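(* Let $\alpha,\beta$ be fixed levels in $(0,1)$, $\mathbb{X}=\mathbb{R}^d$ and let $\nu$ be the Lebesgue measure on $\mathbb{R}^d$. Let $\{k_{m_1},m_1\in\mathcal{M}_1\}$ be a collection of approximation kernels (real functions on $\mathbb{R}^d$) such that $\int_{\mathbb{X}}k_{m_1}^2(x)\,d\nu_x<+\infty$ and $k_{m_1}(x)=k_{m_1}(-x)$, and let $\{h_{m_2},m_2\in\mathcal{M}_2\}$ be a collection where each $h_{m_2}=(h_{m_2,1},\ldots,h_{m_2,d})$ is a vector of $d$ positive bandwidths. Set $\mathcal{M}=\mathcal{M}_1\times\mathcal{M}_2$ and, for all $m=(m_1,m_2)\in\mathcal{M}$, $x=(x_1,\ldots,x_d)$, $x'=(x_1',\ldots,x_d')$ in $\mathbb{R}^d$, $$K_m(x,x')=k_{m_1,h_{m_2}}(x-x')=\frac{1}{\prod_{i=1}^dh_{m_2,i}}k_{m_1}\left(\frac{x_1-x_1'}{h_{m_2,1}},\ldots,\frac{x_d-x_d'}{h_{m_2,d}}\right).$$ Let $\Phi_\alpha$ be the aggregated test (defined in the context) with $\{K_m,m\in\mathcal{M}\}$ and a collection $\{w_m,m\in\mathcal{M}\}$ of positive numbers such that $\sum_{m\in\mathcal{M}}e^{-w_m}\le1$. Then $\Phi_\alpha$ is a level $\alpha$ test, that is, $\mathbb{P}_{f,g}(\Phi_\alpha=1)\le\alpha$ whenever $f=g$. Moreover, there exists an absolute constant $\kappa>0$ such that, for an alternative $(f,g)$ (i.e. $f\neq g$), if $$\|f-g\|^2\ge\inf_{(m_1,m_2)\in\mathcal{M}}\left\{\|(f-g)-k_{m_1,h_{m_2}}*(f-g)\|^2+\frac{4+2\sqrt2\,\kappa(\ln(2/\alpha)+w_m)}{n\sqrt\beta}\sqrt{\frac{\|f+g\|_\infty\|f+g\|_1\|k_{m_1}\|^2}{\prod_{i=1}^dh_{m_2,i}}}\right\}+\frac{8\|f+g\|_\infty}{\beta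 n}$$ (with $m=(m_1,m_2)$), then $\mathbb{P}_{f,g}(\Phi_\alpha=0)\le\beta$.
   Context: Let $n>0$ be a number and $d\mu=n\,d\nu$. $N^1$ and $N^{-1}$ are independent Poisson processes on $\mathbb{X}$ with intensities $f$ and $g$ with respect to $\mu$; $\mathbb{P}_{f,g}$ is their joint distribution. The null hypothesis is $f=g$, the alternative $f\neq g$. Notation: $\|h\|_\infty=\sup_{x\in\mathbb{X}}|h(x)|$, $\|h\|_1=\int_{\mathbb{X}}|h|\,d\nu$, $\|h\|=(\int_{\mathbb{X}}h^2d\nu)^{1/2}$; $*$ is convolution with respect to $\nu$. Standing assumptions: $\|f\|_1,\|g\|_1,\|f\|_\infty,\|g\|_\infty<+\infty$. $N$ is the pooled process (point measure $dN=dN^1+dN^{-1}$), with $N_n$ points $X_1,\ldots,X_{N_n}$; for $x\in N$, $\varepsilon^0_x=1$ if $x$ belongs to $N^1$ and $\varepsilon^0_x=-1$ if $x$ belongs to $N^{-1}$. $(\varepsilon_i)_{i\in\mathbb{N}}$ are i.i.d. Rademacher variables independent of $N$. For a symmetric kernel $K:\mathbb{X}\times\mathbb{X}\to\mathbb{R}$ with $\int_{\mathbb{X}^2}K^2(x,x')(f+g)(x)(f+g)(x')\,d\nu_xd\nu_{x'}<+\infty$, set $\hat T_K=\sum_{x\ne x'\in N}K(x,x')\varepsilon^0_x\varepsilon^0_{x'}$ and $\hat T_K^{\varepsilon}=\sum_{i\ne i'\in\{1,\ldots,N_n\}}K(X_i,X_{i'})\varepsilon_i\varepsilon_{i'}$.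 Aggregated test associated with a finite collection of such kernels $\{K_m,m\in\mathcal{M}\}$ and positive weights $\{w_m,m\in\mathcal{M}\}$ with $\sum_{m\in\mathcal{M}}e^{-w_m}\le1$: for $u\in(0,1)$, $q^{(N)}_{m,1-u}$ denotes the $(1-u)$ quantile of $\hat T_{K_m}^{\varepsilon}$ conditionally on $N$. Set $$u_\alpha^{(N)}=\sup\left\{u>0:\ \mathbb{P}\left(\sup_{m\in\mathcal{M}}\left(\hat T_{K_m}^{\varepsilon}-q^{(N)}_{m,1-ue^{-w_m}}\right)>0\,\Big|\,N\right)\le\alpha\right\},$$ $$\Phi_\alpha=\mathbf{1}_{\sup_{m\in\mathcal{M}}\left(\hat T_{K_m}-q^{(N)}_{m,1-u_\alpha^{(N)}e^{-w_m}}\right)>0}.$$ The test rejects $f=g$ when $\Phi_\alpha=1$. *)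

theory Defs
  imports "HOL-Probability.Probability"
begin

section \<open>Poisson processes\<close>

text \<open>
  A realisation of a point process on the space of \<open>L\<close> is a set of points. Sets suffice (there are
  no multiple points) because the intensities below are absolutely continuous with respect to
  Lebesgue measure on a space of positive dimension.
\<close>

definition num_points :: "'a set \<Rightarrow> 'a set \<Rightarrow> ennreal" where
  "num_points S B = emeasure (count_space UNIV) (S \<inter> B)"

definition configs :: "'a measure \<Rightarrow> 'a set measure" where
  "configs L = sigma (Pow (space L))
     {{S \<in> Pow (space L). num_points S B \<in> A} | A B. A \<in> sets borel \<and> B \<in> sets L}"

text \<open>\<open>N\<close> is a Poisson process with intensity measure \<open>L\<close> on the probability space \<open>M\<close>.\<close>

definition poisson_process :: "'w measure \<Rightarrow> 'a measure \<Rightarrow> ('w \<Rightarrow> 'a set) \<Rightarrow> bool" where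
  "poisson_process M L N \<longleftrightarrow>
     prob_space M \<and>
     N \<in> measurable M (configs L) \<and>
     (\<forall>B\<in>sets L. emeasure L B < \<infinity> \<longrightarrow>
        (\<forall>k::nat. measure M {\<omega> \<in> space M. num_points (N \<omega>) B = of_nat k}
                   = exp (- measure L B) * measure L B ^ k / fact k)) \<and>
     (\<forall>B\<in>sets L. emeasure L B = \<infinity> \<longrightarrow> (AE \<omega> in M. num_points (N \<omega>) B = \<infinity>)) \<and>
     (\<forall>B::nat \<Rightarrow> 'a set. range B \<subseteq> sets L \<and> disjoint_family B \<longrightarrow>
        prob_space.indep_vars M (\<lambda>_. borel) (\<lambda>i \<omega>. num_points (N \<omega>) (B i)) UNIV)"

text \<open>
  \<open>P\<close> is the joint distribution of two independent Poisson processes with intensities \<open>f\<close> and \<open>g\<close>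
  with respect to the measure \<open>n \<cdot> \<nu>\<close>; the two processes are the coordinates of a pair of
  configurations.
\<close>

definition joint_law ::
  "'a measure \<Rightarrow> real \<Rightarrow> ('a \<Rightarrow> real) \<Rightarrow> ('a \<Rightarrow> real) \<Rightarrow> ('a set \<times> 'a set) measure \<Rightarrow> bool" where
  "joint_law \<nu> n f g P \<longleftrightarrow>
     prob_space P \<and>
     sets P = sets (configs \<nu> \<Otimes>\<^sub>M configs \<nu>) \<and>
     poisson_process P (density (scale_measure (ennreal n) \<nu>) (\<lambda>x. ennreal (f x))) fst \<and>
     poisson_process P (density (scale_measure (ennreal n) \<nu>) (\<lambda>x. ennreal (g x))) snd \<and>
     prob_space.indep_var P (configs \<nu>) fst (configs \<nu>) snd"


section \<open>Norms and admissible intensities\<close>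

definition sup_norm :: "'a measure \<Rightarrow> ('a \<Rightarrow> real) \<Rightarrow> real" where
  "sup_norm \<nu> h = (SUP x\<in>space \<nu>. \<bar>h x\<bar>)"

definition l1_norm :: "'a measure \<Rightarrow> ('a \<Rightarrow> real) \<Rightarrow> real" where
  "l1_norm \<nu> h = (\<integral>x. \<bar>h x\<bar> \<partial>\<nu>)"

definition l2_norm :: "'a measure \<Rightarrow> ('a \<Rightarrow> real) \<Rightarrow> real" where
  "l2_norm \<nu> h = sqrt (\<integral>x. (h x)\<^sup>2 \<partial>\<nu>)"

definition intensity :: "'a measure \<Rightarrow> ('a \<Rightarrow> real) \<Rightarrow> bool" where
  "intensity \<nu> f \<longleftrightarrow> integrable \<nu> f \<and> bounded (f ` space \<nu>) \<and> (\<forall>x\<in>space \<nu>. 0 \<le> f x)"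


section \<open>Test statistics\<close>

definition mark :: "'a set \<times> 'a set \<Rightarrow> 'a \<Rightarrow> real" where
  "mark N x = (if x \<in> fst N then 1 else -1)"

definition pooled :: "'a set \<times> 'a set \<Rightarrow> 'a set" where
  "pooled N = fst N \<union> snd N"

definition T_stat :: "('a \<Rightarrow> 'a \<Rightarrow> real) \<Rightarrow> 'a set \<times> 'a set \<Rightarrow> real" where
  "T_stat K N =
     (\<Sum>(x, x')\<in>{(x, x'). x \<in> pooled N \<and> x' \<in> pooled N \<and> x \<noteq> x'}. K x x' * mark N x * mark N x')"

text \<open>Independent Rademacher variables, realised as the coordinates of an infinite product.\<close>

definition rademacher_seq :: "(nat \<Rightarrow> real) measure" where
  "rademacher_seq = (\<Pi>\<^sub>M i\<in>UNIV. measure_pmf (pmf_of_set {-1, 1}))"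

text \<open>An arbitrary enumeration of \<open>S\<close>; the law of \<open>T_boot K S\<close> does not depend on the choice.\<close>

definition points :: "'a set \<Rightarrow> nat \<Rightarrow> 'a" where
  "points S = (SOME X. bij_betw X {1..card S} S)"

definition T_boot :: "('a \<Rightarrow> 'a \<Rightarrow> real) \<Rightarrow> 'a set \<Rightarrow> (nat \<Rightarrow> real) \<Rightarrow> real" where
  "T_boot K S \<epsilon> =
     (\<Sum>(i, i')\<in>{(i, i'). i \<in> {1..card S} \<and> i' \<in> {1..card S} \<and> i \<noteq> i'}.
        K (points S i) (points S i') * \<epsilon> i * \<epsilon> i')"


section \<open>The aggregated test\<close>

text \<open>
  The right-continuous (largest) \<open>p\<close>-quantile of a law \<open>D\<close>. The choice matters, since it is applied
  to laws with finite support: it makes the supremum in \<open>u_agg\<close> attained. With the left-continuous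
  inverse \<open>inf {t. p \<le> cdf D t}\<close> that supremum is in general not attained, and the test evaluated
  at it can exceed its level. The quantile is finite for \<open>0 \<le> p < 1\<close> and \<open>-\<infinity>\<close> for \<open>p < 0\<close>.
\<close>

definition quantile :: "real measure \<Rightarrow> real \<Rightarrow> ereal" where
  "quantile D p = (INF t\<in>{t. p < cdf D t}. ereal t)"

text \<open>
  The signs are independent of the pooled process, so conditioning on the latter being equal to
  \<open>S\<close> amounts to taking probabilities over the signs only, with \<open>S\<close> fixed.
\<close>

definition cond_quantile :: "('a \<Rightarrow> 'a \<Rightarrow> real) \<Rightarrow> 'a set \<Rightarrow> real \<Rightarrow> ereal" where
  "cond_quantile K S p = quantile (distr rademacher_seq borel (T_boot K S)) p"

definition u_agg ::
  "real \<Rightarrow> 'm set \<Rightarrow> ('m \<Rightarrow> 'a \<Rightarrow> 'a \<Rightarrow> real) \<Rightarrow> ('m \<Rightarrow> real) \<Rightarrow> 'a set \<Rightarrow> real" where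
  "u_agg \<alpha> \<M> K w S =
     Sup {u. 0 < u \<and>
       measure rademacher_seq {\<epsilon> \<in> space rademacher_seq.
         (SUP m\<in>\<M>. ereal (T_boot (K m) S \<epsilon>) - cond_quantile (K m) S (1 - u * exp (- w m))) > 0}
       \<le> \<alpha>}"

definition agg_test ::
  "real \<Rightarrow> 'm set \<Rightarrow> ('m \<Rightarrow> 'a \<Rightarrow> 'a \<Rightarrow> real) \<Rightarrow> ('m \<Rightarrow> real) \<Rightarrow> 'a set \<times> 'a set \<Rightarrow> nat" where
  "agg_test \<alpha> \<M> K w N = of_bool
     ((SUP m\<in>\<M>. ereal (T_stat (K m) N)
         - cond_quantile (K m) (pooled N) (1 - u_agg \<alpha> \<M> K w (pooled N) * exp (- w m))) > 0)"


section \<open>Approximation kernels on Euclidean space\<close>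

text \<open>
  Points of \<open>\<real>\<^sup>d\<close> are extensional functions on \<open>{..<d}\<close>, so that the dimension can be quantified
  inside a formula; in particular a constant can be required not to depend on it.
\<close>

definition lebesgue_n :: "nat \<Rightarrow> (nat \<Rightarrow> real) measure" where
  "lebesgue_n d = (\<Pi>\<^sub>M i\<in>{..<d}. lborel)"

definition vec_minus :: "nat \<Rightarrow> (nat \<Rightarrow> real) \<Rightarrow> (nat \<Rightarrow> real) \<Rightarrow> (nat \<Rightarrow> real)" where
  "vec_minus d x y = (\<lambda>i\<in>{..<d}. x i - y i)"

definition vec_neg :: "nat \<Rightarrow> (nat \<Rightarrow> real) \<Rightarrow> (nat \<Rightarrow> real)" where
  "vec_neg d x = (\<lambda>i\<in>{..<d}. - x i)"

definition rescaled :: "nat \<Rightarrow> ((nat \<Rightarrow> real) \<Rightarrow> real) \<Rightarrow> (nat \<Rightarrow> real) \<Rightarrow> (nat \<Rightarrow> real) \<Rightarrow> real" where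
  "rescaled d k h x = 1 / (\<Prod>i<d. h i) * k (\<lambda>i\<in>{..<d}. x i / h i)"

definition conv_n ::
  "nat \<Rightarrow> ((nat \<Rightarrow> real) \<Rightarrow> real) \<Rightarrow> ((nat \<Rightarrow> real) \<Rightarrow> real) \<Rightarrow> (nat \<Rightarrow> real) \<Rightarrow> real" where
  "conv_n d a b x = (\<integral>y. a (vec_minus d x y) * b y \<partial>lebesgue_n d)"

definition approx_kernel :: "nat \<Rightarrow> ((nat \<Rightarrow> real) \<Rightarrow> real) \<Rightarrow> bool" where
  "approx_kernel d k \<longleftrightarrow>
     k \<in> borel_measurable (lebesgue_n d) \<and>
     integrable (lebesgue_n d) (\<lambda>x. (k x)\<^sup>2) \<and>
     (\<forall>x\<in>space (lebesgue_n d). k x = k (vec_neg d x))"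

definition pair_kernel ::
  "nat \<Rightarrow> ('m1 \<Rightarrow> (nat \<Rightarrow> real) \<Rightarrow> real) \<Rightarrow> ('m2 \<Rightarrow> nat \<Rightarrow> real) \<Rightarrow>
     'm1 \<times> 'm2 \<Rightarrow> (nat \<Rightarrow> real) \<Rightarrow> (nat \<Rightarrow> real) \<Rightarrow> real" where
  "pair_kernel d k h m x x' = rescaled d (k (fst m)) (h (snd m)) (vec_minus d x x')"

end

theory Submission
  imports Defs
begin

text \<open>
  Level. Under \<open>f = g\<close>, the labels of the pooled points are independent fair signs given the points, so
  that the test statistics have, given the points, jointly the law of the bootstrap statistics
  (\<open>conditional_level\<close>). The corrected level is defined by this very law, and the supremum in its
  definition is attained because exceeding a right-continuous quantile is a strict inequality in the
  level (\<open>boot_rejections_u_agg\<close>).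

  Power. The corrected level is at least \<open>\<alpha>\<close> by a union bound, so if the test does not reject, then each
  statistic is below its bootstrap quantile of order \<open>1 - \<alpha> exp (- w m)\<close>. A quadratic form in
  Rademacher variables has exponential tails by hypercontractivity (\<open>quadratic_sign_tail\<close>); hence this
  quantile is at most \<open>20 (ln (2 / \<alpha>) + w m)\<close> times the root of the sum of the squared kernel over the pairs
  of points. The expectation of that sum is bounded by \<open>n\<^sup>2\<close> times
  \<open>\<parallel>f + g\<parallel>\<^sub>\<infinity> \<parallel>f + g\<parallel>\<^sub>1 \<parallel>k\<parallel>\<^sup>2 / \<Prod> h\<close>. The statistic itself has expectation \<open>n\<^sup>2 \<langle>k * (f - g), f - g\<rangle>\<close>, where
  polarisation brings in the bias, and a variance bounded by
  \<open>4 n\<^sup>3 \<parallel>f + g\<parallel>\<^sub>\<infinity> \<parallel>k * (f - g)\<parallel>\<^sup>2\<close> plus twice the bound on the expected sum of squares. The separation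
  assumption is what Markov's and Chebyshev's inequality then require (\<open>signal_exceeds_noise\<close>,
  \<open>power_bound\<close>). The constant is \<open>\<kappa> = 20\<close>.

  Representation. Only the joint law of two Poisson processes is given. To compute with it, it is
  identified with the law of an explicit sample: a Poisson number of independent points with
  labels. Both laws have the same void probabilities, and these determine a law of configurations because
  the events of containing no point of a set are stable under intersection and generate the
  counting \<open>\<sigma>\<close>-algebra (\<open>joint_law_eq_distr\<close>). The moments of the statistic are those of a sum over pairs
  of independent variables, with a Poisson number of terms (\<open>square_integrable_kernel\<close>).
\<close>

section \<open>Tails of quadratic forms in Rademacher variables\<close>

definition signs :: "nat \<Rightarrow> (nat \<Rightarrow> real) set" where
  "signs n = PiE {1..n} (\<lambda>_. {-1, 1})"

definition sign_mean :: "nat \<Rightarrow> ((nat \<Rightarrow> real) \<Rightarrow> real) \<Rightarrow> real" where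
  "sign_mean n F = (\<Sum>\<sigma>\<in>signs n. F \<sigma>) / 2 ^ n"

lemma finite_signs [simp]: "finite (signs n)"
  unfolding signs_def by (intro finite_PiE) auto

lemma sum_signs_Suc:
  "(\<Sum>\<sigma>\<in>signs (Suc n). F \<sigma>) = (\<Sum>\<sigma>\<in>signs n. F (\<sigma>(Suc n := 1)) + F (\<sigma>(Suc n := -1)))" for F :: "_ \<Rightarrow> real"
proof -
  have eq: "signs (Suc n) = (\<lambda>(y, g). g(Suc n := y)) ` ({-1, 1} \<times> signs n)"
  proof -
    have "{1..Suc n} = insert (Suc n) {1..n}" by auto
    then show ?thesis unfolding signs_def by (simp only: PiE_insert_eq)
  qed
  have inj: "inj_on (\<lambda>(y, g). g(Suc n := y)) ({-1, 1} \<times> signs n)"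
    unfolding signs_def by (rule inj_combinator) simp
  have "(\<Sum>\<sigma>\<in>signs (Suc n). F \<sigma>) = (\<Sum>(y, g)\<in>{-1, 1} \<times> signs n. F (g(Suc n := y)))"
    unfolding eq by (subst sum.reindex[OF inj]) (simp add: o_def case_prod_unfold)
  also have "\<dots> = (\<Sum>y\<in>{-1, 1}. \<Sum>g\<in>signs n. F (g(Suc n := y)))"
    by (rule sum.cartesian_product[symmetric])
  finally show ?thesis by (simp add: sum.distrib add.commute)
qed

lemma sign_mean_Suc:
  "sign_mean (Suc n) F = sign_mean n (\<lambda>\<sigma>. (F (\<sigma>(Suc n := 1)) + F (\<sigma>(Suc n := -1))) / 2)"
  unfolding sign_mean_def sum_signs_Suc by (simp add: sum_divide_distrib[symmetric])

lemma card_signs: "card (signs n) = 2 ^ n"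
  unfolding signs_def by (subst card_PiE) (auto simp: numeral_2_eq_2)

lemma sign_mean_mono: "(\<And>\<sigma>. F \<sigma> \<le> G \<sigma>) \<Longrightarrow> sign_mean n F \<le> sign_mean n G"
  unfolding sign_mean_def by (intro divide_right_mono sum_mono) auto

lemma sign_mean_cmult: "sign_mean n (\<lambda>\<sigma>. c * F \<sigma>) = c * sign_mean n F"
  unfolding sign_mean_def by (simp add: sum_distrib_left)

lemma sign_mean_add: "sign_mean n (\<lambda>\<sigma>. F \<sigma> + G \<sigma>) = sign_mean n F + sign_mean n G"
  unfolding sign_mean_def by (simp add: sum.distrib add_divide_distrib)

lemma sign_mean_sum: "sign_mean n (\<lambda>\<sigma>. \<Sum>j\<in>J. F j \<sigma>) = (\<Sum>j\<in>J. sign_mean n (F j))"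
  unfolding sign_mean_def by (subst sum.swap) (simp add: sum_divide_distrib)

lemma sign_mean_const [simp]: "sign_mean n (\<lambda>_. c) = c"
  unfolding sign_mean_def by (simp add: card_signs)

text \<open>
  Weighted arithmetic--geometric mean with weights \<open>(q - j) / q\<close> and \<open>j / q\<close>. It is the pointwise
  inequality whose mean, after normalisation, is Hoelder's inequality.
\<close>

lemma power_mult_power_le_weighted:
  fixes x y :: real
  assumes "0 \<le> x" "0 \<le> y" "j \<le> q" "0 < q"
  shows "x ^ (q - j) * y ^ j \<le> (1 - j / q) * x ^ q + (j / q) * y ^ q"
proof (cases "x = 0 \<or> y = 0")
  case True
  then show ?thesis using assms
    by (cases "j = 0"; cases "j = q"; cases "x = 0") (auto simp: power_0_left)
next
  case False
  then have pos: "0 < x" "0 < y" using assms by auto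
  have "(x ^ q) powr (1 - j / q) * (y ^ q) powr (j / q) \<le> (1 - j / q) * x ^ q + (j / q) * y ^ q"
    by (rule Youngs_inequality_0) (use assms pos in \<open>auto simp: field_simps\<close>)
  moreover have "(x ^ q) powr (1 - j / q) = x ^ (q - j)"
  proof -
    have "(x ^ q) powr (1 - j / q) = x powr (real q * (1 - j / q))"
      using pos by (simp add: powr_powr flip: powr_realpow)
    also have "real q * (1 - j / q) = real (q - j)" using assms by (simp add: field_simps of_nat_diff)
    finally show ?thesis using pos by (simp add: powr_realpow)
  qed
  moreover have "(y ^ q) powr (j / q) = y ^ j"
    using pos assms by (simp add: powr_powr flip: powr_realpow)
  ultimately show ?thesis by simp
qed

text \<open>
  Dividing \<open>X\<close> by \<open>a\<close> and \<open>Y\<close> by \<open>b\<close> reduces the claim to the weighted mean inequality; since \<open>a\<close> or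
  \<open>b\<close> may vanish, the division is by \<open>a + e\<close> and \<open>b + e\<close>, and \<open>e\<close> tends to \<open>0\<close> at the end.
\<close>

lemma sign_mean_Hoelder:
  assumes x: "\<And>\<sigma>. 0 \<le> X \<sigma>" and y: "\<And>\<sigma>. 0 \<le> Y \<sigma>"
    and a: "sign_mean n (\<lambda>\<sigma>. X \<sigma> ^ q) \<le> a ^ q" "0 \<le> a"
    and b: "sign_mean n (\<lambda>\<sigma>. Y \<sigma> ^ q) \<le> b ^ q" "0 \<le> b"
    and q: "j \<le> q" "0 < q"
  shows "sign_mean n (\<lambda>\<sigma>. X \<sigma> ^ (q - j) * Y \<sigma> ^ j) \<le> a ^ (q - j) * b ^ j"
proof -
  have pos: "sign_mean n (\<lambda>\<sigma>. X \<sigma> ^ (q - j) * Y \<sigma> ^ j) \<le> (a + e) ^ (q - j) * (b + e) ^ j"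
    if e: "0 < e" for e
  proof -
    let ?a = "a + e" and ?b = "b + e"
    have ab: "0 < ?a" "0 < ?b" using e a b by auto
    have ax: "sign_mean n (\<lambda>\<sigma>. X \<sigma> ^ q) \<le> ?a ^ q"
      using a(1) power_mono[of a ?a q] a(2) e by linarith
    have bx: "sign_mean n (\<lambda>\<sigma>. Y \<sigma> ^ q) \<le> ?b ^ q"
      using b(1) power_mono[of b ?b q] b(2) e by linarith
    have "sign_mean n (\<lambda>\<sigma>. (X \<sigma> / ?a) ^ (q - j) * (Y \<sigma> / ?b) ^ j)
      \<le> sign_mean n (\<lambda>\<sigma>. (1 - j / q) * (X \<sigma> / ?a) ^ q + (j / q) * (Y \<sigma> / ?b) ^ q)"
      by (intro sign_mean_mono power_mult_power_le_weighted) (use x y ab q in auto)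
    also have "\<dots> = (1 - j / q) / ?a ^ q * sign_mean n (\<lambda>\<sigma>. X \<sigma> ^ q) + (j / q) / ?b ^ q * sign_mean n (\<lambda>\<sigma>. Y \<sigma> ^ q)"
      unfolding sign_mean_add sign_mean_cmult[symmetric] by (simp add: power_divide field_simps)
    also have "\<dots> \<le> (1 - j / q) / ?a ^ q * ?a ^ q + (j / q) / ?b ^ q * ?b ^ q"
      by (intro add_mono mult_left_mono ax bx) (use ab q in auto)
    also have "\<dots> = 1" using ab by simp
    also have "sign_mean n (\<lambda>\<sigma>. (X \<sigma> / ?a) ^ (q - j) * (Y \<sigma> / ?b) ^ j)
       = 1 / (?a ^ (q - j) * ?b ^ j) * sign_mean n (\<lambda>\<sigma>. X \<sigma> ^ (q - j) * Y \<sigma> ^ j)"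
      unfolding sign_mean_cmult[symmetric] by (simp add: power_divide)
    finally show ?thesis using ab by (simp add: field_simps)
  qed
  have "((\<lambda>e. (a + e) ^ (q - j) * (b + e) ^ j) \<longlongrightarrow> (a + 0) ^ (q - j) * (b + 0) ^ j) (at_right 0)"
    by (intro tendsto_intros)
  then show ?thesis
    by (simp, elim tendsto_lowerbound) (auto simp: eventually_at_right_less pos intro!: eventually_at_right_less[of 0, THEN eventually_mono])
qed

text \<open>
  This comparison of binomial coefficients is what makes \<open>2 q - 1\<close> the hypercontractivity constant:
  going from \<open>j\<close> to \<open>j + 1\<close> multiplies the left side by \<open>(2 q - 2 j - 1) / (2 j + 1)\<close> relative to
  \<open>q choose j\<close>, which is at most \<open>2 q - 1\<close>.
\<close>

lemma choose_double_le:
  assumes "1 \<le> q"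
  shows "real ((2 * q) choose (2 * j)) \<le> real (2 * q - 1) ^ j * real (q choose j)"
proof (induction j)
  case 0 then show ?case by simp
next
  case (Suc j)
  show ?case
  proof (cases "j < q")
    case False
    then show ?thesis by (simp add: binomial_eq_0)
  next
    case True
    have ratio: "real (Suc k) * real (n choose Suc k) = real (n - k) * real (n choose k)" for n k
      using binomial_absorb_comp[of n k] binomial_absorption[of k n] by (metis of_nat_mult)
    have 1: "real (2 * j + 1) * real ((2 * q) choose (2 * j + 1)) = real (2 * q - 2 * j) * real ((2 * q) choose (2 * j))"
      using ratio[of "2 * j" "2 * q"] by simp
    have 2: "real (2 * j + 2) * real ((2 * q) choose (2 * Suc j)) = real (2 * q - 2 * j - 1) * real ((2 * q) choose (2 * j + 1))"
      using ratio[of "2 * j + 1" "2 * q"] by simp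
    have 3: "real (j + 1) * real (q choose (Suc j)) = real (q - j) * real (q choose j)"
      using ratio[of j q] by simp
    have "real (2 * j + 2) * real (2 * j + 1) * real ((2 * q) choose (2 * Suc j))
        = real (2 * q - 2 * j - 1) * (real (2 * q - 2 * j) * real ((2 * q) choose (2 * j)))"
      using 1 2 by (simp add: mult.assoc mult.left_commute del: of_nat_add of_nat_mult)
    also have "\<dots> \<le> real (2 * q - 1) * real (2 * j + 1) * (real (2 * q - 2 * j) * (real (2 * q - 1) ^ j * real (q choose j)))"
    proof (intro mult_mono Suc)
      have "2 * q - 2 * j - 1 \<le> (2 * q - 1) * (2 * j + 1)" by simp
      then show "real (2 * q - 2 * j - 1) \<le> real (2 * q - 1) * real (2 * j + 1)"
        by (metis of_nat_le_iff of_nat_mult)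
    qed auto
    also have "\<dots> = real (2 * q - 1) ^ Suc j * real (2 * j + 1) * (2 * (real (q - j) * real (q choose j)))"
      using True by (simp add: of_nat_diff algebra_simps)
    also have "\<dots> = real (2 * j + 2) * real (2 * j + 1) * (real (2 * q - 1) ^ Suc j * real (q choose Suc j))"
      unfolding 3[symmetric] by (simp add: algebra_simps)
    finally show ?thesis by (rule mult_left_le_imp_le) auto
  qed
qed

lemma even_power_mean:
  fixes a b :: real
  shows "((a + b) ^ (2 * q) + (a - b) ^ (2 * q)) / 2
    = (\<Sum>j\<le>q. real ((2 * q) choose (2 * j)) * ((a\<^sup>2) ^ (q - j) * (b\<^sup>2) ^ j))"
proof -
  let ?t = "\<lambda>k. real ((2 * q) choose k) * b ^ k * a ^ (2 * q - k)"
  have "(a + b) ^ (2 * q) = (\<Sum>k\<le>2 * q. ?t k)"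
    by (subst add.commute, subst binomial_ring) simp
  moreover have "(a - b) ^ (2 * q) = (\<Sum>k\<le>2 * q. (-1) ^ k * ?t k)"
    using binomial_ring[of "-b" a "2 * q"] by (simp add: power_minus[of b] mult_ac)
  ultimately have "((a + b) ^ (2 * q) + (a - b) ^ (2 * q)) / 2 = (\<Sum>k\<le>2 * q. (1 + (-1) ^ k) / 2 * ?t k)"
    by (simp add: sum.distrib[symmetric] sum_divide_distrib algebra_simps add_divide_distrib)
  also have "\<dots> = (\<Sum>k\<in>(\<lambda>j. 2 * j) ` {..q}. ?t k)"
  proof (rule sum.mono_neutral_cong_right)
    show "\<forall>i\<in>{..2 * q} - (*) 2 ` {..q}. (1 + (-1) ^ i) / 2 * ?t i = 0"
    proof
      fix i assume "i \<in> {..2 * q} - (*) 2 ` {..q}"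
      then have "odd i" by (auto elim!: evenE)
      then show "(1 + (-1) ^ i) / 2 * ?t i = 0" by simp
    qed
  qed auto
  also have "\<dots> = (\<Sum>j\<le>q. ?t (2 * j))"
    by (subst sum.reindex) (auto simp: inj_on_def)
  also have "\<dots> = (\<Sum>j\<le>q. real ((2 * q) choose (2 * j)) * ((a\<^sup>2) ^ (q - j) * (b\<^sup>2) ^ j))"
    by (intro sum.cong) (auto simp: diff_mult_distrib2 simp flip: power_mult)
  finally show ?thesis .
qed

text \<open>
  \<open>chaos d n F V\<close>: \<open>F\<close> is a multilinear polynomial of degree at most \<open>d\<close> in the signs \<open>1, \<dots>, n\<close>
  and \<open>V\<close> is the sum of the squares of its coefficients, hence its second moment. Splitting off the
  last sign, as in the third rule, is the only structure that the moment bound needs; the second rule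
  is the same splitting when no factor of lower degree is left.
\<close>

inductive chaos :: "nat \<Rightarrow> nat \<Rightarrow> ((nat \<Rightarrow> real) \<Rightarrow> real) \<Rightarrow> real \<Rightarrow> bool" where
  const: "chaos d 0 (\<lambda>_. c) (c\<^sup>2)"
| const_Suc: "chaos 0 n F V \<Longrightarrow> chaos 0 (Suc n) F V"
| step: "chaos d n A V \<Longrightarrow> chaos e n B W \<Longrightarrow> d = Suc e \<Longrightarrow>
    chaos d (Suc n) (\<lambda>\<sigma>. A \<sigma> + \<sigma> (Suc n) * B \<sigma>) (V + W)"

lemma chaos_nonneg: "chaos d n F V \<Longrightarrow> 0 \<le> V"
  by (induction rule: chaos.induct) auto

lemma chaos_fun_upd: "chaos d n F V \<Longrightarrow> n < i \<Longrightarrow> F (\<sigma>(i := s)) = F \<sigma>"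
  by (induction arbitrary: i rule: chaos.induct) auto

text \<open>
  Bonami's inequality. Averaging \<open>(A \<plusminus> B) ^ (2 q)\<close> over the last sign leaves the even terms
  \<open>A ^ (2 q - 2 j) * B ^ (2 j)\<close>. By Hoelder's inequality their means are bounded through the induction
  hypotheses for \<open>A\<close> and for \<open>B\<close>, and the loss of one degree in \<open>B\<close> pays for the factor
  \<open>(2 q - 1) ^ j\<close> coming from the binomial coefficients.
\<close>

lemma chaos_hypercontractive:
  assumes "chaos d n F V" and q: "1 \<le> q"
  shows "sign_mean n (\<lambda>\<sigma>. F \<sigma> ^ (2 * q)) \<le> (real (2 * q - 1) ^ d * V) ^ q"
  using assms(1)
proof (induction rule: chaos.induct)
  case (const d c)
  have "1 \<le> real (2 * q - 1) ^ d" using q by (intro one_le_power) auto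
  then have "(c\<^sup>2) ^ q \<le> (real (2 * q - 1) ^ d * c\<^sup>2) ^ q"
    using mult_right_mono[of 1 "real (2 * q - 1) ^ d" "c\<^sup>2"] by (intro power_mono) auto
  then show ?case by (simp add: power_mult)
next
  case (const_Suc n F V)
  then show ?case by (simp add: sign_mean_Suc chaos_fun_upd[OF const_Suc.hyps])
next
  case (step d n A V e B W)
  let ?c = "real (2 * q - 1)"
  let ?a = "?c ^ d * V" and ?b = "?c ^ e * W"
  have nonneg: "0 \<le> ?a" "0 \<le> ?b"
    using chaos_nonneg[OF step.hyps(1)] chaos_nonneg[OF step.hyps(2)] by auto
  have "sign_mean (Suc n) (\<lambda>\<sigma>. (A \<sigma> + \<sigma> (Suc n) * B \<sigma>) ^ (2 * q))
      = sign_mean n (\<lambda>\<sigma>. ((A \<sigma> + B \<sigma>) ^ (2 * q) + (A \<sigma> - B \<sigma>) ^ (2 * q)) / 2)"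
    by (simp add: sign_mean_Suc chaos_fun_upd[OF step.hyps(1)] chaos_fun_upd[OF step.hyps(2)])
  also have "\<dots> = (\<Sum>j\<le>q. real ((2 * q) choose (2 * j)) * sign_mean n (\<lambda>\<sigma>. ((A \<sigma>)\<^sup>2) ^ (q - j) * ((B \<sigma>)\<^sup>2) ^ j))"
    unfolding even_power_mean sign_mean_sum sign_mean_cmult ..
  also have "\<dots> \<le> (\<Sum>j\<le>q. (?c ^ j * real (q choose j)) * (?a ^ (q - j) * ?b ^ j))"
  proof (intro sum_mono mult_mono choose_double_le q)
    fix j assume "j \<in> {..q}"
    then show "sign_mean n (\<lambda>\<sigma>. ((A \<sigma>)\<^sup>2) ^ (q - j) * ((B \<sigma>)\<^sup>2) ^ j) \<le> ?a ^ (q - j) * ?b ^ j"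
      using step.IH nonneg q by (intro sign_mean_Hoelder) (auto simp: power_mult)
  next
    fix j show "0 \<le> sign_mean n (\<lambda>\<sigma>. ((A \<sigma>)\<^sup>2) ^ (q - j) * ((B \<sigma>)\<^sup>2) ^ j)"
      unfolding sign_mean_def by (intro divide_nonneg_nonneg sum_nonneg) auto
  qed auto
  also have "\<dots> = (?c * ?b + ?a) ^ q"
    unfolding binomial_ring by (intro sum.cong) (auto simp: power_mult_distrib)
  also have "?c * ?b + ?a = ?c ^ d * (V + W)" using step.hyps(3) by (simp add: algebra_simps)
  finally show ?case .
qed

lemma chaos_constant: "chaos 0 n (\<lambda>_. c) (c\<^sup>2)"
  by (induction n) (auto intro: chaos.intros)

lemma chaos_zero: "chaos d n (\<lambda>_. 0) 0"
proof (induction n arbitrary: d)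
  case 0 then show ?case using chaos.const[of d 0] by simp
next
  case (Suc n)
  show ?case
  proof (cases d)
    case 0 then show ?thesis using chaos_constant[of "Suc n" 0] by simp
  next
    case d: (Suc d')
    show ?thesis using chaos.step[OF Suc[of d] Suc[of d'] d] by simp
  qed
qed

lemma chaos_linear: "chaos 1 n (\<lambda>\<sigma>. \<Sum>i=1..n. b i * \<sigma> i) (\<Sum>i=1..n. (b i)\<^sup>2)"
proof (induction n)
  case 0 then show ?case using chaos_zero[of 1 0] by simp
next
  case (Suc n)
  show ?case using chaos.step[OF Suc chaos_constant[of n "b (Suc n)"]]
    by (simp add: mult.commute)
qed

definition offdiag :: "nat \<Rightarrow> (nat \<times> nat) set" where
  "offdiag n = {(i, j). i \<in> {1..n} \<and> j \<in> {1..n} \<and> i \<noteq> j}"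

lemma finite_offdiag [simp]: "finite (offdiag n)"
proof (rule finite_subset)
  show "offdiag n \<subseteq> {1..n} \<times> {1..n}" by (auto simp: offdiag_def)
qed simp

lemma sum_offdiag_Suc:
  "(\<Sum>(i, j)\<in>offdiag (Suc n). F i j) = (\<Sum>(i, j)\<in>offdiag n. F i j) + (\<Sum>i=1..n. F i (Suc n) + F (Suc n) i)"
  for F :: "_ \<Rightarrow> _ \<Rightarrow> real"
proof -
  let ?A = "(\<lambda>i. (i, Suc n)) ` {1..n}" and ?B = "(\<lambda>i. (Suc n, i)) ` {1..n}"
  have eq: "offdiag (Suc n) = offdiag n \<union> (?A \<union> ?B)"
    by (auto simp: offdiag_def le_Suc_eq)
  have "(\<Sum>p\<in>offdiag (Suc n). case_prod F p) = sum (case_prod F) (offdiag n) + sum (case_prod F) (?A \<union> ?B)"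
    unfolding eq by (rule sum.union_disjoint, simp, simp) (auto simp: offdiag_def)
  also have "sum (case_prod F) (?A \<union> ?B) = sum (case_prod F) ?A + sum (case_prod F) ?B"
    by (rule sum.union_disjoint) auto
  also have "sum (case_prod F) ?A = (\<Sum>i=1..n. F i (Suc n))"
    by (subst sum.reindex) (auto simp: inj_on_def)
  also have "sum (case_prod F) ?B = (\<Sum>i=1..n. F (Suc n) i)"
    by (subst sum.reindex) (auto simp: inj_on_def)
  finally show ?thesis by (simp only: sum.distrib)
qed

text \<open>
  The factor \<open>2\<close> comes from \<open>(a i j + a j i)\<^sup>2 \<le> 2 ((a i j)\<^sup>2 + (a j i)\<^sup>2)\<close>: both orders of a pair
  contribute to the same monomial.
\<close>

lemma chaos_quadratic:
  "\<exists>V. chaos 2 n (\<lambda>\<sigma>. \<Sum>(i, j)\<in>offdiag n. a i j * \<sigma> i * \<sigma> j) V \<and> V \<le> 2 * (\<Sum>(i, j)\<in>offdiag n. (a i j)\<^sup>2)"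
proof (induction n)
  case 0 then show ?case using chaos_zero[of 2 0] by (auto simp: offdiag_def)
next
  case (Suc n)
  then obtain V where V: "chaos 2 n (\<lambda>\<sigma>. \<Sum>(i, j)\<in>offdiag n. a i j * \<sigma> i * \<sigma> j) V"
    "V \<le> 2 * (\<Sum>(i, j)\<in>offdiag n. (a i j)\<^sup>2)" by blast
  let ?b = "\<lambda>i. a i (Suc n) + a (Suc n) i"
  have "(\<lambda>\<sigma>. (\<Sum>(i, j)\<in>offdiag n. a i j * \<sigma> i * \<sigma> j) + \<sigma> (Suc n) * (\<Sum>i=1..n. ?b i * \<sigma> i))
      = (\<lambda>\<sigma>. \<Sum>(i, j)\<in>offdiag (Suc n). a i j * \<sigma> i * \<sigma> j)"
  proof
    fix \<sigma> :: "nat \<Rightarrow> real"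
    have "\<sigma> (Suc n) * (\<Sum>i=1..n. ?b i * \<sigma> i) = (\<Sum>i=1..n. a i (Suc n) * \<sigma> i * \<sigma> (Suc n) + a (Suc n) i * \<sigma> (Suc n) * \<sigma> i)"
      unfolding sum_distrib_left by (intro sum.cong refl) (simp add: algebra_simps)
    then show "(\<Sum>(i, j)\<in>offdiag n. a i j * \<sigma> i * \<sigma> j) + \<sigma> (Suc n) * (\<Sum>i=1..n. ?b i * \<sigma> i)
       = (\<Sum>(i, j)\<in>offdiag (Suc n). a i j * \<sigma> i * \<sigma> j)"
      by (simp only: sum_offdiag_Suc)
  qed
  moreover have "chaos 2 (Suc n) (\<lambda>\<sigma>. (\<Sum>(i, j)\<in>offdiag n. a i j * \<sigma> i * \<sigma> j) + \<sigma> (Suc n) * (\<Sum>i=1..n. ?b i * \<sigma> i))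
     (V + (\<Sum>i=1..n. (?b i)\<^sup>2))"
    by (rule chaos.step[OF V(1) chaos_linear]) simp
  ultimately have ch: "chaos 2 (Suc n) (\<lambda>\<sigma>. \<Sum>(i, j)\<in>offdiag (Suc n). a i j * \<sigma> i * \<sigma> j)
     (V + (\<Sum>i=1..n. (?b i)\<^sup>2))"
    by (rule subst[where P = "\<lambda>F. chaos 2 (Suc n) F (V + (\<Sum>i=1..n. (?b i)\<^sup>2))"])
  have "(\<Sum>i=1..n. (?b i)\<^sup>2) \<le> (\<Sum>i=1..n. 2 * ((a i (Suc n))\<^sup>2 + (a (Suc n) i)\<^sup>2))"
  proof (rule sum_mono)
    fix i
    show "(?b i)\<^sup>2 \<le> 2 * ((a i (Suc n))\<^sup>2 + (a (Suc n) i)\<^sup>2)"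
      using sum_squares_bound[of "a i (Suc n)" "a (Suc n) i"] by (simp add: power2_sum)
  qed
  then have "V + (\<Sum>i=1..n. (?b i)\<^sup>2) \<le> 2 * (\<Sum>(i, j)\<in>offdiag (Suc n). (a i j)\<^sup>2)"
    unfolding sum_offdiag_Suc using V(2) by (simp add: sum_distrib_left)
  with ch show ?case by blast
qed

text \<open>
  Markov's inequality for the \<open>2 q\<close>-th moment with \<open>q\<close> proportional to \<open>L\<close>. Because the moments of a
  quadratic form grow like \<open>(2 q) ^ (2 q)\<close>, the resulting tail is exponential in \<open>L\<close>.
\<close>

lemma quadratic_sign_tail:
  fixes a :: "nat \<Rightarrow> nat \<Rightarrow> real" and L :: real and n :: nat
  defines "s \<equiv> sqrt (\<Sum>(i, j)\<in>offdiag n. (a i j)\<^sup>2)"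
  assumes L: "ln 2 \<le> L"
  shows "sign_mean n (\<lambda>\<sigma>. of_bool ((\<Sum>(i, j)\<in>offdiag n. a i j * \<sigma> i * \<sigma> j) > 20 * L * s)) \<le> exp (- L)"
proof -
  let ?Q = "\<lambda>\<sigma>. \<Sum>(i, j)\<in>offdiag n. a i j * \<sigma> i * \<sigma> j"
  have s2: "s\<^sup>2 = (\<Sum>(i, j)\<in>offdiag n. (a i j)\<^sup>2)"
    unfolding s_def by (intro real_sqrt_pow2 sum_nonneg) auto
  have s0: "0 \<le> s" unfolding s_def by (intro real_sqrt_ge_zero sum_nonneg) auto
  have L0: "2 / 3 \<le> L" using L ln2_ge_two_thirds by linarith
  show ?thesis
  proof (cases "s = 0")
    case True
    then have "\<forall>p\<in>offdiag n. (case p of (i, j) \<Rightarrow> (a i j)\<^sup>2) = 0"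
      using s2 by (subst sum_nonneg_eq_0_iff[symmetric]) auto
    then have "?Q \<sigma> = 0" for \<sigma>
      by (intro sum.neutral) auto
    then show ?thesis using True by simp
  next
    case False
    \<comment> \<open>\<open>q \<le> L + 1 \<le> 5 / 2 * L\<close> because \<open>L \<ge> ln 2 \<ge> 2 / 3\<close>; then \<open>2 q - 1 \<le> 5 L\<close>, and the constant
      \<open>20\<close> makes each of the \<open>q\<close> factors at most \<open>50 / 400 = 1 / 8 \<le> exp (-1)\<close>.\<close>
    define q where "q = nat \<lceil>L\<rceil>"
    have q: "1 \<le> q" "L \<le> q" "q \<le> 5 / 2 * L"
      using L0 unfolding q_def by linarith+
    define t where "t = 20 * L * s"
    have t: "0 < t" using False s0 L0 unfolding t_def by auto
    obtain V where V: "chaos 2 n ?Q V" "V \<le> 2 * s\<^sup>2"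
      using chaos_quadratic[of n a] s2 by auto
    have V0: "0 \<le> V" by (rule chaos_nonneg[OF V(1)])
    have "sign_mean n (\<lambda>\<sigma>. of_bool (?Q \<sigma> > t)) \<le> sign_mean n (\<lambda>\<sigma>. (1 / t ^ (2 * q)) * ?Q \<sigma> ^ (2 * q))"
    proof (rule sign_mean_mono)
      fix \<sigma>
      show "of_bool (?Q \<sigma> > t) \<le> (1 / t ^ (2 * q)) * ?Q \<sigma> ^ (2 * q)"
        using t power_mono[of t "?Q \<sigma>" "2 * q"]
        by (cases "?Q \<sigma> > t") (auto simp: field_simps zero_le_even_power)
    qed
    also have "\<dots> \<le> (1 / t ^ (2 * q)) * (real (2 * q - 1) ^ 2 * V) ^ q"
      unfolding sign_mean_cmult using t by (intro mult_left_mono chaos_hypercontractive V q) auto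
    also have "\<dots> = ((real (2 * q - 1))\<^sup>2 * V / t\<^sup>2) ^ q"
      by (simp add: power_divide flip: power_mult)
    also have "\<dots> \<le> exp (-1) ^ q"
    proof (rule power_mono)
      have "real (2 * q - 1) \<le> 5 * L" using q by (simp add: of_nat_diff)
      then have "(real (2 * q - 1))\<^sup>2 * V \<le> (5 * L)\<^sup>2 * (2 * s\<^sup>2)"
        by (intro mult_mono power_mono V) (use V0 in auto)
      also have "\<dots> = t\<^sup>2 / 8" unfolding t_def by (simp add: power2_eq_square)
      finally have "(real (2 * q - 1))\<^sup>2 * V / t\<^sup>2 \<le> 1 / 8" using t by (simp add: field_simps)
      also have "1 / 8 \<le> exp (-1 :: real)"
        using exp_le by (simp add: exp_minus field_simps)
      finally show "(real (2 * q - 1))\<^sup>2 * V / t\<^sup>2 \<le> exp (-1)" .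
    qed (use V0 in auto)
    also have "exp (-1 :: real) ^ q = exp (- real q)" by (simp flip: exp_of_nat_mult)
    also have "\<dots> \<le> exp (- L)" using q by simp
    finally show ?thesis unfolding t_def .
  qed
qed

interpretation rademacher: product_prob_space "\<lambda>_. measure_pmf (pmf_of_set {-1, 1 :: real})" UNIV
  by standard

lemma space_rademacher_seq [simp]: "space rademacher_seq = UNIV"
  unfolding rademacher_seq_def by (simp add: space_PiM)

interpretation rademacher_seq: prob_space rademacher_seq
  unfolding rademacher_seq_def by (rule rademacher.prob_space_axioms)

lemma measurable_rademacher_coord [measurable]: "(\<lambda>\<epsilon>. \<epsilon> i) \<in> borel_measurable rademacher_seq"
proof -
  have "(\<lambda>\<epsilon>. \<epsilon> i) \<in> measurable rademacher_seq (measure_pmf (pmf_of_set {-1, 1 :: real}))"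
    unfolding rademacher_seq_def by measurable
  moreover have "(\<lambda>x. x) \<in> measurable (measure_pmf (pmf_of_set {-1, 1 :: real})) borel" by simp
  ultimately show ?thesis by (rule measurable_compose)
qed

lemma AE_rademacher_sign: "AE \<epsilon> in rademacher_seq. \<epsilon> i \<in> {-1, 1}"
proof -
  have "AE x in measure_pmf (pmf_of_set {-1, 1 :: real}). x \<in> {-1, 1}"
    by (simp add: AE_measure_pmf_iff)
  then show ?thesis unfolding rademacher_seq_def by (rule rademacher.AE_component[rotated]) simp
qed

text \<open>
  An event that depends on finitely many coordinates has the same probability under the infinite
  product as under the uniform law on the sign vectors, so that the finite moment calculus applies.
\<close>

lemma measure_rademacher_eq_sign_mean:
  assumes G: "{\<epsilon>. G \<epsilon>} \<in> sets rademacher_seq"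
    and dep: "\<And>\<epsilon>. G \<epsilon> \<longleftrightarrow> G (restrict \<epsilon> {1..n})"
  shows "measure rademacher_seq {\<epsilon>. G \<epsilon>} = sign_mean n (\<lambda>\<sigma>. of_bool (G \<sigma>))"
proof -
  let ?C = "\<lambda>\<sigma>. {\<epsilon>::nat \<Rightarrow> real. \<forall>i\<in>{1..n}. \<epsilon> i \<in> {\<sigma> i}}"
  have C_sets: "?C \<sigma> \<in> sets rademacher_seq" for \<sigma>
  proof -
    have "{\<epsilon> \<in> space rademacher_seq. \<forall>i\<in>{1..n}. \<epsilon> i \<in> {\<sigma> i}} \<in> sets rademacher_seq"
      by measurable
    then show ?thesis by simp
  qed
  have C_measure: "measure rademacher_seq (?C \<sigma>) = 1 / 2 ^ n" if "\<sigma> \<in> signs n" for \<sigma>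
  proof -
    have "?C \<sigma> = {\<epsilon> \<in> space rademacher_seq. \<forall>i\<in>{1..n}. \<epsilon> i \<in> {\<sigma> i}}" by simp
    also have "emeasure rademacher_seq \<dots> = (\<Prod>i\<in>{1..n}. emeasure (measure_pmf (pmf_of_set {-1, 1 :: real})) {\<sigma> i})"
      unfolding rademacher_seq_def by (rule rademacher.emeasure_PiM_Collect) auto
    also have "\<dots> = (\<Prod>i\<in>{1..n}. ennreal (1 / 2))"
      using that by (intro prod.cong) (auto simp: emeasure_pmf_single signs_def PiE_iff pmf_of_set indicator_def)
    also have "\<dots> = ennreal ((1 / 2) ^ n)" by (subst prod_ennreal) auto
    finally show ?thesis by (simp add: measure_def power_divide)
  qed
  have AE: "AE \<epsilon> in rademacher_seq. \<epsilon> \<in> {\<epsilon>. G \<epsilon>} \<longleftrightarrow> \<epsilon> \<in> (\<Union>\<sigma>\<in>{\<sigma>\<in>signs n. G \<sigma>}. ?C \<sigma>)"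
  proof -
    have "AE \<epsilon> in rademacher_seq. \<forall>i\<in>{1..n}. \<epsilon> i \<in> {-1, 1}"
      by (rule AE_finite_allI) (use AE_rademacher_sign in auto)
    then show ?thesis
    proof eventually_elim
      case (elim \<epsilon>)
      have mem: "restrict \<epsilon> {1..n} \<in> signs n" using elim by (auto simp: signs_def)
      have eq: "restrict \<epsilon> {1..n} = \<sigma>" if "\<sigma> \<in> signs n" "\<epsilon> \<in> ?C \<sigma>" for \<sigma>
        using that by (auto simp: signs_def PiE_iff extensional_def fun_eq_iff)
      show ?case
      proof
        assume "\<epsilon> \<in> {\<epsilon>. G \<epsilon>}"
        then have "restrict \<epsilon> {1..n} \<in> {\<sigma>\<in>signs n. G \<sigma>}" using mem dep by blast
        then show "\<epsilon> \<in> (\<Union>\<sigma>\<in>{\<sigma>\<in>signs n. G \<sigma>}. ?C \<sigma>)" by (rule UN_I) simp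
      next
        assume "\<epsilon> \<in> (\<Union>\<sigma>\<in>{\<sigma>\<in>signs n. G \<sigma>}. ?C \<sigma>)"
        then obtain \<sigma> where \<sigma>: "\<sigma> \<in> signs n" "G \<sigma>" "\<epsilon> \<in> ?C \<sigma>" by blast
        then have "G (restrict \<epsilon> {1..n})" using eq[OF \<sigma>(1,3)] by simp
        then show "\<epsilon> \<in> {\<epsilon>. G \<epsilon>}" using dep by blast
      qed
    qed
  qed
  have "measure rademacher_seq {\<epsilon>. G \<epsilon>} = measure rademacher_seq (\<Union>\<sigma>\<in>{\<sigma>\<in>signs n. G \<sigma>}. ?C \<sigma>)"
    using AE by (rule measure_eq_AE) (use G C_sets in auto)
  also have "\<dots> = (\<Sum>\<sigma>\<in>{\<sigma>\<in>signs n. G \<sigma>}. measure rademacher_seq (?C \<sigma>))"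
  proof (rule rademacher_seq.finite_measure_finite_Union)
    show "disjoint_family_on ?C {\<sigma> \<in> signs n. G \<sigma>}"
      unfolding disjoint_family_on_def
    proof (intro ballI impI)
      fix \<sigma> \<tau> assume *: "\<sigma> \<in> {\<sigma> \<in> signs n. G \<sigma>}" "\<tau> \<in> {\<sigma> \<in> signs n. G \<sigma>}" "\<sigma> \<noteq> \<tau>"
      then obtain i where "\<sigma> i \<noteq> \<tau> i" "i \<in> {1..n}"
        unfolding signs_def by (metis (no_types, lifting) PiE_ext mem_Collect_eq)
      then show "?C \<sigma> \<inter> ?C \<tau> = {}" by auto
    qed
  qed (use C_sets in auto)
  also have "\<dots> = (\<Sum>\<sigma>\<in>{\<sigma>\<in>signs n. G \<sigma>}. 1 / 2 ^ n)"
    by (intro sum.cong refl C_measure) simp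
  also have "\<dots> = sign_mean n (\<lambda>\<sigma>. of_bool (G \<sigma>))"
    unfolding sign_mean_def by (simp add: sum.If_cases of_bool_def Int_def)
  finally show ?thesis .
qed

lemma measurable_T_boot [measurable]: "T_boot K S \<in> borel_measurable rademacher_seq"
  unfolding T_boot_def by (auto simp: case_prod_unfold intro!: borel_measurable_sum borel_measurable_times)

definition pair_energy :: "('a \<Rightarrow> 'a \<Rightarrow> real) \<Rightarrow> 'a set \<Rightarrow> real" where
  "pair_energy K S = (\<Sum>(x, x')\<in>{(x, x'). x \<in> S \<and> x' \<in> S \<and> x \<noteq> x'}. (K x x')\<^sup>2)"

lemma points_bij: "finite S \<Longrightarrow> bij_betw (points S) {1..card S} S"
  unfolding points_def by (rule someI_ex[OF ex_bij_betw_nat_finite_1])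

lemma pair_sum_points:
  assumes b: "bij_betw X {1..n} S"
  shows "(\<Sum>(x, x')\<in>{(x, x'). x \<in> S \<and> x' \<in> S \<and> x \<noteq> x'}. F x x') = (\<Sum>(i, j)\<in>offdiag n. F (X i) (X j))"
proof -
  have "bij_betw (\<lambda>(i, j). (X i, X j)) (offdiag n) {(x, x'). x \<in> S \<and> x' \<in> S \<and> x \<noteq> x'}"
    (is "bij_betw ?f _ ?Z")
  proof (rule bij_betw_imageI)
    have inj: "X i = X j \<longleftrightarrow> i = j" if "i \<in> {1..n}" "j \<in> {1..n}" for i j
      using b that unfolding bij_betw_def by (rule_tac inj_on_eq_iff) auto
    have X: "X i \<in> S" if "i \<in> {1..n}" for i
      using b that by (rule bij_betw_apply)
    show "inj_on ?f (offdiag n)"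
      by (rule inj_onI) (clarsimp simp: offdiag_def inj simp del: atLeastAtMost_iff)
    show "?f ` offdiag n = ?Z"
    proof
      show "?f ` offdiag n \<subseteq> ?Z"
        by (clarsimp simp: offdiag_def inj X simp del: atLeastAtMost_iff)
      show "?Z \<subseteq> ?f ` offdiag n"
      proof clarify
        fix x x' assume *: "x \<in> S" "x' \<in> S" "x \<noteq> x'"
        moreover have "S = X ` {1..n}" using b by (simp add: bij_betw_def)
        ultimately obtain i j where "i \<in> {1..n}" "j \<in> {1..n}" "x = X i" "x' = X j" by blast
        with * show "(x, x') \<in> ?f ` offdiag n"
          by (intro image_eqI[of _ _ "(i, j)"]) (auto simp: offdiag_def)
      qed
    qed
  qed
  from sum.reindex_bij_betw[OF this, of "\<lambda>(x, x'). F x x'"]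
  show ?thesis by (simp add: case_prod_unfold)
qed

lemma T_boot_offdiag: "T_boot K S \<epsilon> = (\<Sum>(i, j)\<in>offdiag (card S). K (points S i) (points S j) * \<epsilon> i * \<epsilon> j)"
  unfolding T_boot_def offdiag_def by simp

text \<open>
  Conditionally on the points, the bootstrap statistic is a quadratic form in independent signs, and
  its quantile of order \<open>1 - exp (- L)\<close> is at most a multiple of \<open>L\<close> times the root of the energy.
\<close>

lemma T_boot_tail:
  assumes S: "finite S" and L: "ln 2 \<le> L"
  shows "measure rademacher_seq {\<epsilon>. T_boot K S \<epsilon> > 20 * L * sqrt (pair_energy K S)} \<le> exp (- L)"
proof -
  have "pair_energy K S = (\<Sum>(i, j)\<in>offdiag (card S). (K (points S i) (points S j))\<^sup>2)"
    unfolding pair_energy_def by (rule pair_sum_points[OF points_bij[OF S]])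
  moreover have "measure rademacher_seq {\<epsilon>. T_boot K S \<epsilon> > c} = sign_mean (card S) (\<lambda>\<sigma>. of_bool (T_boot K S \<sigma> > c))" for c
  proof (rule measure_rademacher_eq_sign_mean)
    have "{\<epsilon> \<in> space rademacher_seq. T_boot K S \<epsilon> > c} \<in> sets rademacher_seq" by measurable
    then show "{\<epsilon>. T_boot K S \<epsilon> > c} \<in> sets rademacher_seq" by simp
    show "c < T_boot K S \<epsilon> \<longleftrightarrow> c < T_boot K S (restrict \<epsilon> {1..card S})" for \<epsilon>
    proof -
      have "T_boot K S \<epsilon> = T_boot K S (restrict \<epsilon> {1..card S})"
        unfolding T_boot_def by (intro sum.cong) auto
      then show ?thesis by simp
    qed
  qed
  ultimately show ?thesis
    using quadratic_sign_tail[OF L, of "card S" "\<lambda>i j. K (points S i) (points S j)"]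
    unfolding T_boot_offdiag by simp
qed

section \<open>Quantiles and the corrected level of the aggregated test\<close>

text \<open>
  Exceeding the right-continuous quantile is a condition with a strict inequality in the level \<open>p\<close>.
  This is the form in which the quantile is used from here on: the condition is monotone and open in
  \<open>p\<close>, and no case distinction between finite and infinite quantiles remains.
\<close>

lemma exceeds_quantile_iff:
  "0 < ereal x - quantile D p \<longleftrightarrow> (\<exists>t<x. p < cdf D t)"
proof -
  have "0 < ereal x - quantile D p \<longleftrightarrow> quantile D p < ereal x"
    by (cases "quantile D p") auto
  also have "\<dots> \<longleftrightarrow> (\<exists>t<x. p < cdf D t)"
    unfolding quantile_def INF_less_iff by auto
  finally show ?thesis .
qed

text \<open>
  If the quantile \<open>q\<close> is finite, right-continuity of the distribution function gives \<open>p \<le> cdf M q\<close>.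
  If it is \<open>-\<infinity>\<close>, the distribution function exceeds \<open>p\<close> everywhere and \<open>p \<le> 0\<close>.
\<close>

lemma (in real_distribution) exceeds_quantile_prob:
  assumes p: "p < 1"
  shows "prob {x. \<exists>t<x. p < cdf M t} \<le> 1 - p"
proof -
  let ?A = "{t. p < cdf M t}"
  have "eventually (\<lambda>t. p < cdf M t) at_top"
    by (rule order_tendstoD(1)[OF cdf_lim_at_top_prob p])
  then obtain t0 where "\<forall>t\<ge>t0. p < cdf M t"
    unfolding eventually_at_top_linorder by blast
  then have t0: "p < cdf M t0" by blast
  show ?thesis
  proof (cases "bdd_below ?A")
    case True
    let ?q = "Inf ?A"
    have above: "p < cdf M t" if "?q < t" for t
    proof -
      have "?A \<noteq> {}" using t0 by blast
      then have "\<exists>s\<in>?A. s < t" using that by (rule cInf_lessD)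
      then obtain s where "s \<in> ?A" "s < t" ..
      then show ?thesis using cdf_nondecreasing[of s t] by auto
    qed
    have "p \<le> cdf M ?q"
    proof (rule tendsto_lowerbound)
      show "(cdf M \<longlongrightarrow> cdf M ?q) (at_right ?q)"
        using cdf_is_right_cont[of ?q] by (simp add: continuous_within)
      show "eventually (\<lambda>t. p \<le> cdf M t) (at_right ?q)"
        unfolding eventually_at_right_field using above by (intro exI[of _ "?q + 1"]) (auto intro: less_imp_le)
    qed simp
    moreover have "{x. \<exists>t<x. p < cdf M t} \<subseteq> {?q<..}"
      using True by (auto intro: le_less_trans[OF cInf_lower])
    then have "prob {x. \<exists>t<x. p < cdf M t} \<le> prob {?q<..}"
      by (rule finite_measure_mono) simp
    moreover have "prob {?q<..} = 1 - cdf M ?q"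
      using prob_compl[of "{..?q}"] by (simp add: cdf_def2 Compl_eq_Diff_UNIV[symmetric])
    ultimately show ?thesis by simp
  next
    case False
    have "p < cdf M t" for t
    proof -
      from False obtain s where "s \<in> ?A" "s < t"
        by (meson bdd_belowI not_le)
      then show ?thesis using cdf_nondecreasing[of s t] by auto
    qed
    then have "p \<le> 0"
      by (intro tendsto_lowerbound[OF cdf_lim_at_bot]) (auto intro!: always_eventually less_imp_le)
    then show ?thesis using prob_le_1[of "{x. \<exists>t<x. p < cdf M t}"] by linarith
  qed
qed

abbreviation boot_cdf :: "('a \<Rightarrow> 'a \<Rightarrow> real) \<Rightarrow> 'a set \<Rightarrow> real \<Rightarrow> real" where
  "boot_cdf K S \<equiv> cdf (distr rademacher_seq borel (T_boot K S))"

lemma real_distribution_boot: "real_distribution (distr rademacher_seq borel (T_boot K S))"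
  by (intro real_distribution.intro real_distribution_axioms.intro rademacher_seq.prob_space_distr) auto

lemma boot_cdf_eq: "boot_cdf K S t = 1 - measure rademacher_seq {\<epsilon>. t < T_boot K S \<epsilon>}"
proof -
  have "boot_cdf K S t = measure rademacher_seq {\<epsilon>. T_boot K S \<epsilon> \<le> t}"
    unfolding cdf_def2 by (subst measure_distr) (auto intro!: arg_cong[where f="measure _"])
  also have "{\<epsilon>. T_boot K S \<epsilon> \<le> t} = space rademacher_seq - {\<epsilon>. t < T_boot K S \<epsilon>}"
    by auto
  also have "measure rademacher_seq \<dots> = 1 - measure rademacher_seq {\<epsilon>. t < T_boot K S \<epsilon>}"
  proof (rule rademacher_seq.prob_compl)
    have "{\<epsilon> \<in> space rademacher_seq. t < T_boot K S \<epsilon>} \<in> sets rademacher_seq" by measurable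
    then show "{\<epsilon>. t < T_boot K S \<epsilon>} \<in> sets rademacher_seq" by simp
  qed
  finally show ?thesis .
qed

text \<open>
  The decision of the aggregated test at the uncorrected level \<open>u\<close> when the statistics take the
  values \<open>T m\<close> and the pooled points form the set \<open>S\<close>.
\<close>

definition rejects :: "real \<Rightarrow> 'm set \<Rightarrow> ('m \<Rightarrow> 'a \<Rightarrow> 'a \<Rightarrow> real) \<Rightarrow> ('m \<Rightarrow> real) \<Rightarrow> 'a set \<Rightarrow> ('m \<Rightarrow> real) \<Rightarrow> bool" where
  "rejects u \<M> K w S T \<longleftrightarrow> (\<exists>m\<in>\<M>. \<exists>t<T m. 1 - u * exp (- w m) < boot_cdf (K m) S t)"

lemma sup_exceeds_iff_rejects:
  "(SUP m\<in>\<M>. ereal (T m) - cond_quantile (K m) S (1 - u * exp (- w m))) > 0 \<longleftrightarrow> rejects u \<M> K w S T"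
  unfolding less_SUP_iff cond_quantile_def exceeds_quantile_iff rejects_def ..

definition boot_rejections :: "real \<Rightarrow> 'm set \<Rightarrow> ('m \<Rightarrow> 'a \<Rightarrow> 'a \<Rightarrow> real) \<Rightarrow> ('m \<Rightarrow> real) \<Rightarrow> 'a set \<Rightarrow> (nat \<Rightarrow> real) set" where
  "boot_rejections u \<M> K w S = {\<epsilon>. rejects u \<M> K w S (\<lambda>m. T_boot (K m) S \<epsilon>)}"

lemma u_agg_eq: "u_agg \<alpha> \<M> K w S = Sup {u. 0 < u \<and> measure rademacher_seq (boot_rejections u \<M> K w S) \<le> \<alpha>}"
  unfolding u_agg_def boot_rejections_def sup_exceeds_iff_rejects by simp

lemma agg_test_eq: "agg_test \<alpha> \<M> K w N = of_bool (rejects (u_agg \<alpha> \<M> K w (pooled N)) \<M> K w (pooled N) (\<lambda>m. T_stat (K m) N))"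
  unfolding agg_test_def sup_exceeds_iff_rejects ..

lemma rejects_mono: "u \<le> v \<Longrightarrow> rejects u \<M> K w S T \<Longrightarrow> rejects v \<M> K w S T"
  unfolding rejects_def by (smt (verit) exp_gt_zero mult_right_mono)

lemma exceed_sets:
  "{\<epsilon>. \<exists>t<T_boot K S \<epsilon>. p < F t} \<in> sets rademacher_seq"
proof -
  have "open (\<Union>t\<in>{t. p < F t}. {t<..})" by auto
  then have "(\<Union>t\<in>{t. p < F t}. {t<..}) \<in> sets borel" by simp
  from measurable_sets[OF measurable_T_boot[of K S] this]
  have "T_boot K S -` (\<Union>t\<in>{t. p < F t}. {t<..}) \<in> sets rademacher_seq" by simp
  also have "T_boot K S -` (\<Union>t\<in>{t. p < F t}. {t<..}) = {\<epsilon>. \<exists>t<T_boot K S \<epsilon>. p < F t}" by auto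
  finally show ?thesis .
qed

lemma boot_rejections_eq:
  "boot_rejections u \<M> K w S = (\<Union>m\<in>\<M>. {\<epsilon>. \<exists>t<T_boot (K m) S \<epsilon>. 1 - u * exp (- w m) < boot_cdf (K m) S t})"
  unfolding boot_rejections_def rejects_def by auto

lemma boot_rejections_sets:
  "finite \<M> \<Longrightarrow> boot_rejections u \<M> K w S \<in> sets rademacher_seq"
  unfolding boot_rejections_eq by (intro sets.finite_UN exceed_sets) auto

text \<open>
  Each kernel contributes at most \<open>u * exp (- w m)\<close> by \<open>exceeds_quantile_prob\<close>, and the exponential weights
  sum to at most \<open>1\<close>.
\<close>

lemma boot_rejections_prob:
  assumes fin: "finite \<M>" and w: "(\<Sum>m\<in>\<M>. exp (- w m)) \<le> 1" and u: "0 < u"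
  shows "measure rademacher_seq (boot_rejections u \<M> K w S) \<le> u"
proof -
  have "measure rademacher_seq (boot_rejections u \<M> K w S)
     \<le> (\<Sum>m\<in>\<M>. measure rademacher_seq {\<epsilon>. \<exists>t<T_boot (K m) S \<epsilon>. 1 - u * exp (- w m) < boot_cdf (K m) S t})"
    unfolding boot_rejections_eq
    by (intro rademacher_seq.finite_measure_subadditive_finite fin) (auto intro: exceed_sets)
  also have "\<dots> \<le> (\<Sum>m\<in>\<M>. u * exp (- w m))"
  proof (rule sum_mono)
    fix m
    interpret D: real_distribution "distr rademacher_seq borel (T_boot (K m) S)"
      by (rule real_distribution_boot)
    let ?A = "{x. \<exists>t<x. 1 - u * exp (- w m) < boot_cdf (K m) S t}"
    have "open (\<Union>t\<in>{t. 1 - u * exp (- w m) < boot_cdf (K m) S t}. {t<..})" by auto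
    also have "(\<Union>t\<in>{t. 1 - u * exp (- w m) < boot_cdf (K m) S t}. {t<..}) = ?A" by auto
    finally have A: "?A \<in> sets borel" by simp
    have "D.prob ?A \<le> 1 - (1 - u * exp (- w m))"
      by (rule D.exceeds_quantile_prob) (use u in simp)
    moreover have "D.prob ?A = measure rademacher_seq {\<epsilon>. \<exists>t<T_boot (K m) S \<epsilon>. 1 - u * exp (- w m) < boot_cdf (K m) S t}"
      by (subst measure_distr[OF measurable_T_boot A]) (auto intro!: arg_cong[where f="measure _"])
    ultimately show "measure rademacher_seq {\<epsilon>. \<exists>t<T_boot (K m) S \<epsilon>. 1 - u * exp (- w m) < boot_cdf (K m) S t} \<le> u * exp (- w m)"
      by simp
  qed
  also have "\<dots> \<le> u * 1" unfolding sum_distrib_left[symmetric] using w u by (intro mult_left_mono) auto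
  finally show ?thesis by simp
qed

context
  fixes \<alpha> :: real and \<M> :: "'m set" and K :: "'m \<Rightarrow> 'a \<Rightarrow> 'a \<Rightarrow> real" and w :: "'m \<Rightarrow> real" and S :: "'a set"
  assumes \<alpha>: "0 < \<alpha>" "\<alpha> < 1" and fin: "finite \<M>" and ne: "\<M> \<noteq> {}"
    and sum_w: "(\<Sum>m\<in>\<M>. exp (- w m)) \<le> 1"
begin

text \<open>
  A real supremum is meaningful only for a bounded set. As soon as \<open>u * exp (- w m) > 1\<close> the quantile
  is \<open>-\<infinity>\<close> and the bootstrap test rejects with probability \<open>1 > \<alpha>\<close>.
\<close>

lemma admissible_bdd:
  "bdd_above {u. 0 < u \<and> measure rademacher_seq (boot_rejections u \<M> K w S) \<le> \<alpha>}"
proof -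
  obtain m where m: "m \<in> \<M>" using ne by auto
  show ?thesis
  proof (rule bdd_aboveI[of _ "2 * exp (w m)"], clarify, rule ccontr)
    fix u assume u: "0 < u" "measure rademacher_seq (boot_rejections u \<M> K w S) \<le> \<alpha>" "\<not> u \<le> 2 * exp (w m)"
    have "2 < u * exp (- w m)" using u(3) by (simp add: exp_minus field_simps)
    moreover have "0 \<le> boot_cdf (K m) S t" for t by (simp add: cdf_def2)
    ultimately have "1 - u * exp (- w m) < boot_cdf (K m) S t" for t by (smt (verit))
    then have "\<exists>t<T_boot (K m) S \<epsilon>. 1 - u * exp (- w m) < boot_cdf (K m) S t" for \<epsilon>
      using lt_ex[of "T_boot (K m) S \<epsilon>"] by blast
    then have "boot_rejections u \<M> K w S = UNIV"
      using m unfolding boot_rejections_eq by blast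
    then show False using u(2) \<alpha> rademacher_seq.prob_space by simp
  qed
qed

lemma le_u_agg: "\<alpha> \<le> u_agg \<alpha> \<M> K w S"
  unfolding u_agg_eq
  by (rule cSup_upper[OF _ admissible_bdd]) (use \<alpha> boot_rejections_prob[OF fin sum_w] in auto)

text \<open>
  The supremum defining the corrected level is attained. Rejection is a strict inequality in \<open>u\<close>, so the
  rejection event at the supremum is the increasing union of those at smaller levels, each of which
  has probability at most \<open>\<alpha>\<close>.
\<close>

lemma boot_rejections_u_agg: "measure rademacher_seq (boot_rejections (u_agg \<alpha> \<M> K w S) \<M> K w S) \<le> \<alpha>"
proof -
  let ?U = "{u. 0 < u \<and> measure rademacher_seq (boot_rejections u \<M> K w S) \<le> \<alpha>}"
  let ?u = "u_agg \<alpha> \<M> K w S"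
  define v where "v n = ?u * (1 - 1 / real (Suc n))" for n
  let ?B = "\<lambda>n. boot_rejections (v n) \<M> K w S"
  have u0: "0 < ?u" using le_u_agg \<alpha> by linarith
  have mono: "boot_rejections s \<M> K w S \<subseteq> boot_rejections t \<M> K w S" if "s \<le> t" for s t
    unfolding boot_rejections_def using rejects_mono[OF that] by auto
  have inc: "incseq ?B"
  proof (rule incseq_SucI, rule mono)
    fix n
    have "1 / real (Suc (Suc n)) \<le> 1 / real (Suc n)" by (simp add: frac_le)
    then show "v n \<le> v (Suc n)" unfolding v_def using u0 by (intro mult_left_mono) auto
  qed
  have lim: "v \<longlonglongrightarrow> ?u"
  proof -
    have "v \<longlonglongrightarrow> ?u * (1 - 0)"
      unfolding v_def using LIMSEQ_inverse_real_of_nat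
      by (intro tendsto_intros) (simp add: inverse_eq_divide)
    then show ?thesis by simp
  qed
  have "boot_rejections ?u \<M> K w S = (\<Union>n. ?B n)"
  proof
    show "(\<Union>n. ?B n) \<subseteq> boot_rejections ?u \<M> K w S"
      using mono u0 by (intro UN_least) (auto simp: v_def mult_left_le)
    show "boot_rejections ?u \<M> K w S \<subseteq> (\<Union>n. ?B n)"
    proof
      fix \<epsilon> assume "\<epsilon> \<in> boot_rejections ?u \<M> K w S"
      then obtain m t where mt: "m \<in> \<M>" "t < T_boot (K m) S \<epsilon>" "1 - ?u * exp (- w m) < boot_cdf (K m) S t"
        unfolding boot_rejections_eq by auto
      have "(\<lambda>n. 1 - v n * exp (- w m)) \<longlonglongrightarrow> 1 - ?u * exp (- w m)"
        by (intro tendsto_intros lim)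
      from order_tendstoD(2)[OF this mt(3)] obtain n where "1 - v n * exp (- w m) < boot_cdf (K m) S t"
        by (auto simp: eventually_sequentially)
      with mt show "\<epsilon> \<in> (\<Union>n. ?B n)" unfolding boot_rejections_eq by auto
    qed
  qed
  moreover have "(\<lambda>n. measure rademacher_seq (?B n)) \<longlonglongrightarrow> measure rademacher_seq (\<Union>n. ?B n)"
    using inc by (intro rademacher_seq.finite_Lim_measure_incseq) (auto intro: boot_rejections_sets[OF fin])
  moreover have "measure rademacher_seq (?B n) \<le> \<alpha>" for n
  proof -
    have "v n < ?u" unfolding v_def using u0 by simp
    moreover have "?U \<noteq> {}" using \<alpha> boot_rejections_prob[OF fin sum_w] by auto
    ultimately obtain x where x: "x \<in> ?U" "v n < x"
      unfolding u_agg_eq using less_cSup_iff[OF _ admissible_bdd] by blast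
    have "measure rademacher_seq (?B n) \<le> measure rademacher_seq (boot_rejections x \<M> K w S)"
      using x(2) by (intro rademacher_seq.finite_measure_mono mono boot_rejections_sets fin) simp
    then show ?thesis using x(1) by simp
  qed
  ultimately show ?thesis by (auto intro: LIMSEQ_le_const2)
qed

text \<open>
  Since the corrected level is at least \<open>\<alpha>\<close>, each single test is at least as powerful as the one at
  level \<open>\<alpha> * exp (- w m)\<close>, whose critical value is controlled by the tail of the bootstrap statistic.
  The tail bound gives probability \<open>\<alpha> / 2 * exp (- w m)\<close>, strictly below the level, as the
  right-continuous quantile requires.
\<close>

lemma T_stat_le_if_not_rejects:
  assumes S: "finite S" and m: "m \<in> \<M>" and w: "0 < w m"
    and not: "\<not> rejects (u_agg \<alpha> \<M> K w S) \<M> K w S T"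
  shows "T m \<le> 20 * (ln (2 / \<alpha>) + w m) * sqrt (pair_energy (K m) S)"
proof (rule ccontr)
  let ?L = "ln (2 / \<alpha>) + w m"
  let ?t = "20 * ?L * sqrt (pair_energy (K m) S)"
  assume "\<not> T m \<le> ?t"
  then have t: "?t < T m" by simp
  have "ln 2 \<le> ln (2 / \<alpha>)" using \<alpha> by (subst ln_le_cancel_iff) (auto simp: field_simps)
  then have L: "ln 2 \<le> ?L" using w by linarith
  have "measure rademacher_seq {\<epsilon>. ?t < T_boot (K m) S \<epsilon>} \<le> exp (- ?L)"
    by (rule T_boot_tail[OF S L])
  also have "exp (- ?L) = \<alpha> / 2 * exp (- w m)"
    using \<alpha> by (simp add: exp_diff exp_minus field_simps exp_add)
  also have "\<dots> < u_agg \<alpha> \<M> K w S * exp (- w m)"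
    using le_u_agg \<alpha> by (intro mult_strict_right_mono) auto
  finally have "1 - u_agg \<alpha> \<M> K w S * exp (- w m) < boot_cdf (K m) S ?t"
    unfolding boot_cdf_eq by simp
  with m t not show False unfolding rejects_def by blast
qed

end

text \<open>
  Every label other than \<open>1\<close> puts the point into the second configuration, so that the pair is defined
  also for label sequences that are not signs, an event of probability \<open>0\<close> below.
\<close>

definition sign_split :: "nat \<Rightarrow> (nat \<Rightarrow> 'a) \<Rightarrow> (nat \<Rightarrow> real) \<Rightarrow> 'a set \<times> 'a set" where
  "sign_split k X \<epsilon> = (X ` {i \<in> {1..k}. \<epsilon> i = 1}, X ` {i \<in> {1..k}. \<epsilon> i \<noteq> 1})"

lemma pooled_sign_split: "pooled (sign_split k X \<epsilon>) = X ` {1..k}"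
  unfolding sign_split_def pooled_def by auto

lemma mark_sign_split:
  assumes "inj_on X {1..k}" "i \<in> {1..k}" "\<epsilon> i \<in> {-1, 1}"
  shows "mark (sign_split k X \<epsilon>) (X i) = \<epsilon> i"
proof -
  have "X i \<in> X ` {i \<in> {1..k}. \<epsilon> i = 1} \<longleftrightarrow> \<epsilon> i = 1"
    using assms(1,2) by (auto dest: inj_onD)
  then show ?thesis using assms(3) unfolding mark_def sign_split_def by auto
qed

lemma T_stat_sign_split:
  assumes "inj_on X {1..k}" "\<And>i. i \<in> {1..k} \<Longrightarrow> \<epsilon> i \<in> {-1, 1}"
  shows "T_stat K (sign_split k X \<epsilon>) = (\<Sum>(i, j)\<in>offdiag k. K (X i) (X j) * \<epsilon> i * \<epsilon> j)"
proof -
  have "bij_betw X {1..k} (X ` {1..k})" using assms(1) by (rule inj_on_imp_bij_betw)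
  then have "T_stat K (sign_split k X \<epsilon>) = (\<Sum>(i, j)\<in>offdiag k.
     K (X i) (X j) * mark (sign_split k X \<epsilon>) (X i) * mark (sign_split k X \<epsilon>) (X j))"
    unfolding T_stat_def pooled_sign_split by (rule pair_sum_points)
  also have "\<dots> = (\<Sum>(i, j)\<in>offdiag k. K (X i) (X j) * \<epsilon> i * \<epsilon> j)"
    by (intro sum.cong refl) (use mark_sign_split[OF assms(1) _ assms(2)] in \<open>auto simp: offdiag_def\<close>)
  finally show ?thesis .
qed

lemma distr_rademacher_reindex:
  assumes "inj f"
  shows "distr rademacher_seq rademacher_seq (\<lambda>\<epsilon> i. \<epsilon> (f i)) = rademacher_seq"
  using distr_PiM_reindex[of UNIV "\<lambda>_. measure_pmf (pmf_of_set {-1, 1 :: real})" f UNIV] assms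
  unfolding rademacher_seq_def by (simp add: prob_space_measure_pmf restrict_UNIV)

text \<open>
  With the points \<open>X 1, \<dots>, X k\<close> fixed and labelled by independent signs, the test statistics have jointly
  the law of the bootstrap statistics. The latter refer to another enumeration of the same points,
  which is absorbed by a permutation of the signs. The conclusion exhibits a measurable set that
  contains almost all rejections, so that it bounds the measure of every measurable part of them.
\<close>

lemma conditional_level:
  assumes \<alpha>: "0 < \<alpha>" "\<alpha> < 1" and fin: "finite \<M>" and ne: "\<M> \<noteq> {}"
    and sum_w: "(\<Sum>m\<in>\<M>. exp (- w m)) \<le> 1" and inj: "inj_on X {1..k}"
  shows "\<exists>A\<in>sets rademacher_seq. measure rademacher_seq A \<le> \<alpha> \<and>
     (AE \<epsilon> in rademacher_seq. agg_test \<alpha> \<M> K w (sign_split k X \<epsilon>) = 1 \<longrightarrow> \<epsilon> \<in> A)"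
proof -
  define S where "S = X ` {1..k}"
  have S: "finite S" "card S = k" unfolding S_def using inj by (auto simp: card_image)
  have pts: "bij_betw (points S) {1..k} S" using points_bij[OF S(1)] S(2) by simp
  \<comment> \<open>\<open>f\<close> extends the change of enumeration by the identity to a permutation of all indices, so that it
    acts on the whole sign sequence.\<close>
  define f where "f l = (if l \<in> {1..k} then the_inv_into {1..k} X (points S l) else l)" for l
  have X: "bij_betw X {1..k} S" using inj unfolding S_def by (rule inj_on_imp_bij_betw)
  have "bij_betw (the_inv_into {1..k} X \<circ> points S) {1..k} {1..k}"
    using pts bij_betw_the_inv_into[OF X] by (rule bij_betw_trans)
  then have bij: "bij_betw f {1..k} {1..k}"
    by (rule bij_betw_cong[THEN iffD1, rotated]) (auto simp: f_def)
  have f_mem: "f l \<in> {1..k}" if "l \<in> {1..k}" for l using bij that by (rule bij_betw_apply)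
  have inj_f: "inj f"
  proof (rule injI)
    fix a b assume ab: "f a = f b"
    have out: "f l = l" if "l \<notin> {1..k}" for l using that unfolding f_def by (rule if_not_P)
    show "a = b"
      using ab bij f_mem out inj_onD[OF bij_betw_imp_inj_on[OF bij], of a b] by metis
  qed
  have Xf: "X (f l) = points S l" if "l \<in> {1..k}" for l
    using that f_the_inv_into_f_bij_betw[OF X, of "points S l"] bij_betw_apply[OF pts that] unfolding f_def by simp
  let ?R = "boot_rejections (u_agg \<alpha> \<M> K w S) \<M> K w S"
  let ?g = "\<lambda>(\<epsilon>::nat \<Rightarrow> real) i. \<epsilon> (f i)"
  have g: "?g \<in> measurable rademacher_seq rademacher_seq"
    unfolding rademacher_seq_def by (rule measurable_PiM_single') (auto simp: space_PiM)
  have R: "?R \<in> sets rademacher_seq" by (rule boot_rejections_sets[OF fin])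
  show ?thesis
  proof (intro bexI conjI)
    show "?g -` ?R \<in> sets rademacher_seq" using measurable_sets[OF g R] by simp
    have "measure rademacher_seq (?g -` ?R) = measure (distr rademacher_seq rademacher_seq ?g) ?R"
      by (subst measure_distr[OF g R]) simp
    then show "measure rademacher_seq (?g -` ?R) \<le> \<alpha>"
      unfolding distr_rademacher_reindex[OF inj_f]
      using boot_rejections_u_agg[OF \<alpha> fin ne sum_w] by simp
    have "AE \<epsilon> in rademacher_seq. \<forall>i\<in>{1..k}. \<epsilon> i \<in> {-1, 1}"
      by (rule AE_finite_allI) (use AE_rademacher_sign in auto)
    then show "AE \<epsilon> in rademacher_seq. agg_test \<alpha> \<M> K w (sign_split k X \<epsilon>) = 1 \<longrightarrow> \<epsilon> \<in> ?g -` ?R"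
    proof eventually_elim
      case (elim \<epsilon>)
      have "T_stat K' (sign_split k X \<epsilon>) = T_boot K' S (?g \<epsilon>)" for K'
      proof -
        have "T_stat K' (sign_split k X \<epsilon>) = (\<Sum>(i, j)\<in>offdiag k. K' (points S i) (points S j)
            * mark (sign_split k X \<epsilon>) (points S i) * mark (sign_split k X \<epsilon>) (points S j))"
          unfolding T_stat_def pooled_sign_split S_def[symmetric] by (rule pair_sum_points[OF pts])
        also have "\<dots> = (\<Sum>(i, j)\<in>offdiag k. K' (points S i) (points S j) * \<epsilon> (f i) * \<epsilon> (f j))"
        proof (intro sum.cong refl, clarify)
          have mark: "mark (sign_split k X \<epsilon>) (points S i) = \<epsilon> (f i)" if "i \<in> {1..k}" for i
            using mark_sign_split[OF inj f_mem[OF that], of \<epsilon>] elim f_mem[OF that] Xf[OF that] by auto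
          fix i j assume "(i, j) \<in> offdiag k"
          then show "K' (points S i) (points S j) * mark (sign_split k X \<epsilon>) (points S i) * mark (sign_split k X \<epsilon>) (points S j)
            = K' (points S i) (points S j) * \<epsilon> (f i) * \<epsilon> (f j)"
            by (simp add: mark offdiag_def)
        qed
        finally show ?thesis unfolding T_boot_offdiag S(2) .
      qed
      then show ?case
        unfolding agg_test_eq pooled_sign_split S_def[symmetric] boot_rejections_def by simp
    qed
  qed
qed

section \<open>Void probabilities determine a law of configurations\<close>

text \<open>
  A configuration is a set, that is, a point process without multiple points, and the law of such a
  process is determined by its void probabilities (Renyi). The events \<open>avoiding L B\<close> are stable
  under intersection because \<open>avoiding L B \<inter> avoiding L C = avoiding L (B \<union> C)\<close>, so it suffices that
  they generate the counting \<open>\<sigma>\<close>-algebra.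
\<close>

definition avoiding :: "'a measure \<Rightarrow> 'a set \<Rightarrow> 'a set set" where
  "avoiding L B = {S \<in> Pow (space L). S \<inter> B = {}}"

lemma num_points_eq_0_iff: "num_points S B = 0 \<longleftrightarrow> S \<inter> B = {}"
  unfolding num_points_def by (subst emeasure_count_space_eq_0) auto

lemma configs_generator_subset:
  "{{S \<in> Pow (space L). num_points S B \<in> A} | A B. A \<in> sets borel \<and> B \<in> sets L} \<subseteq> Pow (Pow (space L))"
  by auto

lemma space_configs [simp]: "space (configs L) = Pow (space L)"
  unfolding configs_def by (rule space_measure_of[OF configs_generator_subset])

lemma sets_configs:
  "sets (configs L) = sigma_sets (Pow (space L))
     {{S \<in> Pow (space L). num_points S B \<in> A} | A B. A \<in> sets borel \<and> B \<in> sets L}"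
  unfolding configs_def by (rule sets_measure_of[OF configs_generator_subset])

lemma avoiding_in_configs: "B \<in> sets L \<Longrightarrow> avoiding L B \<in> sets (configs L)"
  unfolding sets_configs avoiding_def num_points_eq_0_iff[symmetric]
  by (intro sigma_sets.Basic CollectI exI[of _ "{0}"] exI[of _ B]) auto

lemma num_points_eq_SUP:
  "num_points S B = (SUP k. if \<exists>F\<subseteq>S \<inter> B. finite F \<and> card F = k then of_nat k else 0)"
proof (cases "finite (S \<inter> B)")
  case True
  show ?thesis
  proof (rule antisym)
    show "num_points S B \<le> (SUP k. if \<exists>F\<subseteq>S \<inter> B. finite F \<and> card F = k then of_nat k else 0)"
      using True unfolding num_points_def by (intro SUP_upper2[of "card (S \<inter> B)"]) auto
    show "(SUP k. if \<exists>F\<subseteq>S \<inter> B. finite F \<and> card F = k then of_nat k else 0) \<le> num_points S B"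
      using True unfolding num_points_def by (intro SUP_least) (auto intro: card_mono)
  qed
next
  case False
  have "\<exists>F\<subseteq>S \<inter> B. finite F \<and> card F = k" for k
    using infinite_arbitrarily_large[OF False, of k] by blast
  then have "(SUP k. if \<exists>F\<subseteq>S \<inter> B. finite F \<and> card F = k then of_nat k else 0) = (SUP k::nat. of_nat k :: ennreal)"
    by simp
  also have "\<dots> = num_points S B"
    using False unfolding num_points_def by (simp add: ennreal_SUP_of_nat_eq_top)
  finally show ?thesis ..
qed

text \<open>
  Countable measurable partitions that eventually separate any two points. With them the number of
  points in \<open>B\<close> can be read off from the events that a cell contains no point of \<open>B\<close>.
\<close>

locale separating_cells =
  fixes L :: "'a measure" and cell :: "nat \<Rightarrow> 'a \<Rightarrow> 'c::countable"
  assumes cell_sets: "\<And>n j. {x \<in> space L. cell n x = j} \<in> sets L"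
    and separating: "\<And>x y. x \<in> space L \<Longrightarrow> y \<in> space L \<Longrightarrow> x \<noteq> y \<Longrightarrow>
      eventually (\<lambda>n. cell n x \<noteq> cell n y) sequentially"
begin

text \<open>
  At least \<open>k\<close> points lie in \<open>B\<close> iff, at some resolution, at least \<open>k\<close> cells contain a point of \<open>B\<close>:
  finitely many points eventually lie in distinct cells.
\<close>

lemma many_points_iff:
  assumes S: "S \<subseteq> space L"
  shows "(\<exists>F\<subseteq>S \<inter> B. finite F \<and> card F = k) \<longleftrightarrow>
    (\<exists>n. \<exists>J. finite J \<and> card J = k \<and> (\<forall>j\<in>J. S \<inter> (B \<inter> {x \<in> space L. cell n x = j}) \<noteq> {}))"
proof
  assume "\<exists>F\<subseteq>S \<inter> B. finite F \<and> card F = k"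
  then obtain F where F: "F \<subseteq> S \<inter> B" "finite F" "card F = k" by blast
  have "eventually (\<lambda>n. \<forall>x\<in>F. \<forall>y\<in>F. x \<noteq> y \<longrightarrow> cell n x \<noteq> cell n y) sequentially"
  proof (intro eventually_ball_finite F(2) ballI)
    fix x y assume "x \<in> F" "y \<in> F"
    then have "x \<in> space L" "y \<in> space L" using F(1) S by auto
    then show "eventually (\<lambda>n. x \<noteq> y \<longrightarrow> cell n x \<noteq> cell n y) sequentially"
      using separating[of x y] by (cases "x = y") auto
  qed
  then obtain n where n: "inj_on (cell n) F"
    unfolding inj_on_def eventually_sequentially by blast
  have "finite (cell n ` F)" "card (cell n ` F) = k"
    using n F by (auto simp: card_image)
  moreover have "\<forall>j\<in>cell n ` F. S \<inter> (B \<inter> {x \<in> space L. cell n x = j}) \<noteq> {}"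
    using F(1) S by blast
  ultimately show "\<exists>n. \<exists>J. finite J \<and> card J = k \<and> (\<forall>j\<in>J. S \<inter> (B \<inter> {x \<in> space L. cell n x = j}) \<noteq> {})"
    by blast
next
  assume "\<exists>n. \<exists>J. finite J \<and> card J = k \<and> (\<forall>j\<in>J. S \<inter> (B \<inter> {x \<in> space L. cell n x = j}) \<noteq> {})"
  then obtain n J where J: "finite J" "card J = k" "\<forall>j\<in>J. \<exists>x. x \<in> S \<inter> B \<and> cell n x = j" by blast
  from bchoice[OF J(3)] obtain p where p: "\<forall>j\<in>J. p j \<in> S \<inter> B \<and> cell n (p j) = j" by blast
  have "inj_on p J" using p by (metis inj_onI)
  then have "finite (p ` J)" "card (p ` J) = k" using J by (auto simp: card_image)
  moreover have "p ` J \<subseteq> S \<inter> B" using p by blast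
  ultimately show "\<exists>F\<subseteq>S \<inter> B. finite F \<and> card F = k" by blast
qed

lemma sets_configs_eq: "sets (configs L) = sigma_sets (Pow (space L)) (avoiding L ` sets L)"
proof
  show "sigma_sets (Pow (space L)) (avoiding L ` sets L) \<subseteq> sets (configs L)"
    using sets.sigma_sets_subset[of "avoiding L ` sets L" "configs L"] avoiding_in_configs[of _ L] by auto
  let ?N = "sigma (Pow (space L)) (avoiding L ` sets L)"
  have gen: "avoiding L ` sets L \<subseteq> Pow (Pow (space L))" by (auto simp: avoiding_def)
  have space_N: "space ?N = Pow (space L)" using gen by (rule space_measure_of)
  have sets_N: "sets ?N = sigma_sets (Pow (space L)) (avoiding L ` sets L)" using gen by (rule sets_measure_of)
  have meets: "{S \<in> space ?N. S \<inter> B \<noteq> {}} \<in> sets ?N" if "B \<in> sets L" for B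
  proof -
    have "avoiding L B \<in> sets ?N" unfolding sets_N using that by (intro sigma_sets.Basic imageI)
    then have "space ?N - avoiding L B \<in> sets ?N" by (rule sets.compl_sets)
    also have "space ?N - avoiding L B = {S \<in> space ?N. S \<inter> B \<noteq> {}}"
      unfolding space_N avoiding_def by auto
    finally show ?thesis .
  qed
  have many: "{S \<in> space ?N. \<exists>F\<subseteq>S \<inter> B. finite F \<and> card F = k} \<in> sets ?N" if B: "B \<in> sets L" for B k
  proof -
    have "{S \<in> space ?N. \<exists>F\<subseteq>S \<inter> B. finite F \<and> card F = k}
      = (\<Union>n. \<Union>J\<in>{J::'c set. finite J \<and> card J = k}.
           {S \<in> space ?N. \<forall>j\<in>J. S \<inter> (B \<inter> {x \<in> space L. cell n x = j}) \<noteq> {}})"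
      (is "?A = ?B")
    proof (rule set_eqI)
      fix S
      have "S \<in> ?A \<longleftrightarrow> S \<subseteq> space L \<and> (\<exists>F\<subseteq>S \<inter> B. finite F \<and> card F = k)"
        unfolding space_N by simp
      also have "\<dots> \<longleftrightarrow> S \<subseteq> space L \<and>
          (\<exists>n. \<exists>J. finite J \<and> card J = k \<and> (\<forall>j\<in>J. S \<inter> (B \<inter> {x \<in> space L. cell n x = j}) \<noteq> {}))"
        by (rule conj_cong[OF refl many_points_iff])
      also have "\<dots> \<longleftrightarrow> S \<in> ?B"
        unfolding space_N UN_iff mem_Collect_eq Pow_iff by (simp only: bex_UNIV ex_simps Bex_def mem_Collect_eq UNIV_I simp_thms) blast
      finally show "S \<in> ?A \<longleftrightarrow> S \<in> ?B" .
    qed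
    also have "\<dots> \<in> sets ?N"
    proof (rule sets.countable_UN''[OF countableI_type], rule sets.countable_UN'')
      fix n
      show "countable {J::'c set. finite J \<and> card J = k}"
        by (rule countable_subset[OF _ countable_Collect_finite]) auto
      fix J assume "J \<in> {J::'c set. finite J \<and> card J = k}"
      then show "{S \<in> space ?N. \<forall>j\<in>J. S \<inter> (B \<inter> {x \<in> space L. cell n x = j}) \<noteq> {}} \<in> sets ?N"
        by (intro sets.sets_Collect_finite_All meets sets.Int B cell_sets) auto
    qed
    finally show ?thesis .
  qed
  have num: "(\<lambda>S. num_points S B) \<in> borel_measurable ?N" if B: "B \<in> sets L" for B
    unfolding num_points_eq_SUP
    by (intro borel_measurable_SUP measurable_If many B) auto
  have "{{S \<in> Pow (space L). num_points S B \<in> A} | A B. A \<in> sets borel \<and> B \<in> sets L} \<subseteq> sets ?N"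
  proof clarify
    fix A :: "ennreal set" and B assume "A \<in> sets borel" "B \<in> sets L"
    from measurable_sets[OF num[OF this(2)] this(1)]
    have "(\<lambda>S. num_points S B) -` A \<inter> Pow (space L) \<in> sets ?N" by (simp only: space_N)
    also have "(\<lambda>S. num_points S B) -` A \<inter> Pow (space L) = {S \<in> Pow (space L). num_points S B \<in> A}"
      by blast
    finally show "{S \<in> Pow (space L). num_points S B \<in> A} \<in> sets ?N" .
  qed
  from sets.sigma_sets_subset[OF this]
  show "sets (configs L) \<subseteq> sigma_sets (Pow (space L)) (avoiding L ` sets L)"
    by (simp only: space_N sets_N sets_configs)
qed

lemma measurable_configsI:
  assumes "\<And>\<omega>. \<omega> \<in> space M \<Longrightarrow> N \<omega> \<subseteq> space L"
    and "\<And>B. B \<in> sets L \<Longrightarrow> {\<omega> \<in> space M. N \<omega> \<inter> B = {}} \<in> sets M"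
  shows "N \<in> measurable M (configs L)"
proof -
  have "N \<in> measurable M (sigma (Pow (space L)) (avoiding L ` sets L))"
  proof (rule measurable_measure_of)
    show "avoiding L ` sets L \<subseteq> Pow (Pow (space L))" by (auto simp: avoiding_def)
    show "N \<in> space M \<rightarrow> Pow (space L)" using assms(1) by auto
    fix A assume "A \<in> avoiding L ` sets L"
    then obtain B where B: "A = avoiding L B" "B \<in> sets L" by auto
    have "N -` A \<inter> space M = {\<omega> \<in> space M. N \<omega> \<inter> B = {}}"
      unfolding B(1) avoiding_def using assms(1) by auto
    then show "N -` A \<inter> space M \<in> sets M" using assms(2)[OF B(2)] by simp
  qed
  also have "measurable M (sigma (Pow (space L)) (avoiding L ` sets L)) = measurable M (configs L)"
    by (intro measurable_cong_sets refl) (subst sets_measure_of, auto simp: sets_configs_eq avoiding_def)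
  finally show ?thesis .
qed

lemma config_pair_law_eqI:
  assumes P: "prob_space P" "sets P = sets (configs L \<Otimes>\<^sub>M configs L)"
    and Q: "prob_space Q" "sets Q = sets (configs L \<Otimes>\<^sub>M configs L)"
    and eq: "\<And>B C. B \<in> sets L \<Longrightarrow> C \<in> sets L \<Longrightarrow>
      measure P (avoiding L B \<times> avoiding L C) = measure Q (avoiding L B \<times> avoiding L C)"
  shows "P = Q"
proof -
  interpret P: prob_space P by (rule P)
  interpret Q: prob_space Q by (rule Q)
  let ?G = "avoiding L ` sets L"
  let ?E = "{a \<times> b | a b. a \<in> ?G \<and> b \<in> ?G}"
  have whole: "avoiding L {} = Pow (space L)" by (auto simp: avoiding_def)
  have E: "?E \<subseteq> Pow (Pow (space L) \<times> Pow (space L))" by (auto simp: avoiding_def)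
  have "sets (configs L \<Otimes>\<^sub>M configs L) = sets (sigma (space (configs L) \<times> space (configs L)) ?E)"
    by (rule sets_pair_eq[where Ca = "{avoiding L {}}" and Cb = "{avoiding L {}}"])
      (auto simp: sets_configs_eq whole avoiding_def)
  then have sets: "sets (configs L \<Otimes>\<^sub>M configs L) = sigma_sets (Pow (space L) \<times> Pow (space L)) ?E"
    using E by simp
  show ?thesis
  proof (rule measure_eqI_generator_eq[where E = ?E and \<Omega> = "Pow (space L) \<times> Pow (space L)"
        and A = "\<lambda>_. Pow (space L) \<times> Pow (space L)"])
    show "Int_stable ?E"
    proof (rule Int_stableI)
      fix a b assume "a \<in> ?E" "b \<in> ?E"
      then obtain B C B' C' where *: "B \<in> sets L" "C \<in> sets L" "B' \<in> sets L" "C' \<in> sets L"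
        "a = avoiding L B \<times> avoiding L C" "b = avoiding L B' \<times> avoiding L C'" by auto
      have "a \<inter> b = avoiding L (B \<union> B') \<times> avoiding L (C \<union> C')"
        unfolding * avoiding_def by auto
      then show "a \<inter> b \<in> ?E" using * by blast
    qed
    show "range (\<lambda>_. Pow (space L) \<times> Pow (space L)) \<subseteq> ?E"
      using whole by (auto intro!: exI[of _ "Pow (space L)"] image_eqI[of _ _ "{}"])
    fix X assume "X \<in> ?E"
    then show "emeasure P X = emeasure Q X"
      using eq by (auto simp: P.emeasure_eq_measure Q.emeasure_eq_measure)
  qed (use E sets P Q in auto)
qed

end

definition floor_cell :: "nat \<Rightarrow> nat \<Rightarrow> (nat \<Rightarrow> real) \<Rightarrow> int list" where
  "floor_cell d n x = map (\<lambda>i. \<lfloor>real n * x i\<rfloor>) [0..<d]"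

lemma space_lebesgue_n: "space (lebesgue_n d) = {..<d} \<rightarrow>\<^sub>E UNIV"
  unfolding lebesgue_n_def by (simp add: space_PiM)

lemma measurable_lebesgue_coord [measurable]: "i < d \<Longrightarrow> (\<lambda>x. x i) \<in> borel_measurable (lebesgue_n d)"
  unfolding lebesgue_n_def using measurable_component_singleton[of i "{..<d}" "\<lambda>_. lborel"] by simp

interpretation lebesgue_cells: separating_cells "lebesgue_n d" "floor_cell d" for d
proof
  fix n :: nat and j :: "int list"
  have "{x \<in> space (lebesgue_n d). floor_cell d n x = j}
      = {x \<in> space (lebesgue_n d). length j = d \<and> (\<forall>i\<in>{..<d}. \<lfloor>real n * x i\<rfloor> = j ! i)}"
    by (auto simp: floor_cell_def list_eq_iff_nth_eq)
  also have "\<dots> \<in> sets (lebesgue_n d)"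
    by (cases "length j = d") (auto intro!: sets.sets_Collect_finite_All)
  finally show "{x \<in> space (lebesgue_n d). floor_cell d n x = j} \<in> sets (lebesgue_n d)" .
next
  fix x y :: "nat \<Rightarrow> real" assume "x \<in> space (lebesgue_n d)" "y \<in> space (lebesgue_n d)" "x \<noteq> y"
  then obtain i where i: "i < d" "x i \<noteq> y i"
    unfolding space_lebesgue_n by (metis PiE_ext lessThan_iff)
  obtain N where N: "1 < real N * \<bar>x i - y i\<bar>"
    using i ex_less_of_nat_mult[of "\<bar>x i - y i\<bar>" 1] by auto
  show "eventually (\<lambda>n. floor_cell d n x \<noteq> floor_cell d n y) sequentially"
  proof (rule eventually_sequentiallyI[of N], rule notI)
    fix n assume n: "N \<le> n" "floor_cell d n x = floor_cell d n y"
    then have "\<lfloor>real n * x i\<rfloor> = \<lfloor>real n * y i\<rfloor>"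
      using i unfolding floor_cell_def by (auto simp: list_eq_iff_nth_eq)
    then have "\<bar>real n * x i - real n * y i\<bar> < 1" by linarith
    also have "\<bar>real n * x i - real n * y i\<bar> = real n * \<bar>x i - y i\<bar>"
      by (simp add: abs_mult flip: right_diff_distrib)
    finally have "real n * \<bar>x i - y i\<bar> < 1" .
    moreover have "real N * \<bar>x i - y i\<bar> \<le> real n * \<bar>x i - y i\<bar>"
      using n by (intro mult_right_mono) auto
    ultimately show False using N by linarith
  qed
qed

lemma poisson_void:
  assumes P: "poisson_process P (density (scale_measure (ennreal n) \<nu>) (\<lambda>x. ennreal (f x))) N"
    and f: "intensity \<nu> f" and n: "0 < n" and B: "B \<in> sets \<nu>"
  shows "measure P {\<omega> \<in> space P. N \<omega> \<inter> B = {}} = exp (- (n * (\<integral>x. f x * indicator B x \<partial>\<nu>)))"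
proof -
  let ?L = "density (scale_measure (ennreal n) \<nu>) (\<lambda>x. ennreal (f x))"
  have int: "integrable \<nu> (\<lambda>x. f x * indicator B x)"
    using f B unfolding intensity_def by (intro integrable_real_mult_indicator) auto
  have "emeasure ?L B = (\<integral>\<^sup>+x. ennreal (f x) * indicator B x \<partial>scale_measure (ennreal n) \<nu>)"
    using f B unfolding intensity_def by (intro emeasure_density) auto
  also have "\<dots> = ennreal n * (\<integral>\<^sup>+x. ennreal (f x) * indicator B x \<partial>\<nu>)"
    using f B unfolding intensity_def by (intro nn_integral_scale_measure) auto
  also have "(\<integral>\<^sup>+x. ennreal (f x) * indicator B x \<partial>\<nu>) = (\<integral>\<^sup>+x. ennreal (f x * indicator B x) \<partial>\<nu>)"
    by (intro nn_integral_cong) (auto simp: indicator_def)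
  also have "\<dots> = ennreal (\<integral>x. f x * indicator B x \<partial>\<nu>)"
    using f unfolding intensity_def by (intro nn_integral_eq_integral int AE_I2) auto
  finally have em: "emeasure ?L B = ennreal (n * (\<integral>x. f x * indicator B x \<partial>\<nu>))"
    using n by (simp add: ennreal_mult')
  have nonneg: "0 \<le> (\<integral>x. f x * indicator B x \<partial>\<nu>)"
    using f unfolding intensity_def by (intro Bochner_Integration.integral_nonneg_AE AE_I2) auto
  have "B \<in> sets ?L" "emeasure ?L B < \<infinity>" using B em by auto
  with P have "measure P {\<omega> \<in> space P. num_points (N \<omega>) B = of_nat 0} = exp (- measure ?L B) * measure ?L B ^ 0 / fact 0"
    unfolding poisson_process_def by blast
  then show ?thesis using em nonneg n by (simp add: num_points_eq_0_iff measure_def)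
qed

text \<open>
  Any construction of a pair of configurations with the void probabilities of two independent Poisson
  processes has their joint law. Void probabilities of Poisson processes are the counting
  probabilities for \<open>k = 0\<close>, and those of the pair factorise by independence.
\<close>

lemma joint_law_eq_distr:
  fixes d :: nat
  defines "\<nu> \<equiv> lebesgue_n d"
  assumes P: "joint_law \<nu> n f g P" and f: "intensity \<nu> f" and g: "intensity \<nu> g" and n: "0 < n"
    and M: "prob_space M" and N: "N \<in> measurable M (configs \<nu> \<Otimes>\<^sub>M configs \<nu>)"
    and void: "\<And>B C. B \<in> sets \<nu> \<Longrightarrow> C \<in> sets \<nu> \<Longrightarrow>
      measure M {\<omega> \<in> space M. fst (N \<omega>) \<inter> B = {} \<and> snd (N \<omega>) \<inter> C = {}}
        = exp (- (n * (\<integral>x. f x * indicator B x \<partial>\<nu>))) * exp (- (n * (\<integral>x. g x * indicator C x \<partial>\<nu>)))"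
  shows "P = distr M (configs \<nu> \<Otimes>\<^sub>M configs \<nu>) N"
  unfolding \<nu>_def
proof (rule lebesgue_cells.config_pair_law_eqI)
  interpret P: prob_space P using P unfolding joint_law_def by simp
  interpret M: prob_space M by (rule M)
  show "prob_space P" by (rule P.prob_space_axioms)
  have sets_P: "sets P = sets (configs \<nu> \<Otimes>\<^sub>M configs \<nu>)" using P unfolding joint_law_def by simp
  then show "sets P = sets (configs (lebesgue_n d) \<Otimes>\<^sub>M configs (lebesgue_n d))" unfolding \<nu>_def .
  have space_P: "space P = Pow (space \<nu>) \<times> Pow (space \<nu>)"
    using sets_eq_imp_space_eq[OF sets_P] by (simp add: space_pair_measure)
  show "prob_space (distr M (configs (lebesgue_n d) \<Otimes>\<^sub>M configs (lebesgue_n d)) N)"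
    using N unfolding \<nu>_def by (rule M.prob_space_distr)
  fix B C assume BC: "B \<in> sets (lebesgue_n d)" "C \<in> sets (lebesgue_n d)"
  then have BC': "B \<in> sets \<nu>" "C \<in> sets \<nu>" unfolding \<nu>_def by auto
  have A: "avoiding \<nu> B \<in> sets (configs \<nu>)" "avoiding \<nu> C \<in> sets (configs \<nu>)"
    using BC' by (auto intro: avoiding_in_configs)
  have pp: "poisson_process P (density (scale_measure (ennreal n) \<nu>) (\<lambda>x. ennreal (f x))) fst"
    "poisson_process P (density (scale_measure (ennreal n) \<nu>) (\<lambda>x. ennreal (g x))) snd"
    and ind: "P.indep_var (configs \<nu>) fst (configs \<nu>) snd"
    using P unfolding joint_law_def by auto
  have "avoiding \<nu> B \<times> avoiding \<nu> C = (\<lambda>\<omega>. (fst \<omega>, snd \<omega>)) -` (avoiding \<nu> B \<times> avoiding \<nu> C) \<inter> space P"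
    unfolding space_P avoiding_def by auto
  then have "measure P (avoiding \<nu> B \<times> avoiding \<nu> C)
      = P.prob (fst -` avoiding \<nu> B \<inter> space P) * P.prob (snd -` avoiding \<nu> C \<inter> space P)"
    using P.indep_varD[OF ind A] by simp
  also have "fst -` avoiding \<nu> B \<inter> space P = {\<omega> \<in> space P. fst \<omega> \<inter> B = {}}"
    unfolding space_P avoiding_def by auto
  also have "snd -` avoiding \<nu> C \<inter> space P = {\<omega> \<in> space P. snd \<omega> \<inter> C = {}}"
    unfolding space_P avoiding_def by auto
  finally have 1: "measure P (avoiding \<nu> B \<times> avoiding \<nu> C) =
      exp (- (n * (\<integral>x. f x * indicator B x \<partial>\<nu>))) * exp (- (n * (\<integral>x. g x * indicator C x \<partial>\<nu>)))"
    by (simp add: poisson_void[OF pp(1) f n BC'(1)] poisson_void[OF pp(2) g n BC'(2)])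
  have "measure (distr M (configs \<nu> \<Otimes>\<^sub>M configs \<nu>) N) (avoiding \<nu> B \<times> avoiding \<nu> C)
      = measure M (N -` (avoiding \<nu> B \<times> avoiding \<nu> C) \<inter> space M)"
    using A by (intro measure_distr[OF N]) auto
  also have "N -` (avoiding \<nu> B \<times> avoiding \<nu> C) \<inter> space M
      = {\<omega> \<in> space M. fst (N \<omega>) \<inter> B = {} \<and> snd (N \<omega>) \<inter> C = {}}"
    using measurable_space[OF N] by (force simp: space_pair_measure avoiding_def)
  finally show "measure P (avoiding (lebesgue_n d) B \<times> avoiding (lebesgue_n d) C)
      = measure (distr M (configs (lebesgue_n d) \<Otimes>\<^sub>M configs (lebesgue_n d)) N) (avoiding (lebesgue_n d) B \<times> avoiding (lebesgue_n d) C)"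
    using 1 void[OF BC'] unfolding \<nu>_def by simp
qed simp

section \<open>Moments of a pair statistic of a Poissonised sample\<close>

text \<open>
  The Poisson law, including the degenerate one with mean \<open>0\<close>, which occurs when there are almost surely
  no points.
\<close>

definition pois :: "real \<Rightarrow> nat pmf" where
  "pois l = (if 0 < l then poisson_pmf l else return_pmf 0)"

lemma pmf_pois: "0 \<le> l \<Longrightarrow> pmf (pois l) k = l ^ k / fact k * exp (- l)"
  unfolding pois_def by (cases "l = 0"; cases k) auto

lemma nn_integral_pois_sums:
  assumes "0 \<le> l" "\<And>k. 0 \<le> F k" "(\<lambda>k. pmf (pois l) k * F k) sums s"
  shows "(\<integral>\<^sup>+k. ennreal (F k) \<partial>measure_pmf (pois l)) = ennreal s"
proof -
  have "(\<integral>\<^sup>+k. ennreal (F k) \<partial>measure_pmf (pois l)) = (\<Sum>k. ennreal (pmf (pois l) k * F k))"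
    unfolding nn_integral_measure_pmf nn_integral_count_space_nat
    using assms(2) by (simp add: ennreal_mult)
  also have "\<dots> = ennreal s" using assms by (intro suminf_ennreal_eq) auto
  finally show ?thesis .
qed

lemma pois_generating:
  assumes l: "0 \<le> l" and p: "0 \<le> p"
  shows "(\<integral>\<^sup>+k. ennreal (p ^ k) \<partial>measure_pmf (pois l)) = ennreal (exp (l * (p - 1)))"
proof (rule nn_integral_pois_sums[OF l])
  have "(\<lambda>k. exp (- l) * ((l * p) ^ k /\<^sub>R fact k)) sums (exp (- l) * exp (l * p))"
    by (intro sums_mult exp_converges)
  also have "(\<lambda>k. exp (- l) * ((l * p) ^ k /\<^sub>R fact k)) = (\<lambda>k. pmf (pois l) k * p ^ k)"
    unfolding pmf_pois[OF l] by (simp add: fun_eq_iff power_mult_distrib field_simps)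
  also have "exp (- l) * exp (l * p) = exp (l * (p - 1))" by (simp add: algebra_simps flip: exp_add)
  finally show "(\<lambda>k. pmf (pois l) k * p ^ k) sums exp (l * (p - 1))" .
qed (use p in auto)

lemma falling_factorial_binomial: "(\<Prod>i<r. real k - real i) = fact r * real (k choose r)"
  by (simp add: binomial_gbinomial gbinomial_mult_fact lessThan_atLeast0)

lemma pois_factorial_moment:
  assumes l: "0 \<le> l"
  shows "has_bochner_integral (measure_pmf (pois l)) (\<lambda>k. \<Prod>i<r. real k - real i) (l ^ r)"
proof (rule has_bochner_integral_nn_integral)
  show "(\<integral>\<^sup>+k. ennreal (\<Prod>i<r. real k - real i) \<partial>measure_pmf (pois l)) = ennreal (l ^ r)"
  proof (rule nn_integral_pois_sums[OF l])
    let ?F = "\<lambda>k. pmf (pois l) k * (\<Prod>i<r. real k - real i)"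
    have "(\<lambda>j. l ^ r * exp (- l) * (l ^ j /\<^sub>R fact j)) sums (l ^ r * exp (- l) * exp l)"
      by (intro sums_mult exp_converges)
    moreover have "l ^ r * exp (- l) * (l ^ j /\<^sub>R fact j) = ?F (j + r)" for j
      unfolding pmf_pois[OF l] falling_factorial_binomial
      by (simp add: binomial_fact power_add field_simps)
    moreover have "l ^ r * exp (- l) * exp l = l ^ r" by (simp add: exp_minus)
    ultimately have "(\<lambda>j. ?F (j + r)) sums (l ^ r)" by simp
    moreover have "?F i = 0" if "i < r" for i using that by (auto simp: prod_zero_iff)
    ultimately show "?F sums (l ^ r)" by (subst (asm) sums_zero_iff_shift) auto
  qed (simp add: falling_factorial_binomial)
qed (use l in \<open>auto simp: falling_factorial_binomial\<close>)

lemma measurable_pmf_pair: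
  fixes p :: "nat pmf"
  assumes "\<And>k. (\<lambda>\<omega>. f (k, \<omega>)) \<in> measurable N K"
  shows "f \<in> measurable (measure_pmf p \<Otimes>\<^sub>M N) K"
proof -
  have "f \<in> measurable (count_space UNIV \<Otimes>\<^sub>M N) K"
    using assms by (intro measurable_pair_measure_countable1) auto
  also have "measurable (count_space UNIV \<Otimes>\<^sub>M N) K = measurable (measure_pmf p \<Otimes>\<^sub>M N) K"
    by (intro measurable_cong_sets sets_pair_measure_cong) auto
  finally show ?thesis .
qed

lemma card_offdiag: "card (offdiag n) = n * (n - 1)"
proof -
  have "offdiag n = Sigma {1..n} (\<lambda>i. {1..n} - {i})" by (auto simp: offdiag_def)
  then show ?thesis by simp
qed

lemma real_card_offdiag: "real (card (offdiag k)) = (\<Prod>i<2. real k - real i)"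
  by (cases k) (auto simp: card_offdiag eval_nat_numeral algebra_simps)

lemma offdiag_swap: "(i, j) \<in> offdiag n \<longleftrightarrow> (j, i) \<in> offdiag n"
  by (auto simp: offdiag_def)

lemma sum_offdiag_of_bool:
  assumes "(i, j) \<in> offdiag n"
  shows "(\<Sum>t\<in>offdiag n. of_bool (fst t = i)) = real n - 1"
    and "(\<Sum>t\<in>offdiag n. of_bool (snd t = i)) = real n - 1"
    and "(\<Sum>t\<in>offdiag n. of_bool (t = (i, j))) = (1 :: real)"
proof -
  have n: "i \<in> {1..n}" using assms by (auto simp: offdiag_def)
  have "{t \<in> offdiag n. fst t = i} = Pair i ` ({1..n} - {i})" using n by (auto simp: offdiag_def)
  then have "card {t \<in> offdiag n. fst t = i} = n - 1" using n by (simp add: card_image inj_on_def)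
  then show "(\<Sum>t\<in>offdiag n. of_bool (fst t = i)) = real n - 1"
    using n by (simp add: of_bool_def sum.If_cases Int_def of_nat_diff)
  have "{t \<in> offdiag n. snd t = i} = (\<lambda>x. (x, i)) ` ({1..n} - {i})" using n by (auto simp: offdiag_def)
  then have "card {t \<in> offdiag n. snd t = i} = n - 1" using n by (simp add: card_image inj_on_def)
  then show "(\<Sum>t\<in>offdiag n. of_bool (snd t = i)) = real n - 1"
    using n by (simp add: of_bool_def sum.If_cases Int_def of_nat_diff)
  show "(\<Sum>t\<in>offdiag n. of_bool (t = (i, j))) = (1 :: real)"
    using assms unfolding of_bool_def by (subst sum.delta) auto
qed

locale iid_sequence = prob_space \<rho> for \<rho> :: "'b measure"
begin

abbreviation seq :: "(nat \<Rightarrow> 'b) measure" where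
  "seq \<equiv> PiM UNIV (\<lambda>_. \<rho>)"

sublocale seq: prob_space seq
  by (rule prob_space_PiM) (rule prob_space_axioms)

sublocale product: product_prob_space "\<lambda>_::nat. \<rho>" UNIV
  by standard

sublocale pair: pair_prob_space \<rho> \<rho> ..

lemma coordinates_indep: "seq.indep_vars (\<lambda>_. \<rho>) (\<lambda>i \<omega>. \<omega> i) UNIV"
  by (subst seq.indep_vars_iff_distr_eq_PiM) (auto simp: restrict_UNIV distr_id product.PiM_component)

lemma indep_coordinate_functions:
  assumes "A \<inter> B = {}" "F \<in> measurable (PiM A (\<lambda>_. \<rho>)) N1" "G \<in> measurable (PiM B (\<lambda>_. \<rho>)) N2"
  shows "seq.indep_var N1 (\<lambda>\<omega>. F (restrict \<omega> A)) N2 (\<lambda>\<omega>. G (restrict \<omega> B))"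
  using seq.indep_var_compose[OF seq.indep_var_restrict[OF coordinates_indep assms(1)] assms(2,3)]
  by (simp add: o_def)

lemma pair_law:
  assumes "i \<noteq> j"
  shows "distr seq (\<rho> \<Otimes>\<^sub>M \<rho>) (\<lambda>\<omega>. (\<omega> i, \<omega> j)) = \<rho> \<Otimes>\<^sub>M \<rho>"
proof -
  have "seq.indep_var \<rho> (\<lambda>\<omega>. (\<lambda>x. x i) (restrict \<omega> {i})) \<rho> (\<lambda>\<omega>. (\<lambda>x. x j) (restrict \<omega> {j}))"
    using assms by (intro indep_coordinate_functions measurable_component_singleton) auto
  then show ?thesis
    unfolding seq.indep_var_distribution_eq by (simp add: product.PiM_component)
qed

text \<open>
  The last coordinate is doubled so that the two independent variables take values in the same space.
\<close>

lemma triple_law: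
  assumes "i \<noteq> j" "i \<noteq> q" "j \<noteq> q"
  shows "distr seq ((\<rho> \<Otimes>\<^sub>M \<rho>) \<Otimes>\<^sub>M (\<rho> \<Otimes>\<^sub>M \<rho>)) (\<lambda>\<omega>. ((\<omega> i, \<omega> j), (\<omega> q, \<omega> q)))
    = (\<rho> \<Otimes>\<^sub>M \<rho>) \<Otimes>\<^sub>M distr \<rho> (\<rho> \<Otimes>\<^sub>M \<rho>) (\<lambda>z. (z, z))"
proof -
  have "seq.indep_var (\<rho> \<Otimes>\<^sub>M \<rho>) (\<lambda>\<omega>. (\<lambda>x. (x i, x j)) (restrict \<omega> {i, j}))
      (\<rho> \<Otimes>\<^sub>M \<rho>) (\<lambda>\<omega>. (\<lambda>x. (x q, x q)) (restrict \<omega> {q}))"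
    using assms by (intro indep_coordinate_functions measurable_Pair measurable_component_singleton) auto
  then have "distr seq (\<rho> \<Otimes>\<^sub>M \<rho>) (\<lambda>\<omega>. (\<omega> i, \<omega> j)) \<Otimes>\<^sub>M distr seq (\<rho> \<Otimes>\<^sub>M \<rho>) (\<lambda>\<omega>. (\<omega> q, \<omega> q))
      = distr seq ((\<rho> \<Otimes>\<^sub>M \<rho>) \<Otimes>\<^sub>M (\<rho> \<Otimes>\<^sub>M \<rho>)) (\<lambda>\<omega>. ((\<omega> i, \<omega> j), (\<omega> q, \<omega> q)))"
    unfolding seq.indep_var_distribution_eq by simp
  moreover have "distr seq (\<rho> \<Otimes>\<^sub>M \<rho>) (\<lambda>\<omega>. (\<omega> q, \<omega> q))
      = distr (distr seq \<rho> (\<lambda>\<omega>. \<omega> q)) (\<rho> \<Otimes>\<^sub>M \<rho>) (\<lambda>z. (z, z))"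
    by (subst distr_distr) (auto simp: o_def)
  ultimately show ?thesis by (simp add: product.PiM_component pair_law[OF assms(1)])
qed

lemma measurable_pair_coordinates [measurable]: "(\<lambda>\<omega>. (\<omega> i, \<omega> j)) \<in> measurable seq (\<rho> \<Otimes>\<^sub>M \<rho>)"
  by measurable

lemma nn_integral_pair_sum:
  fixes G :: "'b \<Rightarrow> 'b \<Rightarrow> ennreal"
  assumes [measurable]: "case_prod G \<in> borel_measurable (\<rho> \<Otimes>\<^sub>M \<rho>)" and l: "0 \<le> l"
  shows "(\<integral>\<^sup>+(k, \<omega>). (\<Sum>(i, j)\<in>offdiag k. G (\<omega> i) (\<omega> j)) \<partial>(measure_pmf (pois l) \<Otimes>\<^sub>M seq))
     = ennreal (l\<^sup>2) * (\<integral>\<^sup>+(x, y). G x y \<partial>(\<rho> \<Otimes>\<^sub>M \<rho>))"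
proof -
  have G_meas: "(\<lambda>\<omega>. G (\<omega> i) (\<omega> j)) \<in> borel_measurable seq" for i j
    using measurable_compose[OF measurable_pair_coordinates assms(1)] by simp
  have "(\<integral>\<^sup>+(k, \<omega>). (\<Sum>(i, j)\<in>offdiag k. G (\<omega> i) (\<omega> j)) \<partial>(measure_pmf (pois l) \<Otimes>\<^sub>M seq))
      = (\<integral>\<^sup>+k. \<integral>\<^sup>+\<omega>. (\<Sum>(i, j)\<in>offdiag k. G (\<omega> i) (\<omega> j)) \<partial>seq \<partial>measure_pmf (pois l))"
    by (subst seq.nn_integral_fst[symmetric])
      (auto intro!: measurable_pmf_pair borel_measurable_sum G_meas simp: case_prod_unfold)
  also have "\<dots> = (\<integral>\<^sup>+k. ennreal (\<Prod>i<2. real k - real i) * (\<integral>\<^sup>+(x, y). G x y \<partial>(\<rho> \<Otimes>\<^sub>M \<rho>)) \<partial>measure_pmf (pois l))"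
  proof (intro nn_integral_cong)
    fix k
    have "(\<integral>\<^sup>+\<omega>. (\<Sum>(i, j)\<in>offdiag k. G (\<omega> i) (\<omega> j)) \<partial>seq) = (\<Sum>(i, j)\<in>offdiag k. \<integral>\<^sup>+\<omega>. G (\<omega> i) (\<omega> j) \<partial>seq)"
      by (subst nn_integral_sum) (auto simp: case_prod_unfold intro!: G_meas)
    also have "\<dots> = (\<Sum>(i, j)\<in>offdiag k. \<integral>\<^sup>+(x, y). G x y \<partial>(\<rho> \<Otimes>\<^sub>M \<rho>))"
    proof (intro sum.cong refl, clarify)
      fix i j assume "(i, j) \<in> offdiag k"
      then have ij: "i \<noteq> j" by (simp add: offdiag_def)
      have "(\<integral>\<^sup>+(x, y). G x y \<partial>(\<rho> \<Otimes>\<^sub>M \<rho>)) = (\<integral>\<^sup>+(x, y). G x y \<partial>distr seq (\<rho> \<Otimes>\<^sub>M \<rho>) (\<lambda>\<omega>. (\<omega> i, \<omega> j)))"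
        by (simp only: pair_law[OF ij])
      also have "\<dots> = (\<integral>\<^sup>+\<omega>. G (\<omega> i) (\<omega> j) \<partial>seq)"
        by (subst nn_integral_distr) auto
      finally show "(\<integral>\<^sup>+\<omega>. G (\<omega> i) (\<omega> j) \<partial>seq) = (\<integral>\<^sup>+(x, y). G x y \<partial>(\<rho> \<Otimes>\<^sub>M \<rho>))" ..
    qed
    also have "\<dots> = of_nat (card (offdiag k)) * (\<integral>\<^sup>+(x, y). G x y \<partial>(\<rho> \<Otimes>\<^sub>M \<rho>))" by simp
    also have "of_nat (card (offdiag k)) = ennreal (\<Prod>i<2. real k - real i)"
      by (simp only: ennreal_of_nat_eq_real_of_nat real_card_offdiag)
    finally show "(\<integral>\<^sup>+\<omega>. (\<Sum>(i, j)\<in>offdiag k. G (\<omega> i) (\<omega> j)) \<partial>seq)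
      = ennreal (\<Prod>i<2. real k - real i) * (\<integral>\<^sup>+(x, y). G x y \<partial>(\<rho> \<Otimes>\<^sub>M \<rho>))" .
  qed
  also have "\<dots> = (\<integral>\<^sup>+k. ennreal (\<Prod>i<2. real k - real i) \<partial>measure_pmf (pois l)) * (\<integral>\<^sup>+(x, y). G x y \<partial>(\<rho> \<Otimes>\<^sub>M \<rho>))"
    by (rule nn_integral_multc) auto
  also have "(\<integral>\<^sup>+k. ennreal (\<Prod>i<2. real k - real i) \<partial>measure_pmf (pois l)) = ennreal (l\<^sup>2)"
    using pois_factorial_moment[OF l, of 2]
    by (subst nn_integral_eq_integral) (auto simp: has_bochner_integral_iff falling_factorial_binomial)
  finally show ?thesis .
qed

end

locale square_integrable_kernel = iid_sequence \<rho> for \<rho> :: "'b measure" +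
  fixes H :: "'b \<Rightarrow> 'b \<Rightarrow> real"
  assumes H_measurable [measurable]: "case_prod H \<in> borel_measurable (\<rho> \<Otimes>\<^sub>M \<rho>)"
    and H_sym: "\<And>x y. x \<in> space \<rho> \<Longrightarrow> y \<in> space \<rho> \<Longrightarrow> H x y = H y x"
    and H_square: "integrable (\<rho> \<Otimes>\<^sub>M \<rho>) (\<lambda>(x, y). (H x y)\<^sup>2)"
begin

definition H_mean :: real where "H_mean = (\<integral>(x, y). H x y \<partial>(\<rho> \<Otimes>\<^sub>M \<rho>))"
definition H_proj :: real where "H_proj = (\<integral>x. (\<integral>y. H x y \<partial>\<rho>)\<^sup>2 \<partial>\<rho>)"
definition H_norm :: real where "H_norm = (\<integral>(x, y). (H x y)\<^sup>2 \<partial>(\<rho> \<Otimes>\<^sub>M \<rho>))"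

lemma H_compose: "f \<in> measurable M \<rho> \<Longrightarrow> g \<in> measurable M \<rho> \<Longrightarrow> (\<lambda>x. H (f x) (g x)) \<in> borel_measurable M"
  using measurable_compose[OF measurable_Pair H_measurable] by simp

lemma H_coordinates_measurable [measurable]: "(\<lambda>\<omega>. H (\<omega> i) (\<omega> j)) \<in> borel_measurable seq"
  using measurable_compose[OF measurable_pair_coordinates H_measurable] by simp

lemma
  assumes "i \<noteq> j"
  shows integrable_H_square: "integrable seq (\<lambda>\<omega>. (H (\<omega> i) (\<omega> j))\<^sup>2)"
    and integral_H_square: "(\<integral>\<omega>. (H (\<omega> i) (\<omega> j))\<^sup>2 \<partial>seq) = H_norm"
    and integral_H: "(\<integral>\<omega>. H (\<omega> i) (\<omega> j) \<partial>seq) = H_mean"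
proof -
  have "integrable (distr seq (\<rho> \<Otimes>\<^sub>M \<rho>) (\<lambda>\<omega>. (\<omega> i, \<omega> j))) (\<lambda>(x, y). (H x y)\<^sup>2)"
    unfolding pair_law[OF assms] by (rule H_square)
  then show "integrable seq (\<lambda>\<omega>. (H (\<omega> i) (\<omega> j))\<^sup>2)"
    by (subst (asm) integrable_distr_eq) auto
  have "H_norm = (\<integral>(x, y). (H x y)\<^sup>2 \<partial>distr seq (\<rho> \<Otimes>\<^sub>M \<rho>) (\<lambda>\<omega>. (\<omega> i, \<omega> j)))"
    unfolding pair_law[OF assms] H_norm_def ..
  then show "(\<integral>\<omega>. (H (\<omega> i) (\<omega> j))\<^sup>2 \<partial>seq) = H_norm"
    by (subst (asm) integral_distr) auto
  have "H_mean = (\<integral>(x, y). H x y \<partial>distr seq (\<rho> \<Otimes>\<^sub>M \<rho>) (\<lambda>\<omega>. (\<omega> i, \<omega> j)))"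
    unfolding pair_law[OF assms] H_mean_def ..
  then show "(\<integral>\<omega>. H (\<omega> i) (\<omega> j) \<partial>seq) = H_mean"
    by (subst (asm) integral_distr) auto
qed

lemma integrable_H: "i \<noteq> j \<Longrightarrow> integrable seq (\<lambda>\<omega>. H (\<omega> i) (\<omega> j))"
  by (rule seq.square_integrable_imp_integrable) (auto intro: integrable_H_square)

lemma integrable_H_product:
  assumes "i \<noteq> j" "p \<noteq> q"
  shows "integrable seq (\<lambda>\<omega>. H (\<omega> i) (\<omega> j) * H (\<omega> p) (\<omega> q))"
proof (rule Bochner_Integration.integrable_bound)
  show "integrable seq (\<lambda>\<omega>. (H (\<omega> i) (\<omega> j))\<^sup>2 + (H (\<omega> p) (\<omega> q))\<^sup>2)"
    using assms by (intro Bochner_Integration.integrable_add integrable_H_square)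
  show "AE \<omega> in seq. norm (H (\<omega> i) (\<omega> j) * H (\<omega> p) (\<omega> q)) \<le> norm ((H (\<omega> i) (\<omega> j))\<^sup>2 + (H (\<omega> p) (\<omega> q))\<^sup>2)"
  proof (rule AE_I2)
    fix \<omega>
    have "2 * \<bar>a * b\<bar> \<le> a\<^sup>2 + b\<^sup>2" for a b :: real
      using sum_squares_bound[of "\<bar>a\<bar>" "\<bar>b\<bar>"] by (simp add: abs_mult)
    from this[of "H (\<omega> i) (\<omega> j)" "H (\<omega> p) (\<omega> q)"]
    show "norm (H (\<omega> i) (\<omega> j) * H (\<omega> p) (\<omega> q)) \<le> norm ((H (\<omega> i) (\<omega> j))\<^sup>2 + (H (\<omega> p) (\<omega> q))\<^sup>2)"
      by simp
  qed
qed auto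

lemma integral_H_disjoint:
  assumes "{i, j} \<inter> {p, q} = {}" "i \<noteq> j" "p \<noteq> q"
  shows "(\<integral>\<omega>. H (\<omega> i) (\<omega> j) * H (\<omega> p) (\<omega> q) \<partial>seq) = H_mean\<^sup>2"
proof -
  have meas: "(\<lambda>x. H (x a) (x b)) \<in> borel_measurable (PiM {a, b} (\<lambda>_. \<rho>))" for a b :: nat
  proof -
    have "(\<lambda>x. (x a, x b)) \<in> measurable (PiM {a, b} (\<lambda>_. \<rho>)) (\<rho> \<Otimes>\<^sub>M \<rho>)"
      by (intro measurable_Pair measurable_component_singleton) auto
    from measurable_compose[OF this H_measurable] show ?thesis by simp
  qed
  from indep_coordinate_functions[OF assms(1) meas meas]
  have "seq.indep_var borel (\<lambda>\<omega>. H (\<omega> i) (\<omega> j)) borel (\<lambda>\<omega>. H (\<omega> p) (\<omega> q))" by simp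
  from seq.indep_var_lebesgue_integral[OF this] assms
  show ?thesis by (simp add: integrable_H integral_H power2_eq_square)
qed

text \<open>
  Integrating out the two unshared variables leaves the square of the projection of \<open>H\<close> on one variable.
\<close>

lemma integral_H_shared:
  assumes "i \<noteq> j" "i \<noteq> q" "j \<noteq> q"
  shows "(\<integral>\<omega>. H (\<omega> i) (\<omega> j) * H (\<omega> i) (\<omega> q) \<partial>seq) = H_proj"
proof -
  let ?D = "distr \<rho> (\<rho> \<Otimes>\<^sub>M \<rho>) (\<lambda>z. (z, z))"
  interpret D: prob_space ?D by (rule prob_space_distr) simp
  interpret pair3: pair_sigma_finite "\<rho> \<Otimes>\<^sub>M \<rho>" ?D ..
  let ?M3 = "(\<rho> \<Otimes>\<^sub>M \<rho>) \<Otimes>\<^sub>M (\<rho> \<Otimes>\<^sub>M \<rho>)"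
  let ?F = "\<lambda>z. H (fst (fst z)) (snd (fst z)) * H (fst (fst z)) (fst (snd z))"
  have F [measurable]: "?F \<in> borel_measurable ?M3"
    by (intro borel_measurable_times H_compose) measurable
  have pos [measurable]: "(\<lambda>\<omega>. ((\<omega> i, \<omega> j), (\<omega> q, \<omega> q))) \<in> measurable seq ?M3" by measurable
  have int3: "integrable ((\<rho> \<Otimes>\<^sub>M \<rho>) \<Otimes>\<^sub>M ?D) ?F"
    unfolding triple_law[OF assms, symmetric]
    using integrable_H_product[OF assms(1,2)] by (subst integrable_distr_eq[OF pos F]) simp
  have D: "(\<integral>t. H a (fst t) \<partial>?D) = (\<integral>t. H a t \<partial>\<rho>)" if "a \<in> space \<rho>" for a
    using that by (subst integral_distr) (auto intro!: H_compose)
  have "(\<integral>\<omega>. H (\<omega> i) (\<omega> j) * H (\<omega> i) (\<omega> q) \<partial>seq) = (\<integral>z. ?F z \<partial>((\<rho> \<Otimes>\<^sub>M \<rho>) \<Otimes>\<^sub>M ?D))"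
    unfolding triple_law[OF assms, symmetric] by (subst integral_distr[OF pos F]) simp
  also have "\<dots> = (\<integral>z. \<integral>t. ?F (z, t) \<partial>?D \<partial>(\<rho> \<Otimes>\<^sub>M \<rho>))"
    by (rule pair3.integral_fst'[OF int3, symmetric])
  also have "\<dots> = (\<integral>z. H (fst z) (snd z) * (\<integral>t. H (fst z) t \<partial>\<rho>) \<partial>(\<rho> \<Otimes>\<^sub>M \<rho>))"
    by (intro Bochner_Integration.integral_cong refl) (auto simp: D space_pair_measure)
  also have "\<dots> = (\<integral>x. \<integral>y. H x y * (\<integral>t. H x t \<partial>\<rho>) \<partial>\<rho> \<partial>\<rho>)"
  proof -
    have "integrable (\<rho> \<Otimes>\<^sub>M \<rho>) (\<lambda>z. \<integral>t. ?F (z, t) \<partial>?D)"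
      by (rule pair3.integrable_fst'[OF int3])
    also have "integrable (\<rho> \<Otimes>\<^sub>M \<rho>) (\<lambda>z. \<integral>t. ?F (z, t) \<partial>?D)
        \<longleftrightarrow> integrable (\<rho> \<Otimes>\<^sub>M \<rho>) (\<lambda>z. H (fst z) (snd z) * (\<integral>t. H (fst z) t \<partial>\<rho>))"
      by (intro Bochner_Integration.integrable_cong refl) (auto simp: D space_pair_measure)
    finally have "integrable (\<rho> \<Otimes>\<^sub>M \<rho>) (\<lambda>z. H (fst z) (snd z) * (\<integral>t. H (fst z) t \<partial>\<rho>))" .
    from pair.integral_fst'[OF this] show ?thesis by simp
  qed
  also have "\<dots> = H_proj"
    unfolding H_proj_def by (simp add: power2_eq_square)
  finally show ?thesis .
qed

text \<open>
  The second moment only depends on how many indices the two pairs share: none, one or two. Written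
  with indicators, the three cases become summable over all pairs at once.
\<close>

lemma integral_H_product:
  assumes "i \<noteq> j" "p \<noteq> q"
  shows "(\<integral>\<omega>. H (\<omega> i) (\<omega> j) * H (\<omega> p) (\<omega> q) \<partial>seq) = H_mean\<^sup>2
     + (H_proj - H_mean\<^sup>2) * (of_bool (p = i) + of_bool (p = j) + of_bool (q = i) + of_bool (q = j))
     + (H_norm - 2 * H_proj + H_mean\<^sup>2) * (of_bool (p = i \<and> q = j) + of_bool (p = j \<and> q = i))"
proof -
  have sym: "H (\<omega> a) (\<omega> b) = H (\<omega> b) (\<omega> a)" if "\<omega> \<in> space seq" for \<omega> a b
    using that by (intro H_sym) (auto simp: space_PiM)
  have swap1: "(\<integral>\<omega>. H (\<omega> a) (\<omega> b) * F \<omega> \<partial>seq) = (\<integral>\<omega>. H (\<omega> b) (\<omega> a) * F \<omega> \<partial>seq)" for a b F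
    by (intro Bochner_Integration.integral_cong refl) (metis sym)
  have swap2: "(\<integral>\<omega>. F \<omega> * H (\<omega> a) (\<omega> b) \<partial>seq) = (\<integral>\<omega>. F \<omega> * H (\<omega> b) (\<omega> a) \<partial>seq)" for a b F
    by (intro Bochner_Integration.integral_cong refl) (metis sym)
  have shared: "(\<integral>\<omega>. H (\<omega> a) (\<omega> b) * H (\<omega> a) (\<omega> c) \<partial>seq) = H_proj" if "a \<noteq> b" "a \<noteq> c" "b \<noteq> c" for a b c
    by (rule integral_H_shared[OF that])
  consider "p = i" "q = j" | "p = j" "q = i" | "p = i" "q \<noteq> j" | "p = j" "q \<noteq> i"
    | "q = i" "p \<noteq> j" | "q = j" "p \<noteq> i" | "p \<noteq> i" "p \<noteq> j" "q \<noteq> i" "q \<noteq> j"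
    by blast
  then show ?thesis
  proof cases
    case 1
    have "(\<integral>\<omega>. H (\<omega> i) (\<omega> j) * H (\<omega> p) (\<omega> q) \<partial>seq) = H_norm"
      using integral_H_square[OF assms(1)] 1 by (simp add: power2_eq_square)
    then show ?thesis using 1 assms by (simp add: algebra_simps)
  next
    case 2
    have "(\<integral>\<omega>. H (\<omega> i) (\<omega> j) * H (\<omega> p) (\<omega> q) \<partial>seq) = H_norm"
      using integral_H_square[OF assms(1)] 2 swap2[of _ j i] by (simp add: power2_eq_square)
    then show ?thesis using 2 assms by (simp add: algebra_simps)
  next
    case 3
    then show ?thesis using assms shared[of i j q] by simp
  next
    case 4
    then show ?thesis using assms shared[of j i q] swap1[of i j] by simp
  next
    case 5
    then show ?thesis using assms shared[of i j p] swap2[of _ p i] by simp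
  next
    case 6
    then show ?thesis using assms shared[of j i p] swap1[of i j] swap2[of _ p j] by simp
  next
    case 7
    then show ?thesis using assms integral_H_disjoint[of i j p q] by simp
  qed
qed

definition pair_sum :: "nat \<Rightarrow> (nat \<Rightarrow> 'b) \<Rightarrow> real" where
  "pair_sum k \<omega> = (\<Sum>(i, j)\<in>offdiag k. H (\<omega> i) (\<omega> j))"

lemma measurable_pair_sum [measurable]: "pair_sum k \<in> borel_measurable seq"
  unfolding pair_sum_def by (auto simp: case_prod_unfold)

lemma integral_pair_sum: "(\<integral>\<omega>. pair_sum k \<omega> \<partial>seq) = H_mean * (\<Prod>i<2. real k - real i)"
proof -
  have "(\<integral>\<omega>. pair_sum k \<omega> \<partial>seq) = (\<Sum>(i, j)\<in>offdiag k. \<integral>\<omega>. H (\<omega> i) (\<omega> j) \<partial>seq)"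
    unfolding pair_sum_def case_prod_unfold
    by (rule Bochner_Integration.integral_sum) (auto simp: offdiag_def intro!: integrable_H)
  also have "\<dots> = (\<Sum>(i, j)\<in>offdiag k. H_mean)"
    by (intro sum.cong) (auto simp: offdiag_def integral_H)
  also have "\<dots> = real (card (offdiag k)) * H_mean" by (simp add: case_prod_unfold)
  finally show ?thesis by (simp only: real_card_offdiag mult.commute)
qed

text \<open>
  For a fixed sample size the three kinds of overlap contribute with falling factorials of \<open>k\<close> as
  coefficients. Under a Poisson sample size these turn into powers of the mean, so that the term in
  the square of \<open>H_mean\<close> below is exactly the square of the expectation.
\<close>

lemma
  shows integrable_pair_sum_square: "integrable seq (\<lambda>\<omega>. (pair_sum k \<omega>)\<^sup>2)"
    and integral_pair_sum_square: "(\<integral>\<omega>. (pair_sum k \<omega>)\<^sup>2 \<partial>seq)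
      = H_mean\<^sup>2 * (\<Prod>i<4. real k - real i) + 4 * H_proj * (\<Prod>i<3. real k - real i) + 2 * H_norm * (\<Prod>i<2. real k - real i)"
proof -
  let ?G = "\<lambda>(i, j) (p, q) \<omega>. H (\<omega> i) (\<omega> j) * H (\<omega> p) (\<omega> q)"
  have sq: "(pair_sum k \<omega>)\<^sup>2 = (\<Sum>a\<in>offdiag k. \<Sum>b\<in>offdiag k. ?G a b \<omega>)" for \<omega>
    unfolding pair_sum_def power2_eq_square sum_product by (simp add: case_prod_unfold)
  have int: "integrable seq (?G a b)" if "a \<in> offdiag k" "b \<in> offdiag k" for a b
    using that by (cases a; cases b) (auto simp: offdiag_def intro!: integrable_H_product)
  show "integrable seq (\<lambda>\<omega>. (pair_sum k \<omega>)\<^sup>2)"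
    unfolding sq by (intro Bochner_Integration.integrable_sum int)
  define a where "a = H_mean\<^sup>2"
  define b where "b = H_proj - H_mean\<^sup>2"
  define c where "c = H_norm - 2 * H_proj + H_mean\<^sup>2"
  have "(\<integral>\<omega>. (pair_sum k \<omega>)\<^sup>2 \<partial>seq) = (\<Sum>a\<in>offdiag k. \<Sum>b\<in>offdiag k. \<integral>\<omega>. ?G a b \<omega> \<partial>seq)"
    unfolding sq by (subst Bochner_Integration.integral_sum; (intro Bochner_Integration.integrable_sum int sum.cong refl Bochner_Integration.integral_sum)?)
  also have "\<dots> = (\<Sum>s\<in>offdiag k. real (card (offdiag k)) * a + b * (4 * (real k - 1)) + c * 2)"
  proof (rule sum.cong[OF refl])
    fix s assume "s \<in> offdiag k"
    moreover obtain i j where s: "s = (i, j)" by (cases s)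
    ultimately have ij: "(i, j) \<in> offdiag k" by simp
    have "(\<Sum>t\<in>offdiag k. \<integral>\<omega>. ?G (i, j) t \<omega> \<partial>seq)
       = (\<Sum>t\<in>offdiag k. a + b * (of_bool (fst t = i) + of_bool (fst t = j) + of_bool (snd t = i) + of_bool (snd t = j))
            + c * (of_bool (t = (i, j)) + of_bool (t = (j, i))))"
      using ij unfolding a_def b_def c_def
      by (intro sum.cong refl) (auto simp: offdiag_def integral_H_product)
    also have "\<dots> = (\<Sum>t\<in>offdiag k. a)
        + b * ((\<Sum>t\<in>offdiag k. of_bool (fst t = i)) + (\<Sum>t\<in>offdiag k. of_bool (fst t = j))
             + (\<Sum>t\<in>offdiag k. of_bool (snd t = i)) + (\<Sum>t\<in>offdiag k. of_bool (snd t = j)))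
        + c * ((\<Sum>t\<in>offdiag k. of_bool (t = (i, j))) + (\<Sum>t\<in>offdiag k. of_bool (t = (j, i))))"
      by (simp only: sum.distrib sum_distrib_left distrib_left)
    also have "\<dots> = real (card (offdiag k)) * a + b * (4 * (real k - 1)) + c * 2"
      by (simp only: sum_offdiag_of_bool[OF ij] sum_offdiag_of_bool[OF ij[unfolded offdiag_swap[of i]]] sum_constant) simp
    finally show "(\<Sum>t\<in>offdiag k. \<integral>\<omega>. ?G s t \<omega> \<partial>seq) = real (card (offdiag k)) * a + b * (4 * (real k - 1)) + c * 2"
      unfolding s .
  qed
  also have "\<dots> = real k * (real k - 1) * (real k * (real k - 1) * a + b * (4 * (real k - 1)) + c * 2)"
    by (cases k) (auto simp: card_offdiag algebra_simps)
  also have "\<dots> = H_mean\<^sup>2 * (\<Prod>i<4. real k - real i) + 4 * H_proj * (\<Prod>i<3. real k - real i) + 2 * H_norm * (\<Prod>i<2. real k - real i)"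
    unfolding a_def b_def c_def by (simp add: eval_nat_numeral) algebra
  finally show "(\<integral>\<omega>. (pair_sum k \<omega>)\<^sup>2 \<partial>seq)
      = H_mean\<^sup>2 * (\<Prod>i<4. real k - real i) + 4 * H_proj * (\<Prod>i<3. real k - real i) + 2 * H_norm * (\<Prod>i<2. real k - real i)" .
qed

lemma
  assumes l: "0 \<le> l"
  defines "N \<equiv> measure_pmf (pois l) \<Otimes>\<^sub>M seq"
  shows integrable_poisson_pair_sum: "integrable N (\<lambda>(k, \<omega>). pair_sum k \<omega>)"
    and integrable_poisson_pair_sum_square: "integrable N (\<lambda>(k, \<omega>). (pair_sum k \<omega>)\<^sup>2)"
    and integral_poisson_pair_sum: "(\<integral>(k, \<omega>). pair_sum k \<omega> \<partial>N) = l\<^sup>2 * H_mean"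
    and integral_poisson_pair_sum_square:
      "(\<integral>(k, \<omega>). (pair_sum k \<omega>)\<^sup>2 \<partial>N) = l ^ 4 * H_mean\<^sup>2 + 4 * l ^ 3 * H_proj + 2 * l\<^sup>2 * H_norm"
proof -
  interpret N: pair_prob_space "measure_pmf (pois l)" seq ..
  let ?R = "l ^ 4 * H_mean\<^sup>2 + 4 * l ^ 3 * H_proj + 2 * l\<^sup>2 * H_norm"
  let ?S = "\<lambda>k. H_mean\<^sup>2 * (\<Prod>i<4. real k - real i) + 4 * H_proj * (\<Prod>i<3. real k - real i) + 2 * H_norm * (\<Prod>i<2. real k - real i)"
  have m1: "(\<lambda>(k, \<omega>). pair_sum k \<omega>) \<in> borel_measurable N"
    unfolding N_def by (intro measurable_pmf_pair) simp
  have m2: "(\<lambda>(k, \<omega>). (pair_sum k \<omega>)\<^sup>2) \<in> borel_measurable N"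
    unfolding N_def by (intro measurable_pmf_pair) simp
  have nonneg: "0 \<le> H_mean\<^sup>2" "0 \<le> H_proj" "0 \<le> H_norm"
    unfolding H_proj_def H_norm_def by (auto intro!: Bochner_Integration.integral_nonneg simp: case_prod_unfold)
  have moments: "has_bochner_integral (measure_pmf (pois l)) ?S ?R"
    using has_bochner_integral_add[OF has_bochner_integral_add[OF
        has_bochner_integral_mult_right[OF pois_factorial_moment[OF l, of 4], of "H_mean\<^sup>2"]
        has_bochner_integral_mult_right[OF pois_factorial_moment[OF l, of 3], of "4 * H_proj"]]
        has_bochner_integral_mult_right[OF pois_factorial_moment[OF l, of 2], of "2 * H_norm"]]
    by (simp add: algebra_simps)
  have S_nonneg: "0 \<le> ?S k" for k
    unfolding falling_factorial_binomial using nonneg by (intro add_nonneg_nonneg mult_nonneg_nonneg) auto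
  have "(\<integral>\<^sup>+z. ennreal (case z of (k, \<omega>) \<Rightarrow> (pair_sum k \<omega>)\<^sup>2) \<partial>N)
      = (\<integral>\<^sup>+k. \<integral>\<^sup>+\<omega>. ennreal ((pair_sum k \<omega>)\<^sup>2) \<partial>seq \<partial>measure_pmf (pois l))"
    unfolding N_def using m2[unfolded N_def] by (subst seq.nn_integral_fst[symmetric]) auto
  also have "\<dots> = (\<integral>\<^sup>+k. ennreal (?S k) \<partial>measure_pmf (pois l))"
    by (intro nn_integral_cong) (simp add: nn_integral_eq_integral integrable_pair_sum_square integral_pair_sum_square)
  also have "\<dots> = ennreal ?R"
    using moments S_nonneg by (subst nn_integral_eq_integral) (auto simp: has_bochner_integral_iff)
  finally have *: "(\<integral>\<^sup>+z. ennreal (case z of (k, \<omega>) \<Rightarrow> (pair_sum k \<omega>)\<^sup>2) \<partial>N) = ennreal ?R" .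
  have R_nonneg: "0 \<le> ?R" using nonneg l by (intro add_nonneg_nonneg mult_nonneg_nonneg) auto
  have both: "integrable N (\<lambda>(k, \<omega>). (pair_sum k \<omega>)\<^sup>2) \<and> (\<integral>(k, \<omega>). (pair_sum k \<omega>)\<^sup>2 \<partial>N) = ?R"
    using * m2 R_nonneg by (subst nn_integral_eq_integrable[symmetric]) auto
  then show "integrable N (\<lambda>(k, \<omega>). (pair_sum k \<omega>)\<^sup>2)" "(\<integral>(k, \<omega>). (pair_sum k \<omega>)\<^sup>2 \<partial>N) = ?R" by auto
  have NN: "finite_measure N" unfolding N_def by (rule N.finite_measure_axioms)
  show int: "integrable N (\<lambda>(k, \<omega>). pair_sum k \<omega>)"
    using both by (intro finite_measure.square_integrable_imp_integrable[OF NN m1]) (simp add: case_prod_unfold)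
  have "(\<integral>(k, \<omega>). pair_sum k \<omega> \<partial>N) = (\<integral>k. \<integral>\<omega>. pair_sum k \<omega> \<partial>seq \<partial>measure_pmf (pois l))"
    using N.integral_fst'[OF int[unfolded N_def]] unfolding N_def by simp
  also have "\<dots> = (\<integral>k. H_mean * (\<Prod>i<2. real k - real i) \<partial>measure_pmf (pois l))"
    by (simp only: integral_pair_sum)
  also have "\<dots> = H_mean * l\<^sup>2"
    using pois_factorial_moment[OF l, of 2] by (simp add: has_bochner_integral_iff)
  finally show "(\<integral>(k, \<omega>). pair_sum k \<omega> \<partial>N) = l\<^sup>2 * H_mean" by simp
qed

end

section \<open>The two-sample statistic\<close>

lemma integrable_square_product:
  fixes u v :: "'a \<Rightarrow> real"
  assumes "u \<in> borel_measurable M" "v \<in> borel_measurable M"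
    and "integrable M (\<lambda>x. (u x)\<^sup>2)" "integrable M (\<lambda>x. (v x)\<^sup>2)"
  shows "integrable M (\<lambda>x. u x * v x)"
proof (rule Bochner_Integration.integrable_bound)
  show "integrable M (\<lambda>x. (u x)\<^sup>2 + (v x)\<^sup>2)" using assms by auto
  have "2 * \<bar>a * b\<bar> \<le> a\<^sup>2 + b\<^sup>2" for a b :: real
    using sum_squares_bound[of "\<bar>a\<bar>" "\<bar>b\<bar>"] by (simp add: abs_mult)
  then have "norm (u x * v x) \<le> norm ((u x)\<^sup>2 + (v x)\<^sup>2)" for x
    by (smt (verit) real_norm_def zero_le_power2)
  then show "AE x in M. norm (u x * v x) \<le> norm ((u x)\<^sup>2 + (v x)\<^sup>2)" by simp
qed (use assms in auto)

lemma intensity_square_integrable: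
  assumes "intensity \<nu> f"
  shows "integrable \<nu> (\<lambda>x. (f x)\<^sup>2)"
proof -
  obtain b where "\<forall>y\<in>f ` space \<nu>. norm y \<le> b"
    using assms unfolding intensity_def bounded_iff by blast
  then have b: "\<bar>f x\<bar> \<le> b" if "x \<in> space \<nu>" for x using that by simp
  show ?thesis
  proof (rule Bochner_Integration.integrable_bound)
    show "integrable \<nu> (\<lambda>x. b * f x)" using assms unfolding intensity_def by auto
    show "AE x in \<nu>. norm ((f x)\<^sup>2) \<le> norm (b * f x)"
    proof (rule AE_I2)
      fix x assume x: "x \<in> space \<nu>"
      have "\<bar>f x\<bar> * \<bar>f x\<bar> \<le> b * \<bar>f x\<bar>" using b[OF x] by (intro mult_right_mono) auto
      then show "norm ((f x)\<^sup>2) \<le> norm (b * f x)"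
        by (simp add: power2_eq_square abs_mult) (smt (verit) mult_right_mono abs_ge_zero abs_ge_self)
    qed
  qed (use assms in \<open>auto simp: intensity_def\<close>)
qed

abbreviation label :: "bool \<Rightarrow> real" where
  "label b \<equiv> if b then 1 else -1"

text \<open>
  The pooled process is a Poisson number of independent points with density proportional to \<open>f + g\<close>,
  each labelled as coming from the first sample with probability \<open>f / (f + g)\<close>. The kernel enters
  through the common value \<open>c\<close> of the squared norms of its sections, the intensities through a
  bound \<open>S\<close> of \<open>f + g\<close>.
\<close>

locale two_sample = sigma_finite_measure \<nu> for \<nu> :: "'a measure" +
  fixes n :: real and f g :: "'a \<Rightarrow> real" and K :: "'a \<Rightarrow> 'a \<Rightarrow> real" and c S :: real
  assumes n_pos: "0 < n" and f_intensity: "intensity \<nu> f" and g_intensity: "intensity \<nu> g"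
    and mass_pos: "0 < (\<integral>x. f x + g x \<partial>\<nu>)"
    and K_measurable [measurable]: "case_prod K \<in> borel_measurable (\<nu> \<Otimes>\<^sub>M \<nu>)"
    and K_sym: "\<And>x y. x \<in> space \<nu> \<Longrightarrow> y \<in> space \<nu> \<Longrightarrow> K x y = K y x"
    and K_norm: "\<And>x. x \<in> space \<nu> \<Longrightarrow> (\<integral>\<^sup>+y. ennreal ((K x y)\<^sup>2) \<partial>\<nu>) = ennreal c"
    and c_nonneg: "0 \<le> c"
    and S_bound: "\<And>x. x \<in> space \<nu> \<Longrightarrow> f x + g x \<le> S"
begin

definition mass :: real where "mass = (\<integral>x. f x + g x \<partial>\<nu>)"
definition \<Delta> :: "'a \<Rightarrow> real" where "\<Delta> x = f x - g x"
definition K\<Delta> :: "'a \<Rightarrow> real" where "K\<Delta> x = (\<integral>y. K x y * \<Delta> y \<partial>\<nu>)"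

definition \<rho> :: "('a \<times> bool) measure" where
  "\<rho> = density (\<nu> \<Otimes>\<^sub>M count_space UNIV) (\<lambda>z. ennreal ((if snd z then f (fst z) else g (fst z)) / mass))"

definition H :: "'a \<times> bool \<Rightarrow> 'a \<times> bool \<Rightarrow> real" where
  "H z z' = K (fst z) (fst z') * label (snd z) * label (snd z')"

lemma f_meas [measurable]: "f \<in> borel_measurable \<nu>" and g_meas [measurable]: "g \<in> borel_measurable \<nu>"
  using f_intensity g_intensity by (auto simp: intensity_def)

lemma f_int: "integrable \<nu> f" and g_int: "integrable \<nu> g"
  using f_intensity g_intensity by (auto simp: intensity_def)

lemma f_nonneg: "x \<in> space \<nu> \<Longrightarrow> 0 \<le> f x" and g_nonneg: "x \<in> space \<nu> \<Longrightarrow> 0 \<le> g x"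
  using f_intensity g_intensity by (auto simp: intensity_def)

lemma mass: "0 < mass" unfolding mass_def by (rule mass_pos)

lemma \<Delta>_meas [measurable]: "\<Delta> \<in> borel_measurable \<nu>"
  unfolding \<Delta>_def[abs_def] by measurable

lemma \<Delta>_square: "integrable \<nu> (\<lambda>x. (\<Delta> x)\<^sup>2)"
proof -
  have "integrable \<nu> (\<lambda>x. (f x)\<^sup>2 + (g x)\<^sup>2 - 2 * (f x * g x))"
    by (intro Bochner_Integration.integrable_add Bochner_Integration.integrable_diff integrable_mult_right
        integrable_square_product intensity_square_integrable f_intensity g_intensity) auto
  then show ?thesis by (simp add: \<Delta>_def power2_diff mult.assoc)
qed

lemma density_meas [measurable]:
  "(\<lambda>z. ennreal ((if snd z then f (fst z) else g (fst z)) / mass)) \<in> borel_measurable (\<nu> \<Otimes>\<^sub>M count_space UNIV)"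
  by measurable

lemma sets_\<rho> [measurable_cong, simp]: "sets \<rho> = sets (\<nu> \<Otimes>\<^sub>M count_space UNIV)"
  unfolding \<rho>_def by simp

lemma space_\<rho> [simp]: "space \<rho> = space \<nu> \<times> UNIV"
  unfolding \<rho>_def by (simp add: space_pair_measure)

lemma nn_integral_\<rho>:
  assumes [measurable]: "\<phi> \<in> borel_measurable (\<nu> \<Otimes>\<^sub>M count_space UNIV)"
  shows "(\<integral>\<^sup>+z. \<phi> z \<partial>\<rho>) = (\<integral>\<^sup>+x. ennreal (f x / mass) * \<phi> (x, True) + ennreal (g x / mass) * \<phi> (x, False) \<partial>\<nu>)"
proof -
  interpret B: sigma_finite_measure "count_space (UNIV :: bool set)"
    by (rule sigma_finite_measure_count_space_finite) simp
  have "(\<integral>\<^sup>+z. \<phi> z \<partial>\<rho>) = (\<integral>\<^sup>+z. ennreal ((if snd z then f (fst z) else g (fst z)) / mass) * \<phi> z \<partial>(\<nu> \<Otimes>\<^sub>M count_space UNIV))"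
    unfolding \<rho>_def by (rule nn_integral_density) auto
  also have "\<dots> = (\<integral>\<^sup>+x. \<integral>\<^sup>+b. ennreal ((if b then f x else g x) / mass) * \<phi> (x, b) \<partial>count_space UNIV \<partial>\<nu>)"
    by (subst B.nn_integral_fst[symmetric]) (auto intro!: nn_integral_cong)
  finally show ?thesis
    by (simp add: nn_integral_count_space_finite UNIV_bool add.commute)
qed

lemma nn_integral_mass: "(\<integral>\<^sup>+x. ennreal (f x / mass) + ennreal (g x / mass) \<partial>\<nu>) = 1"
proof -
  have "(\<integral>\<^sup>+x. ennreal (f x / mass) + ennreal (g x / mass) \<partial>\<nu>) = (\<integral>\<^sup>+x. ennreal ((f x + g x) / mass) \<partial>\<nu>)"
    using mass f_nonneg g_nonneg by (intro nn_integral_cong) (simp add: add_divide_distrib)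
  also have "\<dots> = ennreal (\<integral>x. (f x + g x) / mass \<partial>\<nu>)"
    using mass f_nonneg g_nonneg f_int g_int by (intro nn_integral_eq_integral) auto
  also have "(\<integral>x. (f x + g x) / mass \<partial>\<nu>) = 1" using mass by (simp flip: mass_def)
  finally show ?thesis by simp
qed

lemma prob_space_\<rho>: "prob_space \<rho>"
proof
  have "emeasure \<rho> (space \<rho>) = (\<integral>\<^sup>+z. 1 \<partial>\<rho>)" by simp
  also have "\<dots> = 1" by (subst nn_integral_\<rho>) (auto simp: nn_integral_mass)
  finally show "emeasure \<rho> (space \<rho>) = 1" .
qed

lemma K_slice_meas [measurable]: "x \<in> space \<nu> \<Longrightarrow> K x \<in> borel_measurable \<nu>"
  using measurable_compose[OF measurable_Pair1' K_measurable, of x] by simp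

lemma K_slice_square: "x \<in> space \<nu> \<Longrightarrow> integrable \<nu> (\<lambda>y. (K x y)\<^sup>2)"
  using K_norm[of x] by (intro integrableI_nonneg) auto

text \<open>
  Weighting by the label turns the intensity \<open>f + g\<close> into the difference \<open>f - g\<close>.
\<close>

lemma integral_label:
  assumes [measurable]: "\<psi> \<in> borel_measurable \<nu>" and sq: "integrable \<nu> (\<lambda>x. (\<psi> x)\<^sup>2)"
  shows "integrable \<rho> (\<lambda>z. \<psi> (fst z) * label (snd z))"
    and "(\<integral>z. \<psi> (fst z) * label (snd z) \<partial>\<rho>) = (\<integral>x. \<psi> x * \<Delta> x \<partial>\<nu>) / mass"
proof -
  interpret B: sigma_finite_measure "count_space (UNIV :: bool set)"
    by (rule sigma_finite_measure_count_space_finite) simp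
  interpret P: pair_sigma_finite \<nu> "count_space (UNIV :: bool set)" ..
  have int_f: "integrable \<nu> (\<lambda>x. \<psi> x * f x)" and int_g: "integrable \<nu> (\<lambda>x. \<psi> x * g x)"
    by (intro integrable_square_product sq intensity_square_integrable f_intensity g_intensity; simp)+
  show int: "integrable \<rho> (\<lambda>z. \<psi> (fst z) * label (snd z))"
  proof (rule integrableI_bounded)
    have "(\<integral>\<^sup>+z. ennreal (norm (\<psi> (fst z) * label (snd z))) \<partial>\<rho>)
       = (\<integral>\<^sup>+x. ennreal (f x / mass) * ennreal \<bar>\<psi> x\<bar> + ennreal (g x / mass) * ennreal \<bar>\<psi> x\<bar> \<partial>\<nu>)"
      by (subst nn_integral_\<rho>) (auto simp: abs_mult)
    also have "\<dots> = (\<integral>\<^sup>+x. ennreal (\<bar>\<psi> x * f x\<bar> / mass + \<bar>\<psi> x * g x\<bar> / mass) \<partial>\<nu>)"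
      using mass f_nonneg g_nonneg
      by (intro nn_integral_cong) (simp add: ennreal_mult[symmetric] abs_mult mult.commute flip: ennreal_plus)
    also have "\<dots> < \<infinity>"
    proof -
      have "integrable \<nu> (\<lambda>x. \<bar>\<psi> x * f x\<bar> / mass + \<bar>\<psi> x * g x\<bar> / mass)"
        using int_f int_g by auto
      then show ?thesis using mass by (subst nn_integral_eq_integral) auto
    qed
    finally show "(\<integral>\<^sup>+z. ennreal (norm (\<psi> (fst z) * label (snd z))) \<partial>\<rho>) < \<infinity>" .
  qed measurable
  let ?d = "\<lambda>z. (if snd z then f (fst z) else g (fst z)) / mass"
  have d_nonneg: "AE z in \<nu> \<Otimes>\<^sub>M count_space UNIV. 0 \<le> ?d z"
    using mass f_nonneg g_nonneg by (intro AE_I2) (auto simp: space_pair_measure)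
  have meas: "(\<lambda>z. \<psi> (fst z) * label (snd z)) \<in> borel_measurable (\<nu> \<Otimes>\<^sub>M count_space UNIV)" by measurable
  have int2: "integrable (\<nu> \<Otimes>\<^sub>M count_space UNIV) (\<lambda>z. ?d z *\<^sub>R (\<psi> (fst z) * label (snd z)))"
    using int unfolding \<rho>_def by (subst (asm) integrable_density[OF meas _ d_nonneg]) auto
  have "(\<integral>z. \<psi> (fst z) * label (snd z) \<partial>\<rho>)
      = (\<integral>z. ?d z *\<^sub>R (\<psi> (fst z) * label (snd z)) \<partial>(\<nu> \<Otimes>\<^sub>M count_space UNIV))"
    unfolding \<rho>_def by (rule integral_density[OF meas _ d_nonneg]) measurable
  also have "\<dots> = (\<integral>x. \<integral>b. ?d (x, b) *\<^sub>R (\<psi> (fst (x, b)) * label (snd (x, b))) \<partial>count_space UNIV \<partial>\<nu>)"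
    by (rule P.integral_fst'[OF int2, symmetric])
  also have "\<dots> = (\<integral>x. \<psi> x * \<Delta> x / mass \<partial>\<nu>)"
    by (intro Bochner_Integration.integral_cong refl)
      (simp add: lebesgue_integral_count_space_finite UNIV_bool \<Delta>_def field_simps)
  finally show "(\<integral>z. \<psi> (fst z) * label (snd z) \<partial>\<rho>) = (\<integral>x. \<psi> x * \<Delta> x \<partial>\<nu>) / mass" by simp
qed

lemma H_section:
  assumes "z \<in> space \<rho>"
  shows "(\<integral>z'. H z z' \<partial>\<rho>) = K\<Delta> (fst z) * label (snd z) / mass"
proof -
  have x: "fst z \<in> space \<nu>" using assms by auto
  have "(\<integral>z'. H z z' \<partial>\<rho>) = (\<integral>z'. label (snd z) * (K (fst z) (fst z') * label (snd z')) \<partial>\<rho>)"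
    by (intro Bochner_Integration.integral_cong) (auto simp: H_def)
  also have "\<dots> = label (snd z) * ((\<integral>y. K (fst z) y * \<Delta> y \<partial>\<nu>) / mass)"
    using integral_label(2)[OF K_slice_meas[OF x] K_slice_square[OF x]] by simp
  finally show ?thesis by (simp add: K\<Delta>_def)
qed

lemma K\<Delta>_meas [measurable]: "K\<Delta> \<in> borel_measurable \<nu>"
  unfolding K\<Delta>_def[abs_def] by measurable

text \<open>
  The sections of the kernel are only square integrable, so the image of \<open>\<Delta>\<close> is controlled by
  Young's inequality for \<open>L\<^sup>2 * L\<^sup>1\<close>: Cauchy--Schwarz with respect to the measure with density \<open>\<bar>\<Delta>\<bar>\<close>,
  followed by an exchange of the integrals.
\<close>

lemma K\<Delta>_square: "integrable \<nu> (\<lambda>x. (K\<Delta> x)\<^sup>2)"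
proof (rule integrableI_nonneg)
  interpret P: pair_sigma_finite \<nu> \<nu> ..
  have \<Delta>_int: "integrable \<nu> \<Delta>" unfolding \<Delta>_def[abs_def] using f_int g_int by auto
  define D where "D = (\<integral>\<^sup>+y. ennreal \<bar>\<Delta> y\<bar> \<partial>\<nu>)"
  have D_fin: "D < \<infinity>" unfolding D_def using \<Delta>_int by (simp add: integrable_iff_bounded)
  have pointwise: "ennreal ((K\<Delta> x)\<^sup>2) \<le> (\<integral>\<^sup>+y. ennreal ((K x y)\<^sup>2) * ennreal \<bar>\<Delta> y\<bar> \<partial>\<nu>) * D" if x: "x \<in> space \<nu>" for x
  proof -
    note [measurable] = K_slice_meas[OF x]
    have int: "integrable \<nu> (\<lambda>y. K x y * \<Delta> y)"
      by (intro integrable_square_product K_slice_square[OF x] \<Delta>_square) auto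
    have "ennreal ((K\<Delta> x)\<^sup>2) = (ennreal (norm (K\<Delta> x)))\<^sup>2"
      by (simp add: ennreal_power)
    also have "\<dots> \<le> (\<integral>\<^sup>+y. ennreal (norm (K x y * \<Delta> y)) \<partial>\<nu>)\<^sup>2"
      unfolding K\<Delta>_def by (intro power_mono integral_norm_bound_ennreal int) simp
    also have "(\<integral>\<^sup>+y. ennreal (norm (K x y * \<Delta> y)) \<partial>\<nu>)
        = (\<integral>\<^sup>+y. ennreal (\<bar>K x y\<bar> * sqrt \<bar>\<Delta> y\<bar>) * ennreal (sqrt \<bar>\<Delta> y\<bar>) \<partial>\<nu>)"
      by (intro nn_integral_cong) (simp add: abs_mult mult.assoc flip: ennreal_mult)
    also have "\<dots>\<^sup>2 \<le> (\<integral>\<^sup>+y. (ennreal (\<bar>K x y\<bar> * sqrt \<bar>\<Delta> y\<bar>))\<^sup>2 \<partial>\<nu>) * (\<integral>\<^sup>+y. (ennreal (sqrt \<bar>\<Delta> y\<bar>))\<^sup>2 \<partial>\<nu>)"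
      by (rule Cauchy_Schwarz_nn_integral) auto
    also have "(\<integral>\<^sup>+y. (ennreal (\<bar>K x y\<bar> * sqrt \<bar>\<Delta> y\<bar>))\<^sup>2 \<partial>\<nu>) = (\<integral>\<^sup>+y. ennreal ((K x y)\<^sup>2) * ennreal \<bar>\<Delta> y\<bar> \<partial>\<nu>)"
      by (intro nn_integral_cong) (simp add: ennreal_power power_mult_distrib flip: ennreal_mult)
    also have "(\<integral>\<^sup>+y. (ennreal (sqrt \<bar>\<Delta> y\<bar>))\<^sup>2 \<partial>\<nu>) = D"
      unfolding D_def by (intro nn_integral_cong) (simp add: ennreal_power)
    finally show ?thesis .
  qed
  have "(\<integral>\<^sup>+x. ennreal ((K\<Delta> x)\<^sup>2) \<partial>\<nu>) \<le> (\<integral>\<^sup>+x. (\<integral>\<^sup>+y. ennreal ((K x y)\<^sup>2) * ennreal \<bar>\<Delta> y\<bar> \<partial>\<nu>) * D \<partial>\<nu>)"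
    by (intro nn_integral_mono pointwise)
  also have "\<dots> = (\<integral>\<^sup>+x. \<integral>\<^sup>+y. ennreal ((K x y)\<^sup>2) * ennreal \<bar>\<Delta> y\<bar> \<partial>\<nu> \<partial>\<nu>) * D"
    by (rule nn_integral_multc) measurable
  also have "(\<integral>\<^sup>+x. \<integral>\<^sup>+y. ennreal ((K x y)\<^sup>2) * ennreal \<bar>\<Delta> y\<bar> \<partial>\<nu> \<partial>\<nu>)
      = (\<integral>\<^sup>+y. \<integral>\<^sup>+x. ennreal ((K x y)\<^sup>2) * ennreal \<bar>\<Delta> y\<bar> \<partial>\<nu> \<partial>\<nu>)"
    by (rule P.Fubini'[symmetric]) measurable
  also have "\<dots> = (\<integral>\<^sup>+y. ennreal c * ennreal \<bar>\<Delta> y\<bar> \<partial>\<nu>)"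
  proof (intro nn_integral_cong)
    fix y assume y: "y \<in> space \<nu>"
    note [measurable] = K_slice_meas[OF y]
    have "(\<integral>\<^sup>+x. ennreal ((K x y)\<^sup>2) * ennreal \<bar>\<Delta> y\<bar> \<partial>\<nu>) = (\<integral>\<^sup>+x. ennreal ((K y x)\<^sup>2) * ennreal \<bar>\<Delta> y\<bar> \<partial>\<nu>)"
      using y by (intro nn_integral_cong) (simp add: K_sym)
    also have "\<dots> = ennreal c * ennreal \<bar>\<Delta> y\<bar>"
      by (subst nn_integral_multc) (auto simp: K_norm[OF y])
    finally show "(\<integral>\<^sup>+x. ennreal ((K x y)\<^sup>2) * ennreal \<bar>\<Delta> y\<bar> \<partial>\<nu>) = ennreal c * ennreal \<bar>\<Delta> y\<bar>" .
  qed
  also have "\<dots> = ennreal c * D" unfolding D_def by (rule nn_integral_cmult) measurable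
  also have "ennreal c * D * D < \<infinity>" using D_fin by (simp add: ennreal_mult_less_top)
  finally show "(\<integral>\<^sup>+x. ennreal ((K\<Delta> x)\<^sup>2) \<partial>\<nu>) < \<infinity>" .
qed auto

lemma S_nonneg: "0 \<le> S"
proof -
  have "space \<nu> \<noteq> {}" using mass_pos by (metis Bochner_Integration.integral_empty less_irrefl)
  then obtain x where "x \<in> space \<nu>" by auto
  then show ?thesis using S_bound[of x] f_nonneg[of x] g_nonneg[of x] by linarith
qed

lemma H_meas [measurable]: "case_prod H \<in> borel_measurable (\<rho> \<Otimes>\<^sub>M \<rho>)"
proof -
  have "(\<lambda>z. (fst (fst z), fst (snd z))) \<in> measurable (\<rho> \<Otimes>\<^sub>M \<rho>) (\<nu> \<Otimes>\<^sub>M \<nu>)" by measurable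
  from measurable_compose[OF this K_measurable]
  have [measurable]: "(\<lambda>z. K (fst (fst z)) (fst (snd z))) \<in> borel_measurable (\<rho> \<Otimes>\<^sub>M \<rho>)" by simp
  show ?thesis unfolding H_def case_prod_unfold by measurable
qed

lemma H_square_bound:
  "(\<integral>\<^sup>+z. ennreal ((H (fst z) (snd z))\<^sup>2) \<partial>(\<rho> \<Otimes>\<^sub>M \<rho>)) \<le> ennreal (S * c / mass)"
proof -
  interpret prob_space \<rho> by (rule prob_space_\<rho>)
  have inner: "(\<integral>\<^sup>+z'. ennreal ((H z z')\<^sup>2) \<partial>\<rho>) \<le> ennreal (S * c / mass)" if z: "z \<in> space \<rho>" for z
  proof -
    have x: "fst z \<in> space \<nu>" using z by auto
    note [measurable] = K_slice_meas[OF x]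
    have "(\<integral>\<^sup>+z'. ennreal ((H z z')\<^sup>2) \<partial>\<rho>) = (\<integral>\<^sup>+z'. ennreal ((K (fst z) (fst z'))\<^sup>2) \<partial>\<rho>)"
      by (intro nn_integral_cong) (auto simp: H_def power_mult_distrib)
    also have "\<dots> = (\<integral>\<^sup>+y. ennreal (f y / mass) * ennreal ((K (fst z) y)\<^sup>2) + ennreal (g y / mass) * ennreal ((K (fst z) y)\<^sup>2) \<partial>\<nu>)"
      by (subst nn_integral_\<rho>) auto
    also have "\<dots> \<le> (\<integral>\<^sup>+y. ennreal (S / mass) * ennreal ((K (fst z) y)\<^sup>2) \<partial>\<nu>)"
    proof (intro nn_integral_mono)
      fix y assume y: "y \<in> space \<nu>"
      have "ennreal (f y / mass) + ennreal (g y / mass) = ennreal ((f y + g y) / mass)"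
        using mass f_nonneg[OF y] g_nonneg[OF y] by (simp add: add_divide_distrib)
      also have "\<dots> \<le> ennreal (S / mass)"
        using mass S_bound[OF y] by (intro ennreal_leI divide_right_mono) auto
      finally show "ennreal (f y / mass) * ennreal ((K (fst z) y)\<^sup>2) + ennreal (g y / mass) * ennreal ((K (fst z) y)\<^sup>2)
         \<le> ennreal (S / mass) * ennreal ((K (fst z) y)\<^sup>2)"
        unfolding distrib_right[symmetric] by (rule mult_right_mono) simp
    qed
    also have "\<dots> = ennreal (S / mass) * ennreal c"
      by (subst nn_integral_cmult) (auto simp: K_norm[OF x])
    also have "\<dots> = ennreal (S * c / mass)"
      using S_nonneg c_nonneg mass by (simp add: ennreal_mult[symmetric])
    finally show ?thesis .
  qed
  have "(\<integral>\<^sup>+z. ennreal ((H (fst z) (snd z))\<^sup>2) \<partial>(\<rho> \<Otimes>\<^sub>M \<rho>)) = (\<integral>\<^sup>+z. \<integral>\<^sup>+z'. ennreal ((H z z')\<^sup>2) \<partial>\<rho> \<partial>\<rho>)"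
  proof (subst nn_integral_fst[symmetric])
    have "(\<lambda>z. H (fst z) (snd z)) \<in> borel_measurable (\<rho> \<Otimes>\<^sub>M \<rho>)" using H_meas by (simp add: case_prod_unfold)
    then show "(\<lambda>z. ennreal ((H (fst z) (snd z))\<^sup>2)) \<in> borel_measurable (\<rho> \<Otimes>\<^sub>M \<rho>)" by measurable
  qed simp
  also have "\<dots> \<le> (\<integral>\<^sup>+z. ennreal (S * c / mass) \<partial>\<rho>)" by (intro nn_integral_mono inner)
  also have "\<dots> = ennreal (S * c / mass)" by (simp only: nn_integral_const emeasure_space_1 mult_1_right)
  finally show ?thesis .
qed

sublocale stat: square_integrable_kernel \<rho> H
proof (intro square_integrable_kernel.intro square_integrable_kernel_axioms.intro iid_sequence.intro prob_space_\<rho> H_meas)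
  show "H x y = H y x" if "x \<in> space \<rho>" "y \<in> space \<rho>" for x y
    using that by (auto simp: H_def intro: K_sym)
  have "(\<lambda>(x, y). (H x y)\<^sup>2) = (\<lambda>z. (H (fst z) (snd z))\<^sup>2)" by (simp add: case_prod_unfold)
  moreover have "integrable (\<rho> \<Otimes>\<^sub>M \<rho>) (\<lambda>z. (H (fst z) (snd z))\<^sup>2)"
  proof (rule integrableI_nonneg)
    have "(\<lambda>z. H (fst z) (snd z)) \<in> borel_measurable (\<rho> \<Otimes>\<^sub>M \<rho>)" using H_meas by (simp add: case_prod_unfold)
    then show "(\<lambda>z. (H (fst z) (snd z))\<^sup>2) \<in> borel_measurable (\<rho> \<Otimes>\<^sub>M \<rho>)" by measurable
    show "(\<integral>\<^sup>+z. ennreal ((H (fst z) (snd z))\<^sup>2) \<partial>(\<rho> \<Otimes>\<^sub>M \<rho>)) < \<infinity>"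
      using H_square_bound by (rule le_less_trans) simp
  qed simp
  ultimately show "integrable (\<rho> \<Otimes>\<^sub>M \<rho>) (\<lambda>(x, y). (H x y)\<^sup>2)" by simp
qed

lemma H_norm_le: "stat.H_norm \<le> S * c / mass"
  unfolding stat.H_norm_def case_prod_unfold
  using S_nonneg c_nonneg mass by (intro integral_real_bounded H_square_bound) auto

lemma H_mean_eq: "stat.H_mean = (\<integral>x. K\<Delta> x * \<Delta> x \<partial>\<nu>) / mass\<^sup>2"
proof -
  have int: "integrable (\<rho> \<Otimes>\<^sub>M \<rho>) (case_prod H)"
    by (rule finite_measure.square_integrable_imp_integrable[OF stat.pair.finite_measure_axioms H_meas])
      (use stat.H_square in \<open>simp add: case_prod_unfold\<close>)
  have "stat.H_mean = (\<integral>z. \<integral>z'. H z z' \<partial>\<rho> \<partial>\<rho>)"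
    unfolding stat.H_mean_def using stat.pair.integral_fst'[OF int] by simp
  also have "\<dots> = (\<integral>z. (1 / mass) * (K\<Delta> (fst z) * label (snd z)) \<partial>\<rho>)"
    by (intro Bochner_Integration.integral_cong refl) (simp add: H_section)
  also have "\<dots> = (1 / mass) * ((\<integral>x. K\<Delta> x * \<Delta> x \<partial>\<nu>) / mass)"
    by (simp only: integral_mult_right_zero integral_label(2)[OF K\<Delta>_meas K\<Delta>_square])
  finally show ?thesis by (simp add: power2_eq_square)
qed

lemma H_proj_le: "stat.H_proj \<le> S * (\<integral>x. (K\<Delta> x)\<^sup>2 \<partial>\<nu>) / mass ^ 3"
proof -
  let ?Q = "\<integral>x. (K\<Delta> x)\<^sup>2 \<partial>\<nu>"
  have Q: "0 \<le> ?Q" by simp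
  have "stat.H_proj = (\<integral>z. (K\<Delta> (fst z))\<^sup>2 / mass\<^sup>2 \<partial>\<rho>)"
    unfolding stat.H_proj_def by (intro Bochner_Integration.integral_cong refl)
      (auto simp: H_section power_divide power_mult_distrib)
  also have "\<dots> \<le> S * ?Q / mass ^ 3"
  proof (rule integral_real_bounded)
    show "0 \<le> S * ?Q / mass ^ 3" using S_nonneg Q mass by simp
    have "(\<integral>\<^sup>+z. ennreal ((K\<Delta> (fst z))\<^sup>2 / mass\<^sup>2) \<partial>\<rho>)
       = (\<integral>\<^sup>+x. ennreal (f x / mass) * ennreal ((K\<Delta> x)\<^sup>2 / mass\<^sup>2) + ennreal (g x / mass) * ennreal ((K\<Delta> x)\<^sup>2 / mass\<^sup>2) \<partial>\<nu>)"
      by (subst nn_integral_\<rho>) auto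
    also have "\<dots> \<le> (\<integral>\<^sup>+x. ennreal (S / mass ^ 3 * (K\<Delta> x)\<^sup>2) \<partial>\<nu>)"
    proof (intro nn_integral_mono)
      fix x assume x: "x \<in> space \<nu>"
      have "ennreal (f x / mass) * ennreal ((K\<Delta> x)\<^sup>2 / mass\<^sup>2) + ennreal (g x / mass) * ennreal ((K\<Delta> x)\<^sup>2 / mass\<^sup>2)
        = ennreal ((f x + g x) * ((K\<Delta> x)\<^sup>2 / mass ^ 3))"
        using mass f_nonneg[OF x] g_nonneg[OF x]
        by (simp add: ennreal_mult[symmetric] field_simps power2_eq_square power3_eq_cube flip: ennreal_plus)
      also have "\<dots> \<le> ennreal (S * ((K\<Delta> x)\<^sup>2 / mass ^ 3))"
        using mass S_bound[OF x] by (intro ennreal_leI mult_right_mono) auto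
      finally show "ennreal (f x / mass) * ennreal ((K\<Delta> x)\<^sup>2 / mass\<^sup>2) + ennreal (g x / mass) * ennreal ((K\<Delta> x)\<^sup>2 / mass\<^sup>2)
        \<le> ennreal (S / mass ^ 3 * (K\<Delta> x)\<^sup>2)" by simp
    qed
    also have "\<dots> = ennreal (\<integral>x. S / mass ^ 3 * (K\<Delta> x)\<^sup>2 \<partial>\<nu>)"
      using S_nonneg mass K\<Delta>_square by (intro nn_integral_eq_integral) auto
    finally show "(\<integral>\<^sup>+z. ennreal ((K\<Delta> (fst z))\<^sup>2 / mass\<^sup>2) \<partial>\<rho>) \<le> ennreal (S * ?Q / mass ^ 3)" by simp
  qed
  finally show ?thesis .
qed

text \<open>
  This identity expresses the expectation of the statistic through the bias of the kernel.
\<close>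

lemma polarisation:
  "2 * (\<integral>x. K\<Delta> x * \<Delta> x \<partial>\<nu>)
    = (\<integral>x. (\<Delta> x)\<^sup>2 \<partial>\<nu>) + (\<integral>x. (K\<Delta> x)\<^sup>2 \<partial>\<nu>) - (\<integral>x. (\<Delta> x - K\<Delta> x)\<^sup>2 \<partial>\<nu>)"
proof -
  have "(\<integral>x. (\<Delta> x - K\<Delta> x)\<^sup>2 \<partial>\<nu>) = (\<integral>x. (\<Delta> x)\<^sup>2 + (K\<Delta> x)\<^sup>2 - 2 * (K\<Delta> x * \<Delta> x) \<partial>\<nu>)"
    by (intro Bochner_Integration.integral_cong refl) (simp add: power2_diff)
  also have "\<dots> = (\<integral>x. (\<Delta> x)\<^sup>2 \<partial>\<nu>) + (\<integral>x. (K\<Delta> x)\<^sup>2 \<partial>\<nu>) - 2 * (\<integral>x. K\<Delta> x * \<Delta> x \<partial>\<nu>)"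
    using \<Delta>_square K\<Delta>_square integrable_square_product[OF K\<Delta>_meas \<Delta>_meas K\<Delta>_square \<Delta>_square]
    by (simp add: Bochner_Integration.integral_diff Bochner_Integration.integral_add)
  finally show ?thesis by simp
qed

end

section \<open>Separation of the statistic from its critical value\<close>

context two_sample
begin

definition sample :: "(nat \<times> (nat \<Rightarrow> 'a \<times> bool)) measure" where
  "sample = measure_pmf (pois (n * mass)) \<Otimes>\<^sub>M stat.seq"

definition energy :: "nat \<Rightarrow> (nat \<Rightarrow> 'a \<times> bool) \<Rightarrow> real" where
  "energy k \<omega> = (\<Sum>(i, j)\<in>offdiag k. (K (fst (\<omega> i)) (fst (\<omega> j)))\<^sup>2)"

lemma H_square_eq: "(H z z')\<^sup>2 = (K (fst z) (fst z'))\<^sup>2"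
  by (simp add: H_def power_mult_distrib)

lemma energy_nonneg: "0 \<le> energy k \<omega>"
  unfolding energy_def by (intro sum_nonneg) auto

lemma measurable_energy [measurable]: "energy k \<in> borel_measurable stat.seq"
  unfolding energy_def[abs_def] H_square_eq[symmetric] by (auto simp: case_prod_unfold)

lemma sample_measurable:
  "(\<lambda>(k, \<omega>). energy k \<omega>) \<in> borel_measurable sample"
  "(\<lambda>(k, \<omega>). stat.pair_sum k \<omega>) \<in> borel_measurable sample"
  unfolding sample_def by (auto intro!: measurable_pmf_pair)

lemma prob_space_sample: "prob_space sample"
proof -
  interpret N: pair_prob_space "measure_pmf (pois (n * mass))" stat.seq ..
  show ?thesis unfolding sample_def by (rule N.prob_space_axioms)
qed

lemma energy_expectation:
  shows "integrable sample (\<lambda>(k, \<omega>). energy k \<omega>)" "(\<integral>(k, \<omega>). energy k \<omega> \<partial>sample) \<le> n\<^sup>2 * (S * mass * c)"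
proof -
  have l: "0 \<le> n * mass" using n_pos mass by simp
  have H2: "(\<lambda>(x, y). ennreal ((H x y)\<^sup>2)) \<in> borel_measurable (\<rho> \<Otimes>\<^sub>M \<rho>)"
    using H_meas by (simp add: case_prod_unfold)
  have "(\<integral>\<^sup>+z. ennreal (case z of (k, \<omega>) \<Rightarrow> energy k \<omega>) \<partial>sample)
      = (\<integral>\<^sup>+(k, \<omega>). (\<Sum>(i, j)\<in>offdiag k. ennreal ((H (\<omega> i) (\<omega> j))\<^sup>2)) \<partial>sample)"
    by (intro nn_integral_cong) (auto simp: energy_def H_square_eq case_prod_unfold)
  also have "\<dots> = ennreal ((n * mass)\<^sup>2) * (\<integral>\<^sup>+z. ennreal ((H (fst z) (snd z))\<^sup>2) \<partial>(\<rho> \<Otimes>\<^sub>M \<rho>))"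
    unfolding sample_def using stat.nn_integral_pair_sum[OF H2 l] by (simp add: case_prod_unfold)
  also have "\<dots> \<le> ennreal ((n * mass)\<^sup>2) * ennreal (S * c / mass)"
    by (intro mult_left_mono H_square_bound) simp
  also have "\<dots> = ennreal (n\<^sup>2 * (S * mass * c))"
  proof -
    have "(n * mass)\<^sup>2 * (S * c / mass) = n\<^sup>2 * (S * mass * c)"
      using mass by (simp add: power2_eq_square)
    then show ?thesis using mass S_nonneg c_nonneg by (subst ennreal_mult[symmetric]) auto
  qed
  finally have le: "(\<integral>\<^sup>+z. ennreal (case z of (k, \<omega>) \<Rightarrow> energy k \<omega>) \<partial>sample) \<le> ennreal (n\<^sup>2 * (S * mass * c))" .
  show "integrable sample (\<lambda>(k, \<omega>). energy k \<omega>)"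
    using le_less_trans[OF le] by (intro integrableI_nonneg sample_measurable) (auto simp: energy_nonneg)
  show "(\<integral>(k, \<omega>). energy k \<omega> \<partial>sample) \<le> n\<^sup>2 * (S * mass * c)"
    using le mass S_nonneg c_nonneg by (intro integral_real_bounded) auto
qed

text \<open>
  The variance has a linear term, bounded with \<open>H_proj_le\<close>, and a degenerate quadratic one.
\<close>

lemma stat_moments:
  defines "Q \<equiv> \<integral>x. (K\<Delta> x)\<^sup>2 \<partial>\<nu>" and "\<mu> \<equiv> n\<^sup>2 * (\<integral>x. K\<Delta> x * \<Delta> x \<partial>\<nu>)"
  shows "integrable sample (\<lambda>z. (case_prod stat.pair_sum z - \<mu>)\<^sup>2)"
    and "(\<integral>z. (case_prod stat.pair_sum z - \<mu>)\<^sup>2 \<partial>sample) \<le> 4 * n ^ 3 * S * Q + 2 * n\<^sup>2 * (S * mass * c)"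
proof -
  interpret N: prob_space sample by (rule prob_space_sample)
  have l: "0 \<le> n * mass" using n_pos mass by simp
  note int1 = stat.integrable_poisson_pair_sum[OF l, folded sample_def]
  note int2 = stat.integrable_poisson_pair_sum_square[OF l, folded sample_def]
  have \<mu>: "(n * mass)\<^sup>2 * stat.H_mean = \<mu>"
    unfolding H_mean_eq \<mu>_def using mass by (simp add: power_mult_distrib)
  have E1: "(\<integral>z. case_prod stat.pair_sum z \<partial>sample) = \<mu>"
    using stat.integral_poisson_pair_sum[OF l, folded sample_def] \<mu> by simp
  have E2: "(\<integral>z. (case_prod stat.pair_sum z)\<^sup>2 \<partial>sample) = \<mu>\<^sup>2 + 4 * (n * mass) ^ 3 * stat.H_proj + 2 * (n * mass)\<^sup>2 * stat.H_norm"
  proof -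
    have "(n * mass) ^ 4 * stat.H_mean\<^sup>2 = \<mu>\<^sup>2" unfolding \<mu>[symmetric] by (simp add: power_mult_distrib)
    then show ?thesis
      using stat.integral_poisson_pair_sum_square[OF l, folded sample_def] by (simp add: case_prod_unfold)
  qed
  have expand: "(case_prod stat.pair_sum z - \<mu>)\<^sup>2 = (case_prod stat.pair_sum z)\<^sup>2 - 2 * \<mu> * case_prod stat.pair_sum z + \<mu>\<^sup>2" for z
    by (simp add: power2_diff)
  have int2': "integrable sample (\<lambda>z. (case_prod stat.pair_sum z)\<^sup>2)" using int2 by (simp add: case_prod_unfold)
  have int1': "integrable sample (\<lambda>z. case_prod stat.pair_sum z)" using int1 by simp
  show "integrable sample (\<lambda>z. (case_prod stat.pair_sum z - \<mu>)\<^sup>2)"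
    unfolding expand using int1' int2' by (intro Bochner_Integration.integrable_add Bochner_Integration.integrable_diff integrable_mult_right) auto
  have "(\<integral>z. (case_prod stat.pair_sum z - \<mu>)\<^sup>2 \<partial>sample) = (\<integral>z. (case_prod stat.pair_sum z)\<^sup>2 \<partial>sample) - 2 * \<mu> * \<mu> + \<mu>\<^sup>2"
    unfolding expand using int1' int2' by (simp add: E1 N.prob_space del: case_prod_unfold)
  also have "\<dots> = 4 * (n * mass) ^ 3 * stat.H_proj + 2 * (n * mass)\<^sup>2 * stat.H_norm"
    unfolding E2 by (simp add: power2_eq_square)
  also have "\<dots> \<le> 4 * (n * mass) ^ 3 * (S * Q / mass ^ 3) + 2 * (n * mass)\<^sup>2 * (S * c / mass)"
    using H_proj_le H_norm_le n_pos mass unfolding Q_def by (intro add_mono mult_left_mono) auto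
  also have "\<dots> = 4 * n ^ 3 * S * Q + 2 * n\<^sup>2 * (S * mass * c)"
    using mass by (simp add: power_mult_distrib power2_eq_square)
  finally show "(\<integral>z. (case_prod stat.pair_sum z - \<mu>)\<^sup>2 \<partial>sample) \<le> 4 * n ^ 3 * S * Q + 2 * n\<^sup>2 * (S * mass * c)" .
qed

lemma K\<Delta>_zero:
  assumes "c = 0" "x \<in> space \<nu>"
  shows "K\<Delta> x = 0"
proof -
  note [measurable] = K_slice_meas[OF assms(2)]
  have "(\<integral>\<^sup>+y. ennreal ((K x y)\<^sup>2) \<partial>\<nu>) = 0" using K_norm[OF assms(2)] assms(1) by simp
  then have "AE y in \<nu>. ennreal ((K x y)\<^sup>2) = 0" by (subst (asm) nn_integral_0_iff_AE) auto
  then have "AE y in \<nu>. K x y * \<Delta> y = 0" by eventually_elim auto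
  then show ?thesis unfolding K\<Delta>_def by (rule integral_eq_zero_AE)
qed

text \<open>
  The separation assumption says that the expectation \<open>\<mu>\<close> of the statistic exceeds the critical value by
  \<open>sqrt (2 / \<beta>)\<close> standard deviations. By polarisation it bounds \<open>\<mu>\<close> from below by
  \<open>n\<^sup>2 * Q / 2 + 4 * n * S / \<beta>\<close> plus two terms in \<open>R\<close>. The first two dominate
  \<open>sqrt (8 * n ^ 3 * S * Q / \<beta>)\<close>, the linear part of the deviation, by \<open>2 * sqrt (x * y) \<le> x + y\<close>; the
  terms in \<open>R\<close> are its quadratic part and the critical value.
\<close>

lemma signal_exceeds_noise:
  fixes \<beta> L :: real
  defines "Q \<equiv> \<integral>x. (K\<Delta> x)\<^sup>2 \<partial>\<nu>" and "\<mu> \<equiv> n\<^sup>2 * (\<integral>x. K\<Delta> x * \<Delta> x \<partial>\<nu>)" and "R \<equiv> sqrt (S * mass * c)"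
  assumes \<beta>: "0 < \<beta>"
    and separated: "(\<integral>x. (\<Delta> x)\<^sup>2 \<partial>\<nu>) \<ge> (\<integral>x. (\<Delta> x - K\<Delta> x)\<^sup>2 \<partial>\<nu>)
       + (4 + 2 * sqrt 2 * L) / (n * sqrt \<beta>) * R + 8 * S / (\<beta> * n)"
  shows "sqrt (2 * (4 * n ^ 3 * S * Q + 2 * n\<^sup>2 * R\<^sup>2) / \<beta>) + sqrt 2 * L * n * R / sqrt \<beta> \<le> \<mu>"
proof -
  have four_prod: "4 * x * y \<le> (x + y)\<^sup>2" for x y :: real
    using zero_le_power2[of "x - y"] by (simp add: power2_eq_square algebra_simps)
  have R: "0 \<le> R" unfolding R_def using S_nonneg mass c_nonneg by simp
  have Q: "0 \<le> Q" unfolding Q_def by simp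
  define b where "b = sqrt \<beta>"
  have b: "0 < b" "\<beta> = b\<^sup>2" using \<beta> unfolding b_def by auto
  have "2 * (\<integral>x. K\<Delta> x * \<Delta> x \<partial>\<nu>) \<ge> Q + (4 + 2 * sqrt 2 * L) / (n * b) * R + 8 * S / (\<beta> * n)"
    using separated polarisation unfolding Q_def b_def by linarith
  then have "n\<^sup>2 / 2 * (Q + (4 + 2 * sqrt 2 * L) / (n * b) * R + 8 * S / (\<beta> * n)) \<le> n\<^sup>2 / 2 * (2 * (\<integral>x. K\<Delta> x * \<Delta> x \<partial>\<nu>))"
    by (intro mult_left_mono) auto
  also have "\<dots> = \<mu>" unfolding \<mu>_def by simp
  also have "n\<^sup>2 / 2 * (Q + (4 + 2 * sqrt 2 * L) / (n * b) * R + 8 * S / (\<beta> * n))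
      = (n\<^sup>2 * Q / 2 + 4 * n * S / \<beta>) + 2 * n * R / b + sqrt 2 * L * n * R / b"
    using n_pos b by (simp add: field_simps power2_eq_square)
  finally have \<mu>: "(n\<^sup>2 * Q / 2 + 4 * n * S / \<beta>) + 2 * n * R / b + sqrt 2 * L * n * R / b \<le> \<mu>" .
  have "sqrt (2 * (4 * n ^ 3 * S * Q + 2 * n\<^sup>2 * R\<^sup>2) / \<beta>) = sqrt (8 * n ^ 3 * S * Q / \<beta> + (2 * n * R / b)\<^sup>2)"
    using b by (simp add: field_simps power2_eq_square)
  also have "\<dots> \<le> sqrt (8 * n ^ 3 * S * Q / \<beta>) + sqrt ((2 * n * R / b)\<^sup>2)"
    using n_pos S_nonneg Q \<beta> by (intro sqrt_add_le_add_sqrt) auto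
  also have "sqrt ((2 * n * R / b)\<^sup>2) = 2 * n * R / b" using n_pos R b by simp
  also have "sqrt (8 * n ^ 3 * S * Q / \<beta>) \<le> n\<^sup>2 * Q / 2 + 4 * n * S / \<beta>"
  proof (rule real_le_lsqrt)
    show "0 \<le> n\<^sup>2 * Q / 2 + 4 * n * S / \<beta>" using n_pos S_nonneg Q \<beta> by auto
    have "8 * n ^ 3 * S * Q / \<beta> = 4 * (n\<^sup>2 * Q / 2) * (4 * n * S / \<beta>)"
      by (simp add: power2_eq_square power3_eq_cube)
    also have "\<dots> \<le> (n\<^sup>2 * Q / 2 + 4 * n * S / \<beta>)\<^sup>2"
      by (rule four_prod)
    finally show "8 * n ^ 3 * S * Q / \<beta> \<le> (n\<^sup>2 * Q / 2 + 4 * n * S / \<beta>)\<^sup>2" .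
  qed
  finally show ?thesis using \<mu> unfolding b_def by linarith
qed

text \<open>
  The statistic falls below its critical value only if the energy exceeds \<open>2 / \<beta>\<close> times the bound of its
  expectation, or the statistic deviates from its expectation by \<open>sqrt (2 / \<beta>)\<close> standard deviations.
  Markov's and Chebyshev's inequality bound both probabilities by \<open>\<beta> / 2\<close>.
\<close>

lemma power_bound:
  fixes \<beta> L :: real
  assumes \<beta>: "0 < \<beta>" and S: "0 < S" and L: "0 \<le> L"
    and separated: "(\<integral>x. (\<Delta> x)\<^sup>2 \<partial>\<nu>) \<ge> (\<integral>x. (\<Delta> x - K\<Delta> x)\<^sup>2 \<partial>\<nu>)
       + (4 + 2 * sqrt 2 * L) / (n * sqrt \<beta>) * sqrt (S * mass * c) + 8 * S / (\<beta> * n)"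
  shows "measure sample {z \<in> space sample. case_prod stat.pair_sum z \<le> L * sqrt (case_prod energy z)} \<le> \<beta>"
proof -
  interpret N: prob_space sample by (rule prob_space_sample)
  let ?R = "sqrt (S * mass * c)"
  let ?\<mu> = "n\<^sup>2 * (\<integral>x. K\<Delta> x * \<Delta> x \<partial>\<nu>)"
  let ?Q = "\<integral>x. (K\<Delta> x)\<^sup>2 \<partial>\<nu>"
  define W where "W = 4 * n ^ 3 * S * ?Q + 2 * n\<^sup>2 * ?R\<^sup>2"
  \<comment> \<open>A kernel that vanishes almost everywhere has full bias and violates the separation assumption. For
    \<open>c > 0\<close> the deviation \<open>a\<close> is strictly positive, as Chebyshev's inequality requires.\<close>
  have c: "c \<noteq> 0"
  proof
    assume "c = 0"
    then have "(\<integral>x. (\<Delta> x - K\<Delta> x)\<^sup>2 \<partial>\<nu>) = (\<integral>x. (\<Delta> x)\<^sup>2 \<partial>\<nu>)"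
      by (intro Bochner_Integration.integral_cong refl) (simp add: K\<Delta>_zero)
    moreover have "0 < 8 * S / (\<beta> * n)" using S \<beta> n_pos by simp
    ultimately show False using separated \<open>c = 0\<close> by simp
  qed
  then have R: "0 < ?R" and R2: "?R\<^sup>2 = S * mass * c" using S mass c_nonneg by auto
  have W: "0 < W" unfolding W_def using R n_pos S by (intro add_nonneg_pos) auto
  define a where "a = sqrt (2 * W / \<beta>)"
  have a: "0 < a" "a\<^sup>2 = 2 * W / \<beta>" unfolding a_def using W \<beta> by auto
  have signal: "a + sqrt 2 * L * n * ?R / sqrt \<beta> \<le> ?\<mu>"
    using signal_exceeds_noise[OF \<beta> separated] unfolding a_def W_def .
  note [measurable] = sample_measurable
  let ?V = "\<lambda>z. case_prod stat.pair_sum z" and ?E = "\<lambda>z. case_prod energy z"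
  let ?t = "2 * (n\<^sup>2 * ?R\<^sup>2) / \<beta>"
  have t: "0 < ?t" using n_pos R \<beta> by auto
  have Vm [measurable]: "?V \<in> borel_measurable sample" using sample_measurable(2) by simp
  have Em [measurable]: "?E \<in> borel_measurable sample" using sample_measurable(1) by simp
  have "{z \<in> space sample. ?V z \<le> L * sqrt (?E z)}
      \<subseteq> {z \<in> space sample. ?E z \<ge> ?t} \<union> {z \<in> space sample. (?V z - ?\<mu>)\<^sup>2 \<ge> a\<^sup>2}"
  proof
    fix z assume z: "z \<in> {z \<in> space sample. ?V z \<le> L * sqrt (?E z)}"
    show "z \<in> {z \<in> space sample. ?E z \<ge> ?t} \<union> {z \<in> space sample. (?V z - ?\<mu>)\<^sup>2 \<ge> a\<^sup>2}"
    proof (cases "?E z \<ge> ?t")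
      case False
      have "?V z \<le> L * sqrt (?E z)" using z by simp
      also have "\<dots> \<le> L * sqrt ?t" using False L by (intro mult_left_mono real_sqrt_le_mono) auto
      also have "sqrt ?t = sqrt 2 * n * ?R / sqrt \<beta>"
        using n_pos R by (simp add: real_sqrt_divide real_sqrt_mult)
      finally have "a \<le> ?\<mu> - ?V z" using signal by (simp add: mult.assoc mult.left_commute)
      then have "a\<^sup>2 \<le> (?\<mu> - ?V z)\<^sup>2" using a by (intro power_mono) auto
      then show ?thesis using z by (simp add: power2_commute)
    qed (use z in simp)
  qed
  then have "measure sample {z \<in> space sample. ?V z \<le> L * sqrt (?E z)}
     \<le> measure sample ({z \<in> space sample. ?E z \<ge> ?t} \<union> {z \<in> space sample. (?V z - ?\<mu>)\<^sup>2 \<ge> a\<^sup>2})"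
    by (rule N.finite_measure_mono) measurable
  also have "\<dots> \<le> measure sample {z \<in> space sample. ?E z \<ge> ?t} + measure sample {z \<in> space sample. (?V z - ?\<mu>)\<^sup>2 \<ge> a\<^sup>2}"
    by (rule measure_Un_le) measurable
  also have "\<dots> \<le> \<beta> / 2 + \<beta> / 2"
  proof (rule add_mono)
    have "measure sample {z \<in> space sample. ?E z \<ge> ?t} \<le> (\<integral>z. ?E z \<partial>sample) / ?t"
      using energy_expectation(1) t
      by (intro integral_Markov_inequality_measure[where A = "space sample"]) (auto simp: energy_nonneg)
    also have "\<dots> \<le> (n\<^sup>2 * ?R\<^sup>2) / ?t"
      using energy_expectation(2) t unfolding R2 by (intro divide_right_mono) auto
    also have "\<dots> = \<beta> / 2" unfolding R2 using n_pos S mass c \<beta> by (simp add: field_simps)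
    finally show "measure sample {z \<in> space sample. ?E z \<ge> ?t} \<le> \<beta> / 2" .
    have "measure sample {z \<in> space sample. (?V z - ?\<mu>)\<^sup>2 \<ge> a\<^sup>2} \<le> (\<integral>z. (?V z - ?\<mu>)\<^sup>2 \<partial>sample) / a\<^sup>2"
      using stat_moments(1) a(1) by (intro integral_Markov_inequality_measure[where A = "space sample"]) auto
    also have "\<dots> \<le> W / a\<^sup>2"
      using stat_moments(2) a(1) unfolding W_def R2 by (intro divide_right_mono) auto
    also have "\<dots> = \<beta> / 2" unfolding a(2) using W \<beta> by (simp add: field_simps)
    finally show "measure sample {z \<in> space sample. (?V z - ?\<mu>)\<^sup>2 \<ge> a\<^sup>2} \<le> \<beta> / 2" .
  qed
  finally show ?thesis by simp
qed

end

section \<open>Marked samples realise the joint law\<close>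

lemma emeasure_pmf_pair_Collect:
  fixes p :: "nat pmf"
  assumes N: "prob_space N" and Q: "\<And>k. {\<omega> \<in> space N. Q k \<omega>} \<in> sets N"
  shows "emeasure (measure_pmf p \<Otimes>\<^sub>M N) {z \<in> space (measure_pmf p \<Otimes>\<^sub>M N). Q (fst z) (snd z)}
     = (\<integral>\<^sup>+k. emeasure N {\<omega> \<in> space N. Q k \<omega>} \<partial>measure_pmf p)"
proof -
  interpret N: prob_space N by (rule N)
  have "(\<lambda>z. Q (fst z) (snd z)) \<in> measurable (measure_pmf p \<Otimes>\<^sub>M N) (count_space UNIV)"
    using Q by (intro measurable_pmf_pair) (auto simp: pred_def)
  then have "{z \<in> space (measure_pmf p \<Otimes>\<^sub>M N). Q (fst z) (snd z)} \<in> sets (measure_pmf p \<Otimes>\<^sub>M N)"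
    by (simp add: pred_def)
  then show ?thesis
    by (subst N.emeasure_pair_measure_alt) (auto intro!: nn_integral_cong arg_cong[where f = "emeasure N"] simp: space_pair_measure)
qed

locale marked_points = prob_space N for N :: "'o measure" +
  fixes d :: nat and X :: "nat \<Rightarrow> 'o \<Rightarrow> nat \<Rightarrow> real" and s :: "nat \<Rightarrow> 'o \<Rightarrow> real"
  assumes X [measurable]: "\<And>i. X i \<in> measurable N (lebesgue_n d)"
    and s [measurable]: "\<And>i. s i \<in> borel_measurable N"
begin

definition configuration :: "nat \<times> 'o \<Rightarrow> (nat \<Rightarrow> real) set \<times> (nat \<Rightarrow> real) set" where
  "configuration z = sign_split (fst z) (\<lambda>i. X i (snd z)) (\<lambda>i. s i (snd z))"

lemma fst_avoids_iff: "fst (configuration z) \<inter> B = {} \<longleftrightarrow> (\<forall>i\<in>{1..fst z}. s i (snd z) = 1 \<longrightarrow> X i (snd z) \<notin> B)"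
  and snd_avoids_iff: "snd (configuration z) \<inter> C = {} \<longleftrightarrow> (\<forall>i\<in>{1..fst z}. s i (snd z) \<noteq> 1 \<longrightarrow> X i (snd z) \<notin> C)"
  unfolding configuration_def sign_split_def by (simp_all only: fst_conv snd_conv) blast+

lemma avoids_sets:
  assumes [measurable]: "B \<in> sets (lebesgue_n d)" "C \<in> sets (lebesgue_n d)"
  shows "{\<omega> \<in> space N. \<forall>i\<in>{1..k}. (s i \<omega> = 1 \<longrightarrow> X i \<omega> \<notin> B) \<and> (s i \<omega> \<noteq> 1 \<longrightarrow> X i \<omega> \<notin> C)} \<in> sets N"
  by measurable

lemma measurable_configuration:
  fixes p :: "nat pmf"
  shows "configuration \<in> measurable (measure_pmf p \<Otimes>\<^sub>M N) (configs (lebesgue_n d) \<Otimes>\<^sub>M configs (lebesgue_n d))"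
proof (rule measurable_pmf_pair)
  fix k
  have sub: "X i \<omega> \<in> space (lebesgue_n d)" if "\<omega> \<in> space N" for i \<omega>
    using measurable_space[OF X that] .
  have "(\<lambda>\<omega>. (fst (configuration (k, \<omega>)), snd (configuration (k, \<omega>)))) \<in> measurable N (configs (lebesgue_n d) \<Otimes>\<^sub>M configs (lebesgue_n d))"
  proof (intro measurable_Pair lebesgue_cells.measurable_configsI)
    show "fst (configuration (k, \<omega>)) \<subseteq> space (lebesgue_n d)" "snd (configuration (k, \<omega>)) \<subseteq> space (lebesgue_n d)"
      if "\<omega> \<in> space N" for \<omega>
      using sub[OF that] by (auto simp: configuration_def sign_split_def)
    fix B assume [measurable]: "B \<in> sets (lebesgue_n d)"
    show "{\<omega> \<in> space N. fst (configuration (k, \<omega>)) \<inter> B = {}} \<in> sets N"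
      unfolding fst_avoids_iff fst_conv snd_conv by measurable
    show "{\<omega> \<in> space N. snd (configuration (k, \<omega>)) \<inter> B = {}} \<in> sets N"
      unfolding snd_avoids_iff fst_conv snd_conv by measurable
  qed
  then show "(\<lambda>\<omega>. configuration (k, \<omega>)) \<in> measurable N (configs (lebesgue_n d) \<Otimes>\<^sub>M configs (lebesgue_n d))" by simp
qed

text \<open>
  If the labelled points are such that \<open>k\<close> of them avoid a given set with probability \<open>v ^ k\<close>, then the
  Poisson number of points turns this into the void probability \<open>exp (- l * (1 - v))\<close>.
\<close>

lemma joint_law_eq_marked:
  assumes P: "joint_law (lebesgue_n d) n f g P" and f: "intensity (lebesgue_n d) f" and g: "intensity (lebesgue_n d) g"
    and n: "0 < n" and l: "0 \<le> l"
    and void: "\<And>B C. B \<in> sets (lebesgue_n d) \<Longrightarrow> C \<in> sets (lebesgue_n d) \<Longrightarrow> \<exists>v\<ge>0.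
       l * (1 - v) = n * (\<integral>x. f x * indicator B x \<partial>lebesgue_n d) + n * (\<integral>x. g x * indicator C x \<partial>lebesgue_n d) \<and>
       (\<forall>k. emeasure N {\<omega> \<in> space N. \<forall>i\<in>{1..k}. (s i \<omega> = 1 \<longrightarrow> X i \<omega> \<notin> B) \<and> (s i \<omega> \<noteq> 1 \<longrightarrow> X i \<omega> \<notin> C)} = ennreal (v ^ k))"
  shows "P = distr (measure_pmf (pois l) \<Otimes>\<^sub>M N) (configs (lebesgue_n d) \<Otimes>\<^sub>M configs (lebesgue_n d)) configuration"
proof (rule joint_law_eq_distr[OF P f g n])
  interpret M: pair_prob_space "measure_pmf (pois l)" N ..
  let ?M = "measure_pmf (pois l) \<Otimes>\<^sub>M N"
  show "prob_space ?M" by (rule M.prob_space_axioms)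
  show "configuration \<in> measurable ?M (configs (lebesgue_n d) \<Otimes>\<^sub>M configs (lebesgue_n d))"
    by (rule measurable_configuration)
  fix B C assume BC: "B \<in> sets (lebesgue_n d)" "C \<in> sets (lebesgue_n d)"
  obtain v where v: "0 \<le> v"
    "l * (1 - v) = n * (\<integral>x. f x * indicator B x \<partial>lebesgue_n d) + n * (\<integral>x. g x * indicator C x \<partial>lebesgue_n d)"
    "\<And>k. emeasure N {\<omega> \<in> space N. \<forall>i\<in>{1..k}. (s i \<omega> = 1 \<longrightarrow> X i \<omega> \<notin> B) \<and> (s i \<omega> \<noteq> 1 \<longrightarrow> X i \<omega> \<notin> C)} = ennreal (v ^ k)"
    using void[OF BC] by blast
  have "{z \<in> space ?M. fst (configuration z) \<inter> B = {} \<and> snd (configuration z) \<inter> C = {}}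
     = {z \<in> space ?M. \<forall>i\<in>{1..fst z}. (s i (snd z) = 1 \<longrightarrow> X i (snd z) \<notin> B) \<and> (s i (snd z) \<noteq> 1 \<longrightarrow> X i (snd z) \<notin> C)}"
    unfolding fst_avoids_iff snd_avoids_iff by blast
  also have "emeasure ?M \<dots> = (\<integral>\<^sup>+k. ennreal (v ^ k) \<partial>measure_pmf (pois l))"
    by (subst emeasure_pmf_pair_Collect[OF prob_space_axioms]) (auto simp only: v(3) intro!: avoids_sets BC)
  also have "\<dots> = ennreal (exp (l * (v - 1)))" by (rule pois_generating[OF l v(1)])
  finally have "measure ?M {z \<in> space ?M. fst (configuration z) \<inter> B = {} \<and> snd (configuration z) \<inter> C = {}} = exp (l * (v - 1))"
    by (simp add: measure_def)
  also have "l * (v - 1) = - (n * (\<integral>x. f x * indicator B x \<partial>lebesgue_n d)) + - (n * (\<integral>x. g x * indicator C x \<partial>lebesgue_n d))"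
    using v(2) by (simp add: algebra_simps)
  finally show "measure ?M {z \<in> space ?M. fst (configuration z) \<inter> B = {} \<and> snd (configuration z) \<inter> C = {}}
     = exp (- (n * (\<integral>x. f x * indicator B x \<partial>lebesgue_n d))) * exp (- (n * (\<integral>x. g x * indicator C x \<partial>lebesgue_n d)))"
    by (simp only: exp_add)
qed

end

lemma (in iid_sequence) AE_distinct:
  assumes meas: "{z \<in> space (\<rho> \<Otimes>\<^sub>M \<rho>). p (fst z) = p (snd z)} \<in> sets (\<rho> \<Otimes>\<^sub>M \<rho>)"
    and atomless: "\<And>y. y \<in> space \<rho> \<Longrightarrow> emeasure \<rho> {x \<in> space \<rho>. p x = p y} = 0"
  shows "AE \<omega> in seq. inj (\<lambda>i. p (\<omega> i))"
proof -
  let ?D = "{z \<in> space (\<rho> \<Otimes>\<^sub>M \<rho>). p (fst z) = p (snd z)}"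
  have "emeasure (\<rho> \<Otimes>\<^sub>M \<rho>) ?D = (\<integral>\<^sup>+y. emeasure \<rho> ((\<lambda>x. (x, y)) -` ?D) \<partial>\<rho>)"
    by (rule pair.emeasure_pair_measure_alt2[OF meas])
  also have "\<dots> = (\<integral>\<^sup>+y. 0 \<partial>\<rho>)"
  proof (intro nn_integral_cong)
    fix y assume y: "y \<in> space \<rho>"
    then have "(\<lambda>x. (x, y)) -` ?D = {x \<in> space \<rho>. p x = p y}" by (auto simp: space_pair_measure)
    then show "emeasure \<rho> ((\<lambda>x. (x, y)) -` ?D) = 0" using atomless[OF y] by simp
  qed
  finally have "?D \<in> null_sets (\<rho> \<Otimes>\<^sub>M \<rho>)" using meas by auto
  then have ae: "AE z in \<rho> \<Otimes>\<^sub>M \<rho>. p (fst z) \<noteq> p (snd z)"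
    by (rule AE_I') auto
  have "AE \<omega> in seq. i \<noteq> j \<longrightarrow> p (\<omega> i) \<noteq> p (\<omega> j)" for i j
  proof (cases "i = j")
    case False
    have "AE z in distr seq (\<rho> \<Otimes>\<^sub>M \<rho>) (\<lambda>\<omega>. (\<omega> i, \<omega> j)). p (fst z) \<noteq> p (snd z)"
      unfolding pair_law[OF False] by (rule ae)
    from AE_distrD[OF measurable_pair_coordinates this] show ?thesis by auto
  qed simp
  then have "AE \<omega> in seq. \<forall>i j. i \<noteq> j \<longrightarrow> p (\<omega> i) \<noteq> p (\<omega> j)" by (simp add: AE_all_countable)
  then show ?thesis by eventually_elim (auto simp: inj_def)
qed

section \<open>Kernels on Euclidean space\<close>

interpretation lborel_product: product_sigma_finite "\<lambda>_::nat. lborel :: real measure"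
  by standard

lemma sigma_finite_lebesgue_n: "sigma_finite_measure (lebesgue_n d)"
  unfolding lebesgue_n_def by (rule lborel_product.sigma_finite) simp

lemma emeasure_lebesgue_n_point:
  assumes d: "1 \<le> d" and a: "a \<in> space (lebesgue_n d)"
  shows "{a} \<in> null_sets (lebesgue_n d)"
proof -
  have eq: "{a} = (\<Pi>\<^sub>E i\<in>{..<d}. {a i})"
    using a unfolding space_lebesgue_n by (intro PiE_singleton[symmetric]) (auto simp: PiE_iff)
  have "emeasure (lebesgue_n d) (\<Pi>\<^sub>E i\<in>{..<d}. {a i}) = (\<Prod>i<d. emeasure lborel {a i})"
    unfolding lebesgue_n_def by (rule lborel_product.emeasure_PiM) auto
  also have "\<dots> = 0" using d by (auto simp: prod_zero_iff intro!: bexI[of _ 0])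
  finally have "emeasure (lebesgue_n d) {a} = 0" unfolding eq .
  moreover have "{a} \<in> sets (lebesgue_n d)"
    unfolding eq lebesgue_n_def by (intro sets_PiM_I_finite) auto
  ultimately show ?thesis by auto
qed

lemma measurable_coordinatewise_affine:
  fixes x h :: "nat \<Rightarrow> real"
  shows "(\<lambda>y. \<lambda>i\<in>I. (x i - y i) / h i) \<in> measurable (PiM I (\<lambda>_. lborel)) (PiM I (\<lambda>_. lborel))"
proof (rule measurable_restrict)
  fix i assume "i \<in> I"
  then have [measurable]: "(\<lambda>y. y i) \<in> borel_measurable (PiM I (\<lambda>_. lborel :: real measure))"
    using measurable_component_singleton[of i I "\<lambda>_. lborel :: real measure"] by simp
  show "(\<lambda>y. (x i - y i) / h i) \<in> measurable (PiM I (\<lambda>_. lborel)) lborel"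
    unfolding measurable_lborel2 by measurable
qed

text \<open>
  Substitution in one coordinate at a time. The sign of the scaling disappears since Lebesgue measure
  is invariant under reflection.
\<close>

lemma nn_integral_PiM_affine:
  fixes x h :: "nat \<Rightarrow> real"
  assumes "finite I" "\<And>i. i \<in> I \<Longrightarrow> 0 < h i"
    and "F \<in> borel_measurable (PiM I (\<lambda>_. lborel))"
  shows "(\<integral>\<^sup>+y. F (\<lambda>i\<in>I. (x i - y i) / h i) \<partial>PiM I (\<lambda>_. lborel)) = ennreal (\<Prod>i\<in>I. h i) * (\<integral>\<^sup>+y. F y \<partial>PiM I (\<lambda>_. lborel))"
  using assms
proof (induction I arbitrary: F rule: finite_induct)
  case empty
  have "(\<integral>\<^sup>+y. F (\<lambda>i\<in>{}. (x i - y i) / h i) \<partial>PiM {} (\<lambda>_. lborel)) = (\<integral>\<^sup>+y. F y \<partial>PiM {} (\<lambda>_. lborel))"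
    by (intro nn_integral_cong arg_cong[of _ _ F]) (simp add: space_PiM restrict_def)
  then show ?case by (simp only: prod.empty ennreal_1 mult_1_left)
next
  case (insert j I)
  note F [measurable] = insert.prems(2)
  have hj: "0 < h j" and h: "\<And>i. i \<in> I \<Longrightarrow> 0 < h i" using insert.prems(1) by auto
  define G where "G z = (\<integral>\<^sup>+u. F (z(j := u)) \<partial>lborel)" for z
  have upd: "(\<lambda>(z, u). F (z(j := u))) \<in> borel_measurable (PiM I (\<lambda>_. lborel) \<Otimes>\<^sub>M lborel)"
    using measurable_compose[OF measurable_add_dim F] by (simp add: case_prod_unfold)
  have G: "G \<in> borel_measurable (PiM I (\<lambda>_. lborel))"
    unfolding G_def[abs_def] using upd by (rule lborel.borel_measurable_nn_integral)
  have aff: "(\<lambda>y. \<lambda>i\<in>insert j I. (x i - y i) / h i) \<in> measurable (PiM (insert j I) (\<lambda>_. lborel)) (PiM (insert j I) (\<lambda>_. lborel))"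
    by (rule measurable_coordinatewise_affine)
  have "(\<integral>\<^sup>+y. F (\<lambda>i\<in>insert j I. (x i - y i) / h i) \<partial>PiM (insert j I) (\<lambda>_. lborel))
      = (\<integral>\<^sup>+y. \<integral>\<^sup>+t. F (\<lambda>i\<in>insert j I. (x i - (y(j := t)) i) / h i) \<partial>lborel \<partial>PiM I (\<lambda>_. lborel))"
    using measurable_compose[OF aff F] insert.hyps by (intro lborel_product.product_nn_integral_insert) auto
  also have "\<dots> = (\<integral>\<^sup>+y. ennreal (h j) * G (\<lambda>i\<in>I. (x i - y i) / h i) \<partial>PiM I (\<lambda>_. lborel))"
  proof (intro nn_integral_cong)
    fix y :: "nat \<Rightarrow> real"
    let ?z = "\<lambda>i\<in>I. (x i - y i) / h i"
    have z: "?z \<in> space (PiM I (\<lambda>_. lborel))" by (auto simp: space_PiM)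
    have meas: "(\<lambda>u. F (?z(j := u))) \<in> borel_measurable borel"
      using measurable_compose[OF measurable_component_update[OF z insert.hyps(2)] F] by simp
    have eq: "(\<lambda>i\<in>insert j I. (x i - (y(j := t)) i) / h i) = ?z(j := (x j - t) / h j)" for t
      using insert.hyps by (auto simp: fun_eq_iff)
    have "(\<integral>\<^sup>+t. F (\<lambda>i\<in>insert j I. (x i - (y(j := t)) i) / h i) \<partial>lborel)
        = (\<integral>\<^sup>+t. F (?z(j := (x j - t) / h j)) \<partial>lborel)"
      unfolding eq ..
    also have "\<dots> = ennreal \<bar>- h j\<bar> * (\<integral>\<^sup>+u. F (?z(j := (x j - (x j + (- h j) * u)) / h j)) \<partial>lborel)"
      using hj by (intro nn_integral_real_affine measurable_compose[OF _ meas]) auto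
    also have "\<dots> = ennreal (h j) * G ?z"
      using hj by (simp add: G_def)
    finally show "(\<integral>\<^sup>+t. F (\<lambda>i\<in>insert j I. (x i - (y(j := t)) i) / h i) \<partial>lborel) = ennreal (h j) * G ?z" .
  qed
  also have "\<dots> = ennreal (h j) * (\<integral>\<^sup>+y. G (\<lambda>i\<in>I. (x i - y i) / h i) \<partial>PiM I (\<lambda>_. lborel))"
    by (intro nn_integral_cmult measurable_compose[OF measurable_coordinatewise_affine G])
  also have "\<dots> = ennreal (h j) * (ennreal (\<Prod>i\<in>I. h i) * (\<integral>\<^sup>+z. G z \<partial>PiM I (\<lambda>_. lborel)))"
    by (subst insert.IH[OF h G]) auto
  also have "(\<integral>\<^sup>+z. G z \<partial>PiM I (\<lambda>_. lborel)) = (\<integral>\<^sup>+y. F y \<partial>PiM (insert j I) (\<lambda>_. lborel))"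
    unfolding G_def using insert.hyps by (intro lborel_product.product_nn_integral_insert[symmetric] F)
  also have "ennreal (h j) * (ennreal (\<Prod>i\<in>I. h i) * (\<integral>\<^sup>+y. F y \<partial>PiM (insert j I) (\<lambda>_. lborel)))
      = ennreal (\<Prod>i\<in>insert j I. h i) * (\<integral>\<^sup>+y. F y \<partial>PiM (insert j I) (\<lambda>_. lborel))"
    using insert.hyps hj h by (simp add: ennreal_mult prod_nonneg less_imp_le mult.assoc)
  finally show ?case .
qed

context
  fixes d :: nat and k :: "(nat \<Rightarrow> real) \<Rightarrow> real" and h :: "nat \<Rightarrow> real"
  assumes k: "approx_kernel d k" and h: "\<And>i. i < d \<Longrightarrow> 0 < h i"
begin

abbreviation scaled_kernel :: "(nat \<Rightarrow> real) \<Rightarrow> (nat \<Rightarrow> real) \<Rightarrow> real" where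
  "scaled_kernel x y \<equiv> rescaled d k h (vec_minus d x y)"

lemma scaled_kernel_eq: "scaled_kernel x y = 1 / (\<Prod>i<d. h i) * k (\<lambda>i\<in>{..<d}. (x i - y i) / h i)"
proof -
  have "(\<lambda>i\<in>{..<d}. vec_minus d x y i / h i) = (\<lambda>i\<in>{..<d}. (x i - y i) / h i)"
    by (auto simp: vec_minus_def fun_eq_iff)
  then show ?thesis by (simp add: rescaled_def)
qed

lemma scaled_kernel_measurable:
  "case_prod scaled_kernel \<in> borel_measurable (lebesgue_n d \<Otimes>\<^sub>M lebesgue_n d)"
proof -
  have k_meas: "k \<in> borel_measurable (lebesgue_n d)" using k by (simp add: approx_kernel_def)
  have "(\<lambda>z. \<lambda>i\<in>{..<d}. (fst z i - snd z i) / h i) \<in> measurable (lebesgue_n d \<Otimes>\<^sub>M lebesgue_n d) (PiM {..<d} (\<lambda>_. lborel))"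
  proof (rule measurable_restrict)
    fix i assume "i \<in> {..<d}"
    then have [measurable]: "(\<lambda>z. fst z i) \<in> borel_measurable (lebesgue_n d \<Otimes>\<^sub>M lebesgue_n d)"
      "(\<lambda>z. snd z i) \<in> borel_measurable (lebesgue_n d \<Otimes>\<^sub>M lebesgue_n d)"
      by (auto intro: measurable_compose[OF measurable_fst measurable_lebesgue_coord]
          measurable_compose[OF measurable_snd measurable_lebesgue_coord])
    show "(\<lambda>z. (fst z i - snd z i) / h i) \<in> measurable (lebesgue_n d \<Otimes>\<^sub>M lebesgue_n d) lborel"
      unfolding measurable_lborel2 by measurable
  qed
  then have "(\<lambda>z. \<lambda>i\<in>{..<d}. (fst z i - snd z i) / h i) \<in> measurable (lebesgue_n d \<Otimes>\<^sub>M lebesgue_n d) (lebesgue_n d)"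
    by (simp only: lebesgue_n_def)
  from measurable_compose[OF this k_meas] show ?thesis
    unfolding case_prod_unfold scaled_kernel_eq by measurable
qed

lemma scaled_kernel_sym: "scaled_kernel x y = scaled_kernel y x"
proof -
  have "vec_neg d (\<lambda>i\<in>{..<d}. (x i - y i) / h i) = (\<lambda>i\<in>{..<d}. (y i - x i) / h i)"
    by (auto simp: vec_neg_def fun_eq_iff minus_divide_left)
  moreover have "(\<lambda>i\<in>{..<d}. (x i - y i) / h i) \<in> space (lebesgue_n d)"
    by (auto simp: space_lebesgue_n)
  ultimately show ?thesis
    using k unfolding scaled_kernel_eq approx_kernel_def by metis
qed

lemma scaled_kernel_norm:
  "(\<integral>\<^sup>+y. ennreal ((scaled_kernel x y)\<^sup>2) \<partial>lebesgue_n d) = ennreal ((l2_norm (lebesgue_n d) k)\<^sup>2 / (\<Prod>i<d. h i))"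
proof -
  let ?h = "\<Prod>i<d. h i"
  have hpos: "0 < ?h" using h by (intro prod_pos) auto
  have k_meas [measurable]: "k \<in> borel_measurable (lebesgue_n d)" and k_sq: "integrable (lebesgue_n d) (\<lambda>x. (k x)\<^sup>2)"
    using k by (auto simp: approx_kernel_def)
  let ?F = "\<lambda>z. ennreal ((k z)\<^sup>2)"
  have F: "?F \<in> borel_measurable (lebesgue_n d)" by measurable
  have aff: "(\<lambda>y. \<lambda>i\<in>{..<d}. (x i - y i) / h i) \<in> measurable (lebesgue_n d) (lebesgue_n d)"
    unfolding lebesgue_n_def by (rule measurable_coordinatewise_affine)
  have "(\<integral>\<^sup>+y. ennreal ((scaled_kernel x y)\<^sup>2) \<partial>lebesgue_n d)
      = (\<integral>\<^sup>+y. ennreal (1 / ?h\<^sup>2) * ?F (\<lambda>i\<in>{..<d}. (x i - y i) / h i) \<partial>lebesgue_n d)"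
    using hpos by (intro nn_integral_cong) (simp add: scaled_kernel_eq power_mult_distrib power_divide flip: ennreal_mult)
  also have "\<dots> = ennreal (1 / ?h\<^sup>2) * (\<integral>\<^sup>+y. ?F (\<lambda>i\<in>{..<d}. (x i - y i) / h i) \<partial>lebesgue_n d)"
    by (intro nn_integral_cmult measurable_compose[OF aff F])
  also have "(\<integral>\<^sup>+y. ?F (\<lambda>i\<in>{..<d}. (x i - y i) / h i) \<partial>lebesgue_n d) = ennreal ?h * (\<integral>\<^sup>+y. ?F y \<partial>lebesgue_n d)"
    using F h unfolding lebesgue_n_def by (intro nn_integral_PiM_affine) auto
  also have "(\<integral>\<^sup>+y. ?F y \<partial>lebesgue_n d) = ennreal ((l2_norm (lebesgue_n d) k)\<^sup>2)"
    using k_sq by (simp add: nn_integral_eq_integral l2_norm_def)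
  finally show ?thesis
    using hpos by (simp add: ennreal_mult[symmetric] power2_eq_square)
qed

end

section \<open>Level of the aggregated test\<close>

lemma nn_integral_rademacher_prod:
  "(\<integral>\<^sup>+\<epsilon>. (\<Prod>i\<in>{1..k}. \<phi> (\<epsilon> i)) \<partial>rademacher_seq) = ((\<phi> 1 + \<phi> (-1)) / 2) ^ k" for \<phi> :: "real \<Rightarrow> ennreal"
proof -
  let ?p = "\<lambda>_::nat. measure_pmf (pmf_of_set {-1, 1 :: real})"
  have restr: "(\<lambda>\<epsilon>. restrict \<epsilon> {1..k}) \<in> measurable rademacher_seq (PiM {1..k} ?p)"
    unfolding rademacher_seq_def by (rule measurable_restrict_subset) simp
  have F: "(\<lambda>\<epsilon>. \<Prod>i\<in>{1..k}. \<phi> (\<epsilon> i)) \<in> borel_measurable (PiM {1..k} ?p)"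
  proof (rule borel_measurable_prod_ennreal)
    fix i assume "i \<in> {1..k}"
    then have "(\<lambda>\<epsilon>. \<epsilon> i) \<in> measurable (PiM {1..k} ?p) (measure_pmf (pmf_of_set {-1, 1 :: real}))"
      by (rule measurable_component_singleton)
    then show "(\<lambda>\<epsilon>. \<phi> (\<epsilon> i)) \<in> borel_measurable (PiM {1..k} ?p)"
      by (rule measurable_compose) simp
  qed
  have "(\<integral>\<^sup>+\<epsilon>. (\<Prod>i\<in>{1..k}. \<phi> (\<epsilon> i)) \<partial>rademacher_seq)
      = (\<integral>\<^sup>+\<epsilon>. (\<Prod>i\<in>{1..k}. \<phi> (restrict \<epsilon> {1..k} i)) \<partial>rademacher_seq)"
    by (intro nn_integral_cong prod.cong) auto
  also have "\<dots> = (\<integral>\<^sup>+\<epsilon>. (\<Prod>i\<in>{1..k}. \<phi> (\<epsilon> i)) \<partial>distr rademacher_seq (PiM {1..k} ?p) (\<lambda>\<epsilon>. restrict \<epsilon> {1..k}))"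
    by (rule nn_integral_distr[OF restr, symmetric]) (use F in simp)
  also have "distr rademacher_seq (PiM {1..k} ?p) (\<lambda>\<epsilon>. restrict \<epsilon> {1..k}) = PiM {1..k} ?p"
    unfolding rademacher_seq_def by (rule rademacher.distr_PiM_restrict_finite) auto
  also have "(\<integral>\<^sup>+\<epsilon>. (\<Prod>i\<in>{1..k}. \<phi> (\<epsilon> i)) \<partial>PiM {1..k} ?p) = (\<Prod>i\<in>{1..k}. \<integral>\<^sup>+x. \<phi> x \<partial>measure_pmf (pmf_of_set {-1, 1 :: real}))"
    by (rule rademacher.product_nn_integral_prod) auto
  also have "\<dots> = ((\<phi> 1 + \<phi> (-1)) / 2) ^ k"
    by (simp add: nn_integral_pmf_of_set add.commute)
  finally show ?thesis .
qed

lemma AE_pair_snd: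
  assumes "sigma_finite_measure M2" "AE \<omega> in M2. Q \<omega>"
  shows "AE z in M1 \<Otimes>\<^sub>M M2. Q (snd z)"
proof -
  interpret M2: sigma_finite_measure M2 by fact
  obtain Z where Z: "{\<omega> \<in> space M2. \<not> Q \<omega>} \<subseteq> Z" "emeasure M2 Z = 0" "Z \<in> sets M2"
    using assms(2) by (rule AE_E)
  then have "space M1 \<times> Z \<in> null_sets (M1 \<Otimes>\<^sub>M M2)"
    by (auto simp: null_sets_def M2.emeasure_pair_measure_Times)
  moreover have "{z \<in> space (M1 \<Otimes>\<^sub>M M2). \<not> Q (snd z)} \<subseteq> space M1 \<times> Z"
    using Z(1) by (auto simp: space_pair_measure)
  ultimately show ?thesis by (rule AE_I')
qed

lemma diagonal_lebesgue_n:
  assumes [measurable]: "u \<in> measurable M (lebesgue_n d)" "v \<in> measurable M (lebesgue_n d)"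
  shows "{z \<in> space M. u z = v z} \<in> sets M"
proof -
  have "{z \<in> space M. u z = v z} = {z \<in> space M. \<forall>i\<in>{..<d}. u z i = v z i}"
  proof (rule Collect_cong, rule conj_cong[OF refl])
    fix z assume z: "z \<in> space M"
    have "u z \<in> {..<d} \<rightarrow>\<^sub>E UNIV" "v z \<in> {..<d} \<rightarrow>\<^sub>E UNIV"
      using measurable_space[OF assms(1) z] measurable_space[OF assms(2) z] unfolding space_lebesgue_n by auto
    then show "u z = v z \<longleftrightarrow> (\<forall>i\<in>{..<d}. u z i = v z i)"
      using PiE_ext[of "u z" "{..<d}" "\<lambda>_. UNIV" "v z"] by metis
  qed
  also have "\<dots> \<in> sets M"
  proof (intro sets.sets_Collect_finite_All)
    fix i assume "i \<in> {..<d}"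
    then have [measurable]: "(\<lambda>z. u z i) \<in> borel_measurable M" "(\<lambda>z. v z i) \<in> borel_measurable M"
      using measurable_compose[OF assms(1) measurable_lebesgue_coord] measurable_compose[OF assms(2) measurable_lebesgue_coord] by auto
    show "{z \<in> space M. u z i = v z i} \<in> sets M" by measurable
  qed simp
  finally show ?thesis .
qed

text \<open>
  For \<open>f = g\<close> the two samples arise from \<open>2 n \<integral> f\<close> points on average, independently labelled by fair
  signs. Conditionally on the points the test rejects with probability at most \<open>\<alpha>\<close>, and Fubini's
  theorem removes the conditioning. A rejection event that is not measurable has measure \<open>0\<close> by
  convention.
\<close>

lemma aggregated_test_level:
  fixes d :: nat and K :: "'m \<Rightarrow> (nat \<Rightarrow> real) \<Rightarrow> (nat \<Rightarrow> real) \<Rightarrow> real"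
  assumes d: "1 \<le> d" and n: "0 < n" and f: "intensity (lebesgue_n d) f" and g: "intensity (lebesgue_n d) g"
    and P: "joint_law (lebesgue_n d) n f g P" and fg: "\<And>x. x \<in> space (lebesgue_n d) \<Longrightarrow> f x = g x"
    and \<alpha>: "0 < \<alpha>" "\<alpha> < 1" and fin: "finite \<M>" and ne: "\<M> \<noteq> {}"
    and sum_w: "(\<Sum>m\<in>\<M>. exp (- w m)) \<le> 1"
  shows "measure P {N \<in> space P. agg_test \<alpha> \<M> K w N = 1} \<le> \<alpha>"
proof -
  let ?\<nu> = "lebesgue_n d"
  interpret \<nu>: sigma_finite_measure ?\<nu> by (rule sigma_finite_lebesgue_n)
  have f_meas [measurable]: "f \<in> borel_measurable ?\<nu>" and f_int: "integrable ?\<nu> f"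
    and f_nonneg: "\<And>x. x \<in> space ?\<nu> \<Longrightarrow> 0 \<le> f x"
    using f by (auto simp: intensity_def)
  define m where "m = (\<integral>x. f x \<partial>?\<nu>)"
  have m: "0 \<le> m" unfolding m_def using f_nonneg by (intro Bochner_Integration.integral_nonneg_AE AE_I2)
  \<comment> \<open>If the total mass is \<open>0\<close> there are no points, and any law of the points serves.\<close>
  define \<rho> where "\<rho> = (if m = 0 then return ?\<nu> (\<lambda>i\<in>{..<d}. 0) else density ?\<nu> (\<lambda>x. ennreal (f x / m)))"
  have sets_\<rho> [measurable_cong, simp]: "sets \<rho> = sets ?\<nu>" unfolding \<rho>_def by simp
  have space_\<rho> [simp]: "space \<rho> = space ?\<nu>" by (rule sets_eq_imp_space_eq) simp
  have \<rho>_pos: "emeasure \<rho> B = ennreal ((\<integral>x. f x * indicator B x \<partial>?\<nu>) / m)" if "m \<noteq> 0" "B \<in> sets ?\<nu>" for B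
  proof -
    have "emeasure \<rho> B = (\<integral>\<^sup>+x. ennreal (f x / m) * indicator B x \<partial>?\<nu>)"
      unfolding \<rho>_def using that by (simp add: emeasure_density)
    also have "\<dots> = (\<integral>\<^sup>+x. ennreal (f x * indicator B x / m) \<partial>?\<nu>)"
      by (intro nn_integral_cong) (auto simp: indicator_def)
    also have "\<dots> = ennreal (\<integral>x. f x * indicator B x / m \<partial>?\<nu>)"
      using that m f_nonneg by (intro nn_integral_eq_integral AE_I2 integrable_divide integrable_real_mult_indicator f_int) auto
    finally show ?thesis by simp
  qed
  have prob_\<rho>: "prob_space \<rho>"
  proof (cases "m = 0")
    case True
    then show ?thesis unfolding \<rho>_def by (auto intro!: prob_space_return simp: space_lebesgue_n)
  next
    case False
    have "(\<integral>x. f x * indicator (space ?\<nu>) x \<partial>?\<nu>) = m"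
      unfolding m_def by (intro Bochner_Integration.integral_cong) auto
    then show ?thesis using \<rho>_pos[OF False, of "space ?\<nu>"] False by (intro prob_spaceI) simp
  qed
  interpret iid_sequence \<rho> by (rule iid_sequence.intro) (rule prob_\<rho>)
  have \<rho>_measure: "m * prob B = (\<integral>x. f x * indicator B x \<partial>?\<nu>)" if B: "B \<in> sets ?\<nu>" for B
  proof (cases "m = 0")
    case True
    have "(\<integral>x. f x * indicator B x \<partial>?\<nu>) \<le> m"
      unfolding m_def using B f_nonneg by (intro integral_mono integrable_real_mult_indicator f_int) (auto simp: indicator_def)
    moreover have "0 \<le> (\<integral>x. f x * indicator B x \<partial>?\<nu>)"
      using f_nonneg by (intro Bochner_Integration.integral_nonneg_AE AE_I2) auto
    ultimately show ?thesis using True by simp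
  next
    case False
    have "0 \<le> (\<integral>x. f x * indicator B x \<partial>?\<nu>) / m"
      using f_nonneg m by (intro divide_nonneg_nonneg Bochner_Integration.integral_nonneg_AE AE_I2) auto
    then show ?thesis using \<rho>_pos[OF False B] False by (simp add: measure_def)
  qed
  interpret pair_space: pair_prob_space seq rademacher_seq ..
  interpret pts: marked_points "seq \<Otimes>\<^sub>M rademacher_seq" d "\<lambda>i \<omega>. fst \<omega> i" "\<lambda>i \<omega>. snd \<omega> i"
  proof (intro marked_points.intro marked_points_axioms.intro)
    show "prob_space (seq \<Otimes>\<^sub>M rademacher_seq)" by (rule pair_space.prob_space_axioms)
    fix i :: nat
    have "(\<lambda>\<omega>. fst \<omega> i) \<in> measurable (seq \<Otimes>\<^sub>M rademacher_seq) \<rho>" by measurable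
    then show "(\<lambda>\<omega>. fst \<omega> i) \<in> measurable (seq \<Otimes>\<^sub>M rademacher_seq) ?\<nu>"
      by (simp add: measurable_cong_sets[OF refl sets_\<rho>])
    show "(\<lambda>\<omega>. snd \<omega> i) \<in> borel_measurable (seq \<Otimes>\<^sub>M rademacher_seq)" by measurable
  qed
  let ?l = "2 * n * m"
  let ?M = "measure_pmf (pois ?l) \<Otimes>\<^sub>M (seq \<Otimes>\<^sub>M rademacher_seq)"
  let ?\<Sigma> = "configs ?\<nu> \<Otimes>\<^sub>M configs ?\<nu>"
  have law: "P = distr ?M ?\<Sigma> pts.configuration"
  proof (rule pts.joint_law_eq_marked[OF P f g n])
    show "0 \<le> ?l" using n m by simp
    fix B C assume B: "B \<in> sets ?\<nu>" and C: "C \<in> sets ?\<nu>"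
    let ?D = "\<lambda>e::real. if e = 1 then space ?\<nu> - B else space ?\<nu> - C"
    let ?v = "(prob (space ?\<nu> - B) + prob (space ?\<nu> - C)) / 2"
    have compl: "prob (space ?\<nu> - B) = 1 - prob B" "prob (space ?\<nu> - C) = 1 - prob C"
      using prob_compl[of B] prob_compl[of C] B C by auto
    have "(\<integral>x. g x * indicator C x \<partial>?\<nu>) = (\<integral>x. f x * indicator C x \<partial>?\<nu>)"
      using fg by (intro Bochner_Integration.integral_cong) auto
    moreover have "1 - ?v = (prob B + prob C) / 2" unfolding compl by (simp add: field_simps)
    then have "?l * (1 - ?v) = ?l * ((prob B + prob C) / 2)" by (rule arg_cong)
    then have "?l * (1 - ?v) = n * (m * prob B) + n * (m * prob C)"
      by (rule trans) (simp add: distrib_left mult.assoc)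
    ultimately have 1: "?l * (1 - ?v) = n * (\<integral>x. f x * indicator B x \<partial>?\<nu>) + n * (\<integral>x. g x * indicator C x \<partial>?\<nu>)"
      by (simp only: \<rho>_measure[OF B] \<rho>_measure[OF C])
    have 2: "emeasure (seq \<Otimes>\<^sub>M rademacher_seq) {\<omega> \<in> space (seq \<Otimes>\<^sub>M rademacher_seq).
        \<forall>i\<in>{1..k}. (snd \<omega> i = 1 \<longrightarrow> fst \<omega> i \<notin> B) \<and> (snd \<omega> i \<noteq> 1 \<longrightarrow> fst \<omega> i \<notin> C)} = ennreal (?v ^ k)"
      (is "emeasure _ ?E = _") for k
    proof -
      have "emeasure (seq \<Otimes>\<^sub>M rademacher_seq) ?E = (\<integral>\<^sup>+\<epsilon>. emeasure seq ((\<lambda>X. (X, \<epsilon>)) -` ?E) \<partial>rademacher_seq)"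
        by (intro pair_space.emeasure_pair_measure_alt2 pts.avoids_sets B C)
      also have "\<dots> = (\<integral>\<^sup>+\<epsilon>. (\<Prod>i\<in>{1..k}. emeasure \<rho> (?D (\<epsilon> i))) \<partial>rademacher_seq)"
      proof (intro nn_integral_cong)
        fix \<epsilon> :: "nat \<Rightarrow> real"
        have "(\<lambda>X. (X, \<epsilon>)) -` ?E = {X \<in> space seq. \<forall>i\<in>{1..k}. X i \<in> ?D (\<epsilon> i)}"
          by (auto simp: space_pair_measure space_PiM PiE_iff)
        also have "emeasure seq \<dots> = (\<Prod>i\<in>{1..k}. emeasure \<rho> (?D (\<epsilon> i)))"
          using B C by (intro product.emeasure_PiM_Collect) auto
        finally show "emeasure seq ((\<lambda>X. (X, \<epsilon>)) -` ?E) = (\<Prod>i\<in>{1..k}. emeasure \<rho> (?D (\<epsilon> i)))" .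
      qed
      also have "\<dots> = ((emeasure \<rho> (?D 1) + emeasure \<rho> (?D (-1))) / 2) ^ k"
        by (rule nn_integral_rademacher_prod)
      also have "\<dots> = ennreal (?v ^ k)"
        by (simp add: emeasure_eq_measure ennreal_power[symmetric] divide_ennreal flip: ennreal_plus ennreal_numeral)
      finally show ?thesis .
    qed
    show "\<exists>v\<ge>0. ?l * (1 - v) = n * (\<integral>x. f x * indicator B x \<partial>?\<nu>) + n * (\<integral>x. g x * indicator C x \<partial>?\<nu>) \<and>
       (\<forall>k. emeasure (seq \<Otimes>\<^sub>M rademacher_seq) {\<omega> \<in> space (seq \<Otimes>\<^sub>M rademacher_seq).
          \<forall>i\<in>{1..k}. (snd \<omega> i = 1 \<longrightarrow> fst \<omega> i \<notin> B) \<and> (snd \<omega> i \<noteq> 1 \<longrightarrow> fst \<omega> i \<notin> C)} = ennreal (v ^ k))"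
      using 1 2 by (intro exI[of _ ?v]) auto
  qed
  have distinct: "AE X in seq. inj_on X {1..k}" if k: "k \<in> set_pmf (pois ?l)" for k
  proof (cases "m = 0")
    case True
    then have "k = 0" using k by (simp add: pois_def)
    then show ?thesis by simp
  next
    case False
    have "AE X in seq. inj (\<lambda>i. X i)"
    proof (rule AE_distinct)
      show "{z \<in> space (\<rho> \<Otimes>\<^sub>M \<rho>). fst z = snd z} \<in> sets (\<rho> \<Otimes>\<^sub>M \<rho>)"
        by (rule diagonal_lebesgue_n[where d = d]) (auto simp: measurable_cong_sets[OF refl sets_\<rho>[symmetric]])
      fix y assume y: "y \<in> space \<rho>"
      have "{x \<in> space \<rho>. x = y} = {y}" using y by auto
      moreover have null: "{y} \<in> null_sets ?\<nu>" using y by (intro emeasure_lebesgue_n_point d) simp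
      then have "AE x in ?\<nu>. x \<notin> {y}" by (rule AE_not_in)
      then have "(\<integral>x. f x * indicator {y} x \<partial>?\<nu>) = 0"
        by (intro integral_eq_zero_AE) (auto elim!: eventually_mono)
      ultimately show "emeasure \<rho> {x \<in> space \<rho>. x = y} = 0"
        using \<rho>_pos[OF False, of "{y}"] null by (auto simp: null_sets_def)
    qed
    then show ?thesis by eventually_elim (auto simp: inj_on_def inj_def)
  qed
  let ?E = "{N \<in> space P. agg_test \<alpha> \<M> K w N = 1}"
  show ?thesis
  proof (cases "?E \<in> sets P")
    case False
    then show ?thesis using \<alpha> by (simp add: measure_notin_sets)
  next
    case True
    moreover have "sets P = sets ?\<Sigma>" using arg_cong[OF law, of sets] by simp
    ultimately have E: "?E \<in> sets ?\<Sigma>" by simp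
    have pre: "pts.configuration -` ?E \<inter> space ?M \<in> sets ?M"
      by (rule measurable_sets[OF pts.measurable_configuration E])
    have slice: "emeasure (seq \<Otimes>\<^sub>M rademacher_seq) (Pair k -` (pts.configuration -` ?E \<inter> space ?M)) \<le> ennreal \<alpha>"
      (is "emeasure _ ?A \<le> _") if k: "k \<in> set_pmf (pois ?l)" for k
    proof -
      have A: "?A \<in> sets (seq \<Otimes>\<^sub>M rademacher_seq)" by (rule sets_Pair1[OF pre])
      have "emeasure (seq \<Otimes>\<^sub>M rademacher_seq) ?A = (\<integral>\<^sup>+X. emeasure rademacher_seq (Pair X -` ?A) \<partial>seq)"
        by (rule rademacher_seq.emeasure_pair_measure_alt[OF A])
      also have "\<dots> \<le> (\<integral>\<^sup>+X. ennreal \<alpha> \<partial>seq)"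
      proof (rule nn_integral_mono_AE)
        show "AE X in seq. emeasure rademacher_seq (Pair X -` ?A) \<le> ennreal \<alpha>"
          using distinct[OF k]
        proof eventually_elim
        case (elim X)
        from conditional_level[OF \<alpha> fin ne sum_w elim, of K]
        obtain A' where A': "A' \<in> sets rademacher_seq" "measure rademacher_seq A' \<le> \<alpha>"
          "AE \<epsilon> in rademacher_seq. agg_test \<alpha> \<M> K w (sign_split k X \<epsilon>) = 1 \<longrightarrow> \<epsilon> \<in> A'"
          by blast
        have "emeasure rademacher_seq (Pair X -` ?A) \<le> emeasure rademacher_seq A'"
        proof (rule emeasure_mono_AE[OF _ A'(1)])
          show "AE \<epsilon> in rademacher_seq. \<epsilon> \<in> Pair X -` ?A \<longrightarrow> \<epsilon> \<in> A'"
            using A'(3) by eventually_elim (auto simp: pts.configuration_def)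
        qed
        also have "\<dots> \<le> ennreal \<alpha>" using A'(2) by (simp add: rademacher_seq.emeasure_eq_measure ennreal_leI)
        finally show "emeasure rademacher_seq (Pair X -` ?A) \<le> ennreal \<alpha>" .
        qed
      qed
      also have "\<dots> = ennreal \<alpha>" by (simp add: seq.emeasure_space_1)
      finally show ?thesis .
    qed
    have "emeasure P ?E = emeasure ?M (pts.configuration -` ?E \<inter> space ?M)"
      by (subst (1) law, rule emeasure_distr[OF pts.measurable_configuration E])
    also have "\<dots> = (\<integral>\<^sup>+k. emeasure (seq \<Otimes>\<^sub>M rademacher_seq) (Pair k -` (pts.configuration -` ?E \<inter> space ?M)) \<partial>measure_pmf (pois ?l))"
      by (rule pair_space.emeasure_pair_measure_alt[OF pre])
    also have "\<dots> \<le> (\<integral>\<^sup>+k. ennreal \<alpha> \<partial>measure_pmf (pois ?l))"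
      by (intro nn_integral_mono_AE AE_pmfI slice)
    also have "\<dots> = ennreal \<alpha>" by (simp add: measure_pmf.emeasure_space_1)
    finally show ?thesis using \<alpha> by (simp add: measure_def enn2real_leI)
  qed
qed

section \<open>Power of the aggregated test\<close>

text \<open>
  The joint law is realised by the labelled sample, on which the statistic and the energy are those of
  the moment calculus as soon as the points are distinct. Not rejecting puts the statistic below its
  critical value, and \<open>power_bound\<close> applies.
\<close>

lemma aggregated_test_power:
  fixes d :: nat and K :: "'m \<Rightarrow> (nat \<Rightarrow> real) \<Rightarrow> (nat \<Rightarrow> real) \<Rightarrow> real" and \<alpha> \<beta> :: real
  defines "\<nu> \<equiv> lebesgue_n d"
  assumes d: "1 \<le> d" and two_sample: "two_sample \<nu> n f g (K m) c S" and P: "joint_law \<nu> n f g P"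
    and \<alpha>: "0 < \<alpha>" "\<alpha> < 1" and \<beta>: "0 < \<beta>" and S: "0 < S"
    and fin: "finite \<M>" and m: "m \<in> \<M>" and w: "0 < w m" and sum_w: "(\<Sum>m\<in>\<M>. exp (- w m)) \<le> 1"
    and separated: "(\<integral>x. (f x - g x)\<^sup>2 \<partial>\<nu>) \<ge> (\<integral>x. ((f x - g x) - (\<integral>y. K m x y * (f y - g y) \<partial>\<nu>))\<^sup>2 \<partial>\<nu>)
       + (4 + 2 * sqrt 2 * (20 * (ln (2 / \<alpha>) + w m))) / (n * sqrt \<beta>) * sqrt (S * (\<integral>x. f x + g x \<partial>\<nu>) * c) + 8 * S / (\<beta> * n)"
  shows "measure P {N \<in> space P. agg_test \<alpha> \<M> K w N = 0} \<le> \<beta>"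
proof -
  interpret two_sample \<nu> n f g "K m" c S by (rule two_sample)
  let ?X = "\<lambda>i \<omega>. fst (\<omega> i :: (nat \<Rightarrow> real) \<times> bool)" and ?s = "\<lambda>i \<omega>. label (snd (\<omega> i :: (nat \<Rightarrow> real) \<times> bool))"
  have fst_meas: "(\<lambda>\<omega>. fst (\<omega> i)) \<in> measurable stat.seq \<nu>" for i by measurable
  interpret pts: marked_points stat.seq d ?X ?s
  proof (intro marked_points.intro marked_points_axioms.intro stat.seq.prob_space_axioms)
    fix i :: nat
    show "(\<lambda>\<omega>. fst (\<omega> i)) \<in> measurable stat.seq (lebesgue_n d)" using fst_meas unfolding \<nu>_def .
    show "(\<lambda>\<omega>. label (snd (\<omega> i))) \<in> borel_measurable stat.seq" by measurable
  qed
  let ?\<Sigma> = "configs \<nu> \<Otimes>\<^sub>M configs \<nu>"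
  have law: "P = distr sample ?\<Sigma> pts.configuration"
    unfolding sample_def
  proof (rule pts.joint_law_eq_marked[folded \<nu>_def, OF P f_intensity g_intensity n_pos])
    show "0 \<le> n * mass" using n_pos mass by simp
    fix B C assume BC [measurable]: "B \<in> sets \<nu>" "C \<in> sets \<nu>"
    define Z where "Z = {z \<in> space \<rho>. (snd z \<and> fst z \<in> B) \<or> (\<not> snd z \<and> fst z \<in> C)}"
    have Z [measurable]: "Z \<in> sets \<rho>" unfolding Z_def by measurable
    let ?IB = "\<integral>x. f x * indicator B x \<partial>\<nu>" and ?IC = "\<integral>x. g x * indicator C x \<partial>\<nu>"
    have int: "integrable \<nu> (\<lambda>x. f x * indicator B x)" "integrable \<nu> (\<lambda>x. g x * indicator C x)"
      by (intro integrable_real_mult_indicator f_int g_int BC)+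
    have nonneg: "0 \<le> ?IB" "0 \<le> ?IC"
      using f_nonneg g_nonneg by (auto intro!: Bochner_Integration.integral_nonneg_AE AE_I2)
    have "emeasure \<rho> Z = (\<integral>\<^sup>+z. indicator Z z \<partial>\<rho>)" by (rule nn_integral_indicator[OF Z, symmetric])
    also have "\<dots> = (\<integral>\<^sup>+x. ennreal (f x / mass) * indicator Z (x, True) + ennreal (g x / mass) * indicator Z (x, False) \<partial>\<nu>)"
      by (rule nn_integral_\<rho>, rule borel_measurable_indicator) (use Z in simp)
    also have "\<dots> = (\<integral>\<^sup>+x. ennreal ((f x * indicator B x + g x * indicator C x) / mass) \<partial>\<nu>)"
      using mass f_nonneg g_nonneg
      by (intro nn_integral_cong) (auto simp: Z_def indicator_def add_divide_distrib)
    also have "\<dots> = ennreal (\<integral>x. (f x * indicator B x + g x * indicator C x) / mass \<partial>\<nu>)"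
      using mass f_nonneg g_nonneg int by (intro nn_integral_eq_integral) auto
    also have "(\<integral>x. (f x * indicator B x + g x * indicator C x) / mass \<partial>\<nu>) = (?IB + ?IC) / mass"
      using int by simp
    finally have Z_prob: "stat.prob Z = (?IB + ?IC) / mass" using nonneg mass by (simp add: measure_def)
    let ?v = "stat.prob (space \<rho> - Z)"
    have "1 - ?v = (?IB + ?IC) / mass" using stat.prob_compl[OF Z] Z_prob by simp
    then have "n * mass * (1 - ?v) = n * mass * ((?IB + ?IC) / mass)" by (rule arg_cong)
    also have "\<dots> = n * ?IB + n * ?IC" using mass by (simp add: field_simps)
    finally have 1: "n * mass * (1 - ?v) = n * ?IB + n * ?IC" .
    have 2: "emeasure stat.seq {\<omega> \<in> space stat.seq. \<forall>i\<in>{1..k}. (?s i \<omega> = 1 \<longrightarrow> ?X i \<omega> \<notin> B) \<and> (?s i \<omega> \<noteq> 1 \<longrightarrow> ?X i \<omega> \<notin> C)} = ennreal (?v ^ k)" for k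
    proof -
      have "{\<omega> \<in> space stat.seq. \<forall>i\<in>{1..k}. (?s i \<omega> = 1 \<longrightarrow> ?X i \<omega> \<notin> B) \<and> (?s i \<omega> \<noteq> 1 \<longrightarrow> ?X i \<omega> \<notin> C)}
         = {\<omega> \<in> space stat.seq. \<forall>i\<in>{1..k}. \<omega> i \<in> space \<rho> - Z}"
        (is "?L = ?R")
      proof (rule Collect_cong, rule conj_cong[OF refl], rule ball_cong[OF refl])
        fix \<omega> :: "nat \<Rightarrow> (nat \<Rightarrow> real) \<times> bool" and i :: nat assume "\<omega> \<in> space stat.seq"
        then have "\<omega> i \<in> space \<rho>" by (auto simp: space_PiM)
        then show "(?s i \<omega> = 1 \<longrightarrow> ?X i \<omega> \<notin> B) \<and> (?s i \<omega> \<noteq> 1 \<longrightarrow> ?X i \<omega> \<notin> C) \<longleftrightarrow> \<omega> i \<in> space \<rho> - Z"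
          by (auto simp: Z_def split: if_splits)
      qed
      also have "emeasure stat.seq ?R = (\<Prod>i\<in>{1..k}. emeasure \<rho> (space \<rho> - Z))"
        by (rule stat.product.emeasure_PiM_Collect) (use Z in auto)
      also have "\<dots> = ennreal (?v ^ k)" by (simp add: stat.emeasure_eq_measure ennreal_power)
      finally show ?thesis .
    qed
    show "\<exists>v\<ge>0. n * mass * (1 - v) = n * ?IB + n * ?IC \<and>
       (\<forall>k. emeasure stat.seq {\<omega> \<in> space stat.seq. \<forall>i\<in>{1..k}. (?s i \<omega> = 1 \<longrightarrow> ?X i \<omega> \<notin> B) \<and> (?s i \<omega> \<noteq> 1 \<longrightarrow> ?X i \<omega> \<notin> C)} = ennreal (v ^ k))"
      using 1 2 by (intro exI[of _ ?v]) auto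
  qed
  have "AE \<omega> in stat.seq. inj (\<lambda>i. fst (\<omega> i))"
  proof (rule stat.AE_distinct)
    show "{z \<in> space (\<rho> \<Otimes>\<^sub>M \<rho>). fst (fst z) = fst (snd z)} \<in> sets (\<rho> \<Otimes>\<^sub>M \<rho>)"
      by (rule diagonal_lebesgue_n[where d = d], fold \<nu>_def) measurable
    fix y assume y: "y \<in> space \<rho>"
    have null: "{fst y} \<in> null_sets \<nu>"
      using y by (intro emeasure_lebesgue_n_point[OF d, folded \<nu>_def]) auto
    let ?Z = "{x \<in> space \<rho>. fst x = fst y}"
    have Z_eq: "?Z = {fst y} \<times> UNIV" using y by auto
    have "?Z \<in> sets (\<nu> \<Otimes>\<^sub>M count_space UNIV)" unfolding Z_eq using null by auto
    then have "(\<lambda>z. indicator ?Z z :: ennreal) \<in> borel_measurable (\<nu> \<Otimes>\<^sub>M count_space UNIV)" and Z: "?Z \<in> sets \<rho>" by auto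
    then have "emeasure \<rho> ?Z = (\<integral>\<^sup>+x. ennreal (f x / mass) * indicator ?Z (x, True) + ennreal (g x / mass) * indicator ?Z (x, False) \<partial>\<nu>)"
      by (subst nn_integral_\<rho>[symmetric]) (auto simp: nn_integral_indicator[OF Z])
    also have "\<dots> = (\<integral>\<^sup>+x. 0 \<partial>\<nu>)"
      using AE_not_in[OF null] by (intro nn_integral_cong_AE) (auto elim!: eventually_mono)
    finally show "emeasure \<rho> ?Z = 0" by simp
  qed
  then have distinct: "AE z in sample. inj (\<lambda>i. fst (snd z i))"
    unfolding sample_def by (rule AE_pair_snd[OF stat.seq.sigma_finite_measure_axioms])
  interpret sample: prob_space sample by (rule prob_space_sample)
  let ?L = "20 * (ln (2 / \<alpha>) + w m)"
  let ?E = "{N \<in> space P. agg_test \<alpha> \<M> K w N = 0}"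
  have L: "0 \<le> ?L" using \<alpha> w by simp
  have bound: "measure sample {z \<in> space sample. case_prod stat.pair_sum z \<le> ?L * sqrt (case_prod energy z)} \<le> \<beta>"
    using separated by (intro power_bound[OF \<beta> S L]) (simp add: \<Delta>_def K\<Delta>_def mass_def)
  show ?thesis
  proof (cases "?E \<in> sets P")
    case False
    then show ?thesis using \<beta> by (simp add: measure_notin_sets)
  next
    case True
    moreover have "sets P = sets ?\<Sigma>" using arg_cong[OF law, of sets] by simp
    ultimately have E: "?E \<in> sets ?\<Sigma>" by simp
    have conf: "pts.configuration \<in> measurable sample ?\<Sigma>"
      unfolding sample_def by (rule pts.measurable_configuration[folded \<nu>_def])
    have "measure P ?E = measure sample (pts.configuration -` ?E \<inter> space sample)"
      by (subst (1) law, rule measure_distr[OF conf E])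
    also have "\<dots> \<le> measure sample {z \<in> space sample. case_prod stat.pair_sum z \<le> ?L * sqrt (case_prod energy z)}"
    proof (rule sample.finite_measure_mono_AE)
      show "AE z in sample. z \<in> pts.configuration -` ?E \<inter> space sample \<longrightarrow>
         z \<in> {z \<in> space sample. case_prod stat.pair_sum z \<le> ?L * sqrt (case_prod energy z)}"
        using distinct
      proof eventually_elim
        case (elim z)
        obtain k \<omega> where z: "z = (k, \<omega>)" by (cases z)
        let ?x = "\<lambda>i. fst (\<omega> i)" and ?e = "\<lambda>i. label (snd (\<omega> i))"
        let ?N = "sign_split k ?x ?e"
        have inj: "inj_on ?x {1..k}" using elim z by (auto intro: inj_on_subset)
        have T: "T_stat (K m) ?N = stat.pair_sum k \<omega>"
          unfolding stat.pair_sum_def H_def by (rule T_stat_sign_split[OF inj]) auto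
        have pe: "pair_energy (K m) (pooled ?N) = energy k \<omega>"
          unfolding pair_energy_def pooled_sign_split energy_def
          by (rule pair_sum_points) (rule inj_on_imp_bij_betw[OF inj])
        show ?case
        proof
          assume zE: "z \<in> pts.configuration -` ?E \<inter> space sample"
          then have "agg_test \<alpha> \<M> K w ?N = 0" by (simp add: z pts.configuration_def)
          then have "\<not> rejects (u_agg \<alpha> \<M> K w (pooled ?N)) \<M> K w (pooled ?N) (\<lambda>m. T_stat (K m) ?N)"
            unfolding agg_test_eq by simp
          moreover have "finite (pooled ?N)" by (simp add: pooled_sign_split)
          moreover have "\<M> \<noteq> {}" using m by auto
          ultimately have "T_stat (K m) ?N \<le> ?L * sqrt (pair_energy (K m) (pooled ?N))"
            using T_stat_le_if_not_rejects[OF \<alpha> fin _ sum_w _ m w, of "pooled ?N" K "\<lambda>m. T_stat (K m) ?N"] by simp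
          then show "z \<in> {z \<in> space sample. case_prod stat.pair_sum z \<le> ?L * sqrt (case_prod energy z)}"
            using zE by (simp add: z T pe)
        qed
      qed
      have [measurable]: "case_prod stat.pair_sum \<in> borel_measurable sample" "case_prod energy \<in> borel_measurable sample"
        using sample_measurable by auto
      show "{z \<in> space sample. case_prod stat.pair_sum z \<le> ?L * sqrt (case_prod energy z)} \<in> sets sample"
        by measurable
    qed
    also note bound
    finally show ?thesis .
  qed
qed

text \<open>
  The total mass is positive under the separation assumption: otherwise \<open>f - g\<close> vanishes almost
  everywhere, while the term in the supremum norm does not, because \<open>f\<close> and \<open>g\<close> differ at \<open>x0\<close>.
\<close>

lemma kernel_test_power:
  fixes k :: "nat \<Rightarrow> (nat \<Rightarrow> real) \<Rightarrow> real" and h :: "nat \<Rightarrow> nat \<Rightarrow> real" and \<alpha> \<beta> n :: real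
    and \<M>1 \<M>2 :: "nat set"
  defines "\<M> \<equiv> \<M>1 \<times> \<M>2"
  assumes d: "1 \<le> d" and n: "0 < n" and \<alpha>: "0 < \<alpha>" "\<alpha> < 1" and \<beta>: "0 < \<beta>"
    and fin: "finite \<M>" and k: "\<And>m1. m1 \<in> \<M>1 \<Longrightarrow> approx_kernel d (k m1)"
    and h: "\<And>m2 i. m2 \<in> \<M>2 \<Longrightarrow> i < d \<Longrightarrow> 0 < h m2 i"
    and w: "\<And>m. m \<in> \<M> \<Longrightarrow> 0 < w m" and sum_w: "(\<Sum>m\<in>\<M>. exp (- w m)) \<le> 1"
    and f: "intensity (lebesgue_n d) f" and g: "intensity (lebesgue_n d) g" and P: "joint_law (lebesgue_n d) n f g P"
    and x0: "x0 \<in> space (lebesgue_n d)" "f x0 \<noteq> g x0" and m: "(m1, m2) \<in> \<M>"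
    and separated: "(l2_norm (lebesgue_n d) (\<lambda>x. f x - g x))\<^sup>2 \<ge>
       (l2_norm (lebesgue_n d) (\<lambda>x. (f x - g x) - conv_n d (rescaled d (k m1) (h m2)) (\<lambda>y. f y - g y) x))\<^sup>2
       + (4 + 2 * sqrt 2 * 20 * (ln (2 / \<alpha>) + w (m1, m2))) / (n * sqrt \<beta>)
         * sqrt (sup_norm (lebesgue_n d) (\<lambda>x. f x + g x) * l1_norm (lebesgue_n d) (\<lambda>x. f x + g x)
                 * (l2_norm (lebesgue_n d) (k m1))\<^sup>2 / (\<Prod>i<d. h m2 i))
       + 8 * sup_norm (lebesgue_n d) (\<lambda>x. f x + g x) / (\<beta> * n)"
  shows "measure P {N \<in> space P. agg_test \<alpha> \<M> (pair_kernel d k h) w N = 0} \<le> \<beta>"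
proof -
  let ?\<nu> = "lebesgue_n d"
  let ?S = "sup_norm ?\<nu> (\<lambda>x. f x + g x)"
  let ?K = "pair_kernel d k h (m1, m2)"
  let ?c = "(l2_norm ?\<nu> (k m1))\<^sup>2 / (\<Prod>i<d. h m2 i)"
  have m12: "m1 \<in> \<M>1" "m2 \<in> \<M>2" using m unfolding \<M>_def by auto
  have K_eq: "?K x y = rescaled d (k m1) (h m2) (vec_minus d x y)" for x y
    unfolding pair_kernel_def by simp
  have nonneg: "0 \<le> f x" "0 \<le> g x" if "x \<in> space ?\<nu>" for x
    using that f g by (auto simp: intensity_def)
  have "bounded (f ` space ?\<nu>)" "bounded (g ` space ?\<nu>)" using f g by (auto simp: intensity_def)
  then obtain a b where ab: "\<forall>y\<in>f ` space ?\<nu>. norm y \<le> a" "\<forall>y\<in>g ` space ?\<nu>. norm y \<le> b"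
    unfolding bounded_iff by blast
  have bdd: "bdd_above ((\<lambda>x. \<bar>f x + g x\<bar>) ` space ?\<nu>)"
  proof (rule bdd_aboveI2)
    fix x assume "x \<in> space ?\<nu>"
    then have "\<bar>f x\<bar> \<le> a" "\<bar>g x\<bar> \<le> b" using ab by auto
    then show "\<bar>f x + g x\<bar> \<le> a + b" by linarith
  qed
  have S_bound: "f x + g x \<le> ?S" if "x \<in> space ?\<nu>" for x
    unfolding sup_norm_def using cSUP_upper[OF that bdd] by linarith
  have S: "0 < ?S" using S_bound[OF x0(1)] nonneg[OF x0(1)] x0(2) by linarith
  have l1: "l1_norm ?\<nu> (\<lambda>x. f x + g x) = (\<integral>x. f x + g x \<partial>?\<nu>)"
    unfolding l1_norm_def using nonneg by (intro Bochner_Integration.integral_cong) auto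
  have l2: "(l2_norm ?\<nu> u)\<^sup>2 = (\<integral>x. (u x)\<^sup>2 \<partial>?\<nu>)" for u
    unfolding l2_norm_def by (simp add: Bochner_Integration.integral_nonneg)
  have hpos: "0 < (\<Prod>i<d. h m2 i)" using h[OF m12(2)] by (intro prod_pos) auto
  have mass_pos: "0 < (\<integral>x. f x + g x \<partial>?\<nu>)"
  proof (rule ccontr)
    assume "\<not> 0 < (\<integral>x. f x + g x \<partial>?\<nu>)"
    moreover have int: "integrable ?\<nu> (\<lambda>x. f x + g x)" using f g by (auto simp: intensity_def)
    moreover have "0 \<le> (\<integral>x. f x + g x \<partial>?\<nu>)"
      using nonneg by (intro Bochner_Integration.integral_nonneg_AE AE_I2) auto
    ultimately have "AE x in ?\<nu>. f x + g x = 0"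
      using nonneg by (subst integral_nonneg_eq_0_iff_AE[symmetric]) auto
    then have "AE x in ?\<nu>. (f x - g x)\<^sup>2 = 0"
      using AE_space by eventually_elim (use nonneg in \<open>auto simp: add_nonneg_eq_0_iff\<close>)
    then have "(l2_norm ?\<nu> (\<lambda>x. f x - g x))\<^sup>2 = 0"
      unfolding l2 by (rule integral_eq_zero_AE)
    moreover have "0 < 8 * ?S / (\<beta> * n)" using S \<beta> n by simp
    moreover have "0 \<le> (4 + 2 * sqrt 2 * 20 * (ln (2 / \<alpha>) + w (m1, m2))) / (n * sqrt \<beta>)
       * sqrt (?S * l1_norm ?\<nu> (\<lambda>x. f x + g x) * (l2_norm ?\<nu> (k m1))\<^sup>2 / (\<Prod>i<d. h m2 i))"
    proof (intro mult_nonneg_nonneg divide_nonneg_nonneg real_sqrt_ge_zero add_nonneg_nonneg)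
      show "0 \<le> l1_norm ?\<nu> (\<lambda>x. f x + g x)" unfolding l1_norm_def by simp
    qed (use S n \<alpha> \<beta> hpos w[OF m] in auto)
    moreover have "0 \<le> (l2_norm ?\<nu> (\<lambda>x. (f x - g x) - conv_n d (rescaled d (k m1) (h m2)) (\<lambda>y. f y - g y) x))\<^sup>2" by simp
    ultimately show False using separated by linarith
  qed
  have ts: "two_sample ?\<nu> n f g ?K ?c ?S"
  proof (intro two_sample.intro two_sample_axioms.intro sigma_finite_lebesgue_n n f g mass_pos S_bound)
    show "case_prod ?K \<in> borel_measurable (?\<nu> \<Otimes>\<^sub>M ?\<nu>)"
      using scaled_kernel_measurable[OF k[OF m12(1)] h[OF m12(2)]] unfolding K_eq .
    show "?K x y = ?K y x" for x y
      unfolding K_eq by (rule scaled_kernel_sym[OF k[OF m12(1)] h[OF m12(2)]])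
    show "(\<integral>\<^sup>+y. ennreal ((?K x y)\<^sup>2) \<partial>?\<nu>) = ennreal ?c" for x
      unfolding K_eq by (rule scaled_kernel_norm[OF k[OF m12(1)] h[OF m12(2)]])
    show "0 \<le> ?c" using hpos by simp
  qed
  have conv: "conv_n d (rescaled d (k m1) (h m2)) (\<lambda>y. f y - g y) x = (\<integral>y. ?K x y * (f y - g y) \<partial>?\<nu>)" for x
    unfolding conv_n_def K_eq ..
  show ?thesis
    using separated unfolding l1 l2 conv
    by (intro aggregated_test_power[where m = "(m1, m2)" and K = "pair_kernel d k h", OF d ts P \<alpha> \<beta> S fin m w[OF m] sum_w]) (simp only: mult.assoc times_divide_eq_right l2)
qed

text \<open>
  The infimum over the empty set is \<open>\<infinity>\<close> and cannot be below a real number; over a nonempty finite set it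
  is attained, so the theorem follows from the bound for one kernel.
\<close>

lemma INF_le_finite_attained:
  fixes F :: "'a \<Rightarrow> ereal"
  assumes "finite A" "(INF a\<in>A. F a) + y \<le> ereal x" "\<bar>y\<bar> \<noteq> \<infinity>"
  shows "\<exists>a\<in>A. F a + y \<le> ereal x"
proof -
  have "A \<noteq> {}" using assms(2,3) by (cases y) (auto simp: top_ereal_def)
  then have "(INF a\<in>A. F a) \<in> F ` A"
    using assms(1) by (simp add: cInf_eq_Min)
  then show ?thesis using assms(2) by auto
qed

theorem theorem4:
  shows "\<exists>\<kappa>::real. 0 < \<kappa> \<and>
    (\<forall>(d::nat) (n::real) (\<alpha>::real) (\<beta>::real) (\<M>1::nat set) (\<M>2::nat set)
       (k::nat \<Rightarrow> (nat \<Rightarrow> real) \<Rightarrow> real) (h::nat \<Rightarrow> nat \<Rightarrow> real) (w::nat \<times> nat \<Rightarrow> real).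
       1 \<le> d \<and> 0 < n \<and> \<alpha> \<in> {0<..<1} \<and> \<beta> \<in> {0<..<1} \<and>
       finite \<M>1 \<and> finite \<M>2 \<and>
       (\<forall>m1\<in>\<M>1. approx_kernel d (k m1)) \<and>
       (\<forall>m2\<in>\<M>2. \<forall>i<d. 0 < h m2 i) \<and>
       (\<forall>m\<in>\<M>1 \<times> \<M>2. 0 < w m) \<and> (\<Sum>m\<in>\<M>1 \<times> \<M>2. exp (- w m)) \<le> 1 \<longrightarrow>
       (let \<nu> = lebesgue_n d; \<M> = \<M>1 \<times> \<M>2; \<Phi> = agg_test \<alpha> \<M> (pair_kernel d k h) w in
         (\<forall>f g P. intensity \<nu> f \<and> intensity \<nu> g \<and> joint_law \<nu> n f g P \<and>
            (\<forall>x\<in>space \<nu>. f x = g x) \<longrightarrow>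
            measure P {N \<in> space P. \<Phi> N = 1} \<le> \<alpha>) \<and>
         (\<forall>f g P. intensity \<nu> f \<and> intensity \<nu> g \<and> joint_law \<nu> n f g P \<and>
            (\<exists>x\<in>space \<nu>. f x \<noteq> g x) \<and>
            ereal ((l2_norm \<nu> (\<lambda>x. f x - g x))\<^sup>2) \<ge>
              (INF (m1, m2)\<in>\<M>. ereal (
                 (l2_norm \<nu> (\<lambda>x. (f x - g x)
                    - conv_n d (rescaled d (k m1) (h m2)) (\<lambda>y. f y - g y) x))\<^sup>2
                 + (4 + 2 * sqrt 2 * \<kappa> * (ln (2 / \<alpha>) + w (m1, m2))) / (n * sqrt \<beta>)
                   * sqrt (sup_norm \<nu> (\<lambda>x. f x + g x) * l1_norm \<nu> (\<lambda>x. f x + g x)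
                           * (l2_norm \<nu> (k m1))\<^sup>2 / (\<Prod>i<d. h m2 i))))
              + ereal (8 * sup_norm \<nu> (\<lambda>x. f x + g x) / (\<beta> * n)) \<longrightarrow>
            measure P {N \<in> space P. \<Phi> N = 0} \<le> \<beta>)))"
proof (intro exI[of _ 20] conjI allI impI, goal_cases)
  case 1
  show ?case by simp
next
  case (2 d n \<alpha> \<beta> \<M>1 \<M>2 k h w)
  then have d: "1 \<le> d" and n: "0 < n" and \<alpha>: "0 < \<alpha>" "\<alpha> < 1" and \<beta>: "0 < \<beta>" "\<beta> < 1"
    and fin: "finite (\<M>1 \<times> \<M>2)" and k: "\<And>m1. m1 \<in> \<M>1 \<Longrightarrow> approx_kernel d (k m1)"
    and h: "\<And>m2 i. m2 \<in> \<M>2 \<Longrightarrow> i < d \<Longrightarrow> 0 < h m2 i"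
    and w: "\<And>m. m \<in> \<M>1 \<times> \<M>2 \<Longrightarrow> 0 < w m" and sum_w: "(\<Sum>m\<in>\<M>1 \<times> \<M>2. exp (- w m)) \<le> 1"
    by auto
  let ?\<nu> = "lebesgue_n d" and ?\<M> = "\<M>1 \<times> \<M>2" and ?\<Phi> = "agg_test \<alpha> (\<M>1 \<times> \<M>2) (pair_kernel d k h) w"
  have level: "measure P {N \<in> space P. ?\<Phi> N = 1} \<le> \<alpha>"
    if H: "intensity ?\<nu> f" "intensity ?\<nu> g" "joint_law ?\<nu> n f g P" "\<forall>x\<in>space ?\<nu>. f x = g x" for f g P
  proof (cases "?\<M> = {}")
    case True
    then have "{N \<in> space P. ?\<Phi> N = 1} = {}"
      unfolding True agg_test_eq rejects_def by simp
    then show ?thesis using \<alpha> by (simp only: measure_empty)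
  next
    case False
    show ?thesis
      by (rule aggregated_test_level[OF d n H(1-3) _ \<alpha> fin False sum_w]) (use H(4) in auto)
  qed
  let ?F = "\<lambda>f g (m1, m2). ereal (
                 (l2_norm ?\<nu> (\<lambda>x. (f x - g x)
                    - conv_n d (rescaled d (k m1) (h m2)) (\<lambda>y. f y - g y) x))\<^sup>2
                 + (4 + 2 * sqrt 2 * 20 * (ln (2 / \<alpha>) + w (m1, m2))) / (n * sqrt \<beta>)
                   * sqrt (sup_norm ?\<nu> (\<lambda>x. f x + g x) * l1_norm ?\<nu> (\<lambda>x. f x + g x)
                           * (l2_norm ?\<nu> (k m1))\<^sup>2 / (\<Prod>i<d. h m2 i)))"
  have power: "measure P {N \<in> space P. ?\<Phi> N = 0} \<le> \<beta>"
    if H: "intensity ?\<nu> f" "intensity ?\<nu> g" "joint_law ?\<nu> n f g P" "\<exists>x\<in>space ?\<nu>. f x \<noteq> g x"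
      "ereal ((l2_norm ?\<nu> (\<lambda>x. f x - g x))\<^sup>2) \<ge>
         (INF m\<in>?\<M>. ?F f g m) + ereal (8 * sup_norm ?\<nu> (\<lambda>x. f x + g x) / (\<beta> * n))" for f g P
  proof -
    obtain m1 m2 where m: "(m1, m2) \<in> ?\<M>"
      and sep: "?F f g (m1, m2) + ereal (8 * sup_norm ?\<nu> (\<lambda>x. f x + g x) / (\<beta> * n)) \<le> ereal ((l2_norm ?\<nu> (\<lambda>x. f x - g x))\<^sup>2)"
      using INF_le_finite_attained[OF fin H(5)] by auto
    obtain x0 where x0: "x0 \<in> space ?\<nu>" "f x0 \<noteq> g x0" using H(4) by blast
    show ?thesis
      by (rule kernel_test_power[OF d n \<alpha> \<beta>(1) fin k h w sum_w H(1-3) x0 m]) (use sep in simp_all)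
  qed
  show ?case
    unfolding Let_def using level power by blast
qed

end
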